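(* Let $F$ be a field of positive characteristic $p$ and let $L$ be a finite-dimensional, $p$-nilpotent restricted Lie algebra over $F$. If $L$ has nilpotency class $2$ and $p>2$, then its restricted enveloping algebra $u(L)$ does not have a filtered multiplicative basis.
   Context: A restricted Lie algebra $L$ over a field $F$ of characteristic $p>0$ is a Lie algebra with a $p$-map $x\mapsto x^{[p]}$; write $x^{[p]^n}$ for the $n$-fold iterate of the $p$-map applied to $x$. $L$ is $p$-nilpotent if for every $x\in L$ there is $n\ge 1$ with $x^{[p]^n}=0$. The restricted enveloping algebra $u(L)$ is the quotient of the universal enveloping algebra $U(L)$ by the ideal generated by all $x^p-x^{[p]}$, $x\in L$. Nilpotency class $2$ means that $L$ is nilpotent of class exactly $2$ as a Lie algebra, i.e. $[L,L]\neq 0$ and $[[L,L],L]=0$. Filtered multiplicative basis: let $A$ be a finite-dimensional associative algebra over $F$ with Jacobson radical $\mathrm{rad}(A)$. An $F$-basis $\mathfrak{B}$ of $A$ is a filtered multiplicative basis of $A$ if (i) for all $b_1,b_2\in\mathfrak{B}$, either $b_1b_2=0$ or $b_1b_2\in\mathfrak{B}$; and (ii) $\mathfrak{B}\cap\mathrm{rad}(A)$ is an $F$-basis of $\mathrm{rad}(A)$. *)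

theory Defs
  imports
    "HOL-Library.Poly_Mapping"
    "HOL-Computational_Algebra.Polynomial"
    "HOL-Algebra.QuotRing"
    "Jordan_Normal_Form.VS_Connect"
begin

section \<open>Restricted Lie algebras\<close>

locale lie_algebra = vector_space scale
  for scale :: "'f::field \<Rightarrow> 'l::ab_group_add \<Rightarrow> 'l" +
  fixes bracket :: "'l \<Rightarrow> 'l \<Rightarrow> 'l"
  assumes bracket_add_left: "bracket (x + y) z = bracket x z + bracket y z"
    and bracket_add_right: "bracket x (y + z) = bracket x y + bracket x z"
    and bracket_scale_left: "bracket (scale c x) y = scale c (bracket x y)"
    and bracket_scale_right: "bracket x (scale c y) = scale c (bracket x y)"
    and bracket_self: "bracket x x = 0"
    and jacobi: "bracket x (bracket y z) + bracket y (bracket z x) + bracket z (bracket x y) = 0"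

text \<open>
  An element of \<open>L \<otimes> F[t] = L[t]\<close> is represented by a polynomial with coefficients in \<open>L\<close>.
  The first definition is the operator \<open>ad (t x + y)\<close> on \<open>L[t]\<close>. The second is Jacobson's
  element \<open>s\<^sub>i(x, y)\<close>: \<open>i s\<^sub>i(x, y)\<close> is the coefficient of \<open>t\<close> to the power \<open>i - 1\<close>
  in \<open>ad (t x + y)\<close> applied \<open>p - 1\<close> times to \<open>x\<close>, where \<open>p\<close> is the characteristic.
\<close>

definition ad_pencil :: "('l::ab_group_add \<Rightarrow> 'l \<Rightarrow> 'l) \<Rightarrow> 'l \<Rightarrow> 'l \<Rightarrow> 'l poly \<Rightarrow> 'l poly" where
  "ad_pencil bracket x y v = pCons 0 (map_poly (bracket x) v) + map_poly (bracket y) v"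

definition jacobson_s ::
  "('f::field \<Rightarrow> 'l::ab_group_add \<Rightarrow> 'l) \<Rightarrow> ('l \<Rightarrow> 'l \<Rightarrow> 'l) \<Rightarrow> nat \<Rightarrow> 'l \<Rightarrow> 'l \<Rightarrow> 'l" where
  "jacobson_s scale bracket i x y =
     scale (inverse (of_nat i)) (coeff ((ad_pencil bracket x y ^^ (CHAR('f) - 1)) [:x:]) (i - 1))"

locale restricted_lie_algebra = lie_algebra scale bracket
  for scale :: "'f::field \<Rightarrow> 'l::ab_group_add \<Rightarrow> 'l" and bracket +
  fixes pmap :: "'l \<Rightarrow> 'l"
  assumes char_pos: "CHAR('f) > 0"
    and ad_pmap: "bracket (pmap x) y = (bracket x ^^ CHAR('f)) y"
    and pmap_scale: "pmap (scale c x) = scale (c ^ CHAR('f)) (pmap x)"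
    and pmap_add: "pmap (x + y) =
          pmap x + pmap y + (\<Sum>i = 1..CHAR('f) - 1. jacobson_s scale bracket i x y)"

definition p_nilpotent :: "('l::zero \<Rightarrow> 'l) \<Rightarrow> bool" where
  "p_nilpotent pmap \<longleftrightarrow> (\<forall>x. \<exists>n\<ge>1. (pmap ^^ n) x = 0)"

definition lie_product ::
  "('f::field \<Rightarrow> 'l::ab_group_add \<Rightarrow> 'l) \<Rightarrow> ('l \<Rightarrow> 'l \<Rightarrow> 'l) \<Rightarrow> 'l set \<Rightarrow> 'l set \<Rightarrow> 'l set" where
  "lie_product scale bracket X Y = Modules.module.span scale {bracket x y | x y. x \<in> X \<and> y \<in> Y}"

definition nilpotency_class_2 ::
  "('f::field \<Rightarrow> 'l::ab_group_add \<Rightarrow> 'l) \<Rightarrow> ('l \<Rightarrow> 'l \<Rightarrow> 'l) \<Rightarrow> bool" where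
  "nilpotency_class_2 scale bracket \<longleftrightarrow>
     lie_product scale bracket UNIV UNIV \<noteq> {0} \<and>
     lie_product scale bracket (lie_product scale bracket UNIV UNIV) UNIV = {0}"


section \<open>Enveloping algebras\<close>

datatype 'a word = Word (letters: "'a list")

text \<open>
  Words form the free monoid. It is written additively because \<^typ>\<open>'a \<Rightarrow>\<^sub>0 'b\<close> takes its
  convolution product from addition on the index type; thus \<^typ>\<open>'l word \<Rightarrow>\<^sub>0 'f\<close> is the
  free associative unital algebra on the set of all elements of \<^typ>\<open>'l\<close>.
\<close>

instantiation word :: (type) monoid_add
begin

definition zero_word :: "'a word" where
  "zero_word = Word []"

definition plus_word :: "'a word \<Rightarrow> 'a word \<Rightarrow> 'a word" where
  "plus_word u v = Word (letters u @ letters v)"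

instance
  by standard (simp_all add: zero_word_def plus_word_def)

end

definition free_algebra :: "('f::field, 'l word \<Rightarrow>\<^sub>0 'f) module" where
  "free_algebra = \<lparr>carrier = UNIV, mult = (*), one = 1, zero = 0, add = (+),
     smult = (\<lambda>c a. Poly_Mapping.single 0 c * a)\<rparr>"

definition generator :: "'l \<Rightarrow> 'l word \<Rightarrow>\<^sub>0 'f::field" where
  "generator x = Poly_Mapping.single (Word [x]) 1"

text \<open>For an ideal \<open>I\<close> all cosets in the union below coincide, so that \<open>c (I + x) = I + c x\<close>.\<close>

definition quotient_algebra :: "('f, 'a) module \<Rightarrow> 'a set \<Rightarrow> ('f, 'a set) module"
    (infixl \<open>Quot\<^sub>a\<close> 65) where
  "A Quot\<^sub>a I = ring.extend (A Quot I)
     (module.fields (\<lambda>c X. \<Union>x\<in>X. I +>\<^bsub>A\<^esub> (c \<odot>\<^bsub>A\<^esub> x)))"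

text \<open>
  The first two families of relations make the generators depend linearly on the elements of
  \<open>L\<close>, which turns the free algebra on the set \<open>L\<close> into the tensor algebra of the vector
  space \<open>L\<close>; the third one is the defining family of the universal enveloping algebra.
\<close>

definition enveloping_relations ::
  "('f::field \<Rightarrow> 'l::ab_group_add \<Rightarrow> 'l) \<Rightarrow> ('l \<Rightarrow> 'l \<Rightarrow> 'l) \<Rightarrow> ('l word \<Rightarrow>\<^sub>0 'f) set" where
  "enveloping_relations scale bracket =
     {generator (x + y) - (generator x + generator y) | x y. True} \<union>
     {generator (scale c x) - Poly_Mapping.single 0 c * generator x | c x. True} \<union>
     {generator x * generator y - generator y * generator x - generator (bracket x y) | x y. True}"

definition enveloping_ideal ::
  "('f::field \<Rightarrow> 'l::ab_group_add \<Rightarrow> 'l) \<Rightarrow> ('l \<Rightarrow> 'l \<Rightarrow> 'l) \<Rightarrow> ('l word \<Rightarrow>\<^sub>0 'f) set" where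
  "enveloping_ideal scale bracket = Idl\<^bsub>free_algebra\<^esub> (enveloping_relations scale bracket)"

definition universal_enveloping_algebra ::
  "('f::field \<Rightarrow> 'l::ab_group_add \<Rightarrow> 'l) \<Rightarrow> ('l \<Rightarrow> 'l \<Rightarrow> 'l) \<Rightarrow> ('f, ('l word \<Rightarrow>\<^sub>0 'f) set) module"
  where
  "universal_enveloping_algebra scale bracket =
     free_algebra Quot\<^sub>a enveloping_ideal scale bracket"

definition enveloping_map ::
  "('f::field \<Rightarrow> 'l::ab_group_add \<Rightarrow> 'l) \<Rightarrow> ('l \<Rightarrow> 'l \<Rightarrow> 'l) \<Rightarrow> 'l \<Rightarrow> ('l word \<Rightarrow>\<^sub>0 'f) set" where
  "enveloping_map scale bracket x =
     enveloping_ideal scale bracket +>\<^bsub>free_algebra\<^esub> generator x"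

definition restricted_enveloping_algebra ::
  "('f::field \<Rightarrow> 'l::ab_group_add \<Rightarrow> 'l) \<Rightarrow> ('l \<Rightarrow> 'l \<Rightarrow> 'l) \<Rightarrow> ('l \<Rightarrow> 'l) \<Rightarrow>
     ('f, ('l word \<Rightarrow>\<^sub>0 'f) set set) module" where
  "restricted_enveloping_algebra scale bracket pmap =
     (let U = universal_enveloping_algebra scale bracket; \<iota> = enveloping_map scale bracket
      in U Quot\<^sub>a Idl\<^bsub>U\<^esub> {\<iota> x [^]\<^bsub>U\<^esub> CHAR('f) \<ominus>\<^bsub>U\<^esub> \<iota> (pmap x) | x. True})"


section \<open>Jacobson radical and filtered multiplicative bases\<close>

definition left_ideal :: "'a set \<Rightarrow> ('a, 'm) ring_scheme \<Rightarrow> bool" where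
  "left_ideal I R \<longleftrightarrow>
     additive_subgroup I R \<and> (\<forall>r\<in>carrier R. \<forall>x\<in>I. r \<otimes>\<^bsub>R\<^esub> x \<in> I)"

definition maximal_left_ideal :: "'a set \<Rightarrow> ('a, 'm) ring_scheme \<Rightarrow> bool" where
  "maximal_left_ideal I R \<longleftrightarrow>
     left_ideal I R \<and> I \<noteq> carrier R \<and>
     (\<forall>J. left_ideal J R \<and> I \<subseteq> J \<longrightarrow> J = I \<or> J = carrier R)"

definition jacobson_radical :: "('a, 'm) ring_scheme \<Rightarrow> 'a set" where
  "jacobson_radical R = {x \<in> carrier R. \<forall>I. maximal_left_ideal I R \<longrightarrow> x \<in> I}"

definition filtered_multiplicative_basis ::
  "('f, 'k) ring_scheme \<Rightarrow> ('f, 'a) module \<Rightarrow> 'a set \<Rightarrow> bool" where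
  "filtered_multiplicative_basis F A B \<longleftrightarrow>
     vectorspace.basis F A B \<and>
     (\<forall>b\<^sub>1\<in>B. \<forall>b\<^sub>2\<in>B. b\<^sub>1 \<otimes>\<^bsub>A\<^esub> b\<^sub>2 = \<zero>\<^bsub>A\<^esub> \<or> b\<^sub>1 \<otimes>\<^bsub>A\<^esub> b\<^sub>2 \<in> B) \<and>
     vectorspace.basis F (A\<lparr>carrier := jacobson_radical A\<rparr>) (B \<inter> jacobson_radical A)"

end

theory Submission
  imports Defs
begin

text \<open>
  Let \<open>A = u(L)\<close>, let \<open>J\<close> be its augmentation ideal, which is nilpotent and hence the radical, and
  let \<open>I\<close> be the ideal generated by \<open>[L, L]\<close>, i.e. the commutator ideal of \<open>A\<close>. A filtered
  multiplicative basis \<open>B\<close> makes \<open>A\<close> a contracted semigroup algebra with \<open>J\<close> spanned by part of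
  \<open>B\<close>; the ideals \<open>I\<close> and \<open>I J\<^sup>2\<close> are then spanned by differences of elements of \<open>B \<union> {0}\<close>. If
  \<open>2u - v - w\<close> lies in such an ideal for \<open>u, v, w \<in> B \<union> {0}\<close> and \<open>p > 2\<close>, then so does \<open>u - v\<close>.

  As \<open>A\<close> is not commutative, Nakayama gives \<open>b, b' \<in> B \<inter> J\<close> with \<open>c = [b, b'] \<notin> I J\<close>. Class 2
  makes \<open>[L, L]\<close> central, so \<open>[c, b] \<in> I\<^sup>2 \<subseteq> I J\<^sup>2\<close>, that is \<open>2bb'b - bbb' - b'bb \<in> I J\<^sup>2\<close>, and
  therefore \<open>bc \<in> I J\<^sup>2\<close>. Since \<open>b \<notin> J\<^sup>2\<close>, some linear form on \<open>L\<close> that vanishes on \<open>[L, L]\<close> and on all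
  \<open>p\<close>-th powers extends to a derivation \<open>D\<close> of \<open>A\<close> with \<open>D b \<in> 1 + J\<close>. It annihilates \<open>[L, L]\<close> and maps
  \<open>J\<^sup>2\<close> into \<open>J\<close>, so applying it to \<open>bc\<close> gives \<open>c \<in> I J\<close>, a contradiction.

  Noncommutativity of \<open>A\<close> needs no Poincare-Birkhoff-Witt theorem: \<open>y\<close> acts on the commutative
  algebra \<open>u(L\<^sub>a\<^sub>b)\<close>, where \<open>L\<^sub>a\<^sub>b\<close> is \<open>L\<close> with zero bracket, as multiplication by \<open>y\<close> plus the
  derivation that extends \<open>(1/2) [y, _]\<close>.
\<close>

section \<open>Products of ideals modulo a fixed ideal\<close>

locale scalar_algebra = vector_space scl for scl :: "'f::field \<Rightarrow> 'r::ring_1 \<Rightarrow> 'r" +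
  assumes scl_mult_left: "scl c a * b = scl c (a * b)"
    and scl_mult_right: "a * scl c b = scl c (a * b)"
begin

lemma subspace_vimage_linear:
  assumes "Vector_Spaces.linear scl scl D" "subspace Z"
  shows "subspace {a. D a \<in> Z}"
proof -
  interpret D: Vector_Spaces.linear scl scl D by fact
  show ?thesis
    using assms(2) by (auto simp: subspace_def D.add D.scale D.zero)
qed

lemma linear_mult_right: "Vector_Spaces.linear scl scl (\<lambda>a. a * b)"
  by unfold_locales (simp_all add: algebra_simps scl_mult_left)

lemma linear_mult_left: "Vector_Spaces.linear scl scl (\<lambda>a. b * a)"
  by unfold_locales (simp_all add: algebra_simps scl_mult_right)

lemma linear_commutator_right: "Vector_Spaces.linear scl scl (\<lambda>a. a * b - b * a)"
  by unfold_locales (simp_all add: algebra_simps scl_mult_left scl_mult_right scale_right_diff_distrib)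

lemma linear_commutator_left: "Vector_Spaces.linear scl scl (\<lambda>a. b * a - a * b)"
  by unfold_locales (simp_all add: algebra_simps scl_mult_left scl_mult_right scale_right_diff_distrib)

text \<open>The preimage of a subspace under a linear map is a subspace, so membership need only be
  tested on a spanning set. Products and commutators are linear in each argument, which gives the
  two lemmas that follow.\<close>

lemma span_subset_vimage:
  assumes "x \<in> span U" "\<And>u. u \<in> U \<Longrightarrow> D u \<in> Z"
    "Vector_Spaces.linear scl scl D" "subspace Z"
  shows "D x \<in> Z"
proof -
  have "span U \<subseteq> {a. D a \<in> Z}"
    by (rule span_minimal) (use assms subspace_vimage_linear in auto)
  with assms(1) show ?thesis by auto
qed

lemma span_mult_mem:
  assumes "x \<in> span U" "y \<in> span V" "\<And>u v. u \<in> U \<Longrightarrow> v \<in> V \<Longrightarrow> u * v \<in> Z" "subspace Z"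
  shows "x * y \<in> Z"
proof (rule span_subset_vimage[OF assms(1) _ linear_mult_right assms(4)])
  fix u assume "u \<in> U"
  show "u * y \<in> Z"
    by (rule span_subset_vimage[OF assms(2) _ linear_mult_left assms(4)]) (use \<open>u \<in> U\<close> assms in auto)
qed

lemma span_commutator_mem:
  assumes "x \<in> span U" "y \<in> span V" "\<And>u v. u \<in> U \<Longrightarrow> v \<in> V \<Longrightarrow> u * v - v * u \<in> Z" "subspace Z"
  shows "x * y - y * x \<in> Z"
proof (rule span_subset_vimage[OF assms(1) _ linear_commutator_right assms(4)])
  fix u assume "u \<in> U"
  show "u * y - y * u \<in> Z"
    by (rule span_subset_vimage[OF assms(2) _ linear_commutator_left assms(4)]) (use \<open>u \<in> U\<close> assms in auto)
qed

end

text \<open>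
  Computations in the quotient by a fixed ideal \<open>K\<close> are carried out with subspaces that
  contain \<open>K\<close>; accordingly \<open>X \<star> Y\<close> is the product of \<open>X\<close> and \<open>Y\<close> modulo \<open>K\<close>.
\<close>

locale algebra_modulo = scalar_algebra scl for scl :: "'f::field \<Rightarrow> 'r::ring_1 \<Rightarrow> 'r" +
  fixes K :: "'r set"
  assumes subspace_K: "subspace K"
    and K_left: "k \<in> K \<Longrightarrow> r * k \<in> K"
    and K_right: "k \<in> K \<Longrightarrow> k * r \<in> K"
begin

definition prd :: "'r set \<Rightarrow> 'r set \<Rightarrow> 'r set" (infixr \<open>\<star>\<close> 70) where
  "X \<star> Y = span (K \<union> {x * y | x y. x \<in> X \<and> y \<in> Y})"

text \<open>These sets are the preimages of the two-sided ideals of the quotient by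
  \<open>K\<close>.\<close>

definition over_ideal :: "'r set \<Rightarrow> bool" where
  "over_ideal T \<longleftrightarrow> subspace T \<and> K \<subseteq> T \<and> (\<forall>r. \<forall>t\<in>T. r * t \<in> T \<and> t * r \<in> T)"

lemma subspace_prd: "subspace (X \<star> Y)"
  unfolding prd_def by simp

lemma K_subset_prd: "K \<subseteq> X \<star> Y"
  unfolding prd_def by (meson Un_upper1 span_superset subset_trans)

lemma K_mem_prd: "k \<in> K \<Longrightarrow> k \<in> X \<star> Y"
  using K_subset_prd by blast

lemma prd_mem: "x \<in> X \<Longrightarrow> y \<in> Y \<Longrightarrow> x * y \<in> X \<star> Y"
  unfolding prd_def by (rule span_base) blast

lemma prd_least:
  assumes "subspace Z" "K \<subseteq> Z" "\<And>x y. x \<in> X \<Longrightarrow> y \<in> Y \<Longrightarrow> x * y \<in> Z"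
  shows "X \<star> Y \<subseteq> Z"
  unfolding prd_def by (rule span_minimal) (use assms in auto)

lemma prd_left:
  assumes "a \<in> X \<star> Y" "\<And>x. x \<in> X \<Longrightarrow> r * x \<in> X"
  shows "r * a \<in> X \<star> Y"
proof -
  have "X \<star> Y \<subseteq> {a. r * a \<in> X \<star> Y}"
  proof (rule prd_least)
    show "subspace {a. r * a \<in> X \<star> Y}"
      by (rule subspace_vimage_linear[OF linear_mult_left subspace_prd])
  qed (use assms(2) in \<open>auto simp: mult.assoc[symmetric] K_left K_mem_prd prd_mem\<close>)
  with assms(1) show ?thesis by auto
qed

lemma prd_right:
  assumes "a \<in> X \<star> Y" "\<And>y. y \<in> Y \<Longrightarrow> y * r \<in> Y"
  shows "a * r \<in> X \<star> Y"
proof -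
  have "X \<star> Y \<subseteq> {a. a * r \<in> X \<star> Y}"
  proof (rule prd_least)
    show "subspace {a. a * r \<in> X \<star> Y}"
      by (rule subspace_vimage_linear[OF linear_mult_right subspace_prd])
  qed (use assms(2) in \<open>auto simp: mult.assoc K_right K_mem_prd prd_mem\<close>)
  with assms(1) show ?thesis by auto
qed

lemma over_idealD:
  assumes "over_ideal T"
  shows "subspace T" "K \<subseteq> T" "t \<in> T \<Longrightarrow> r * t \<in> T" "t \<in> T \<Longrightarrow> t * r \<in> T"
  using assms unfolding over_ideal_def by auto

lemma over_ideal_prd:
  assumes "\<And>r x. x \<in> X \<Longrightarrow> r * x \<in> X" "\<And>r y. y \<in> Y \<Longrightarrow> y * r \<in> Y"
  shows "over_ideal (X \<star> Y)"
  unfolding over_ideal_def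
  using subspace_prd K_subset_prd prd_left[of _ X Y] prd_right[of _ X Y] assms by blast

lemma prd_subset_left:
  assumes "over_ideal T" shows "T \<star> Y \<subseteq> T"
  by (rule prd_least) (use over_idealD[OF assms] in auto)

text \<open>Elements of \<open>C\<close> are central modulo \<open>K\<close>, so
  \<open>r * (c * y)\<close> and \<open>c * (r * y)\<close> differ by
  \<open>(c * r - r * c) * y\<close>, which lies in \<open>K\<close>. Hence the right ideal
  generated by \<open>C\<close> is two-sided.\<close>

lemma over_ideal_central_prd:
  assumes "\<And>c a. c \<in> C \<Longrightarrow> c * a - a * c \<in> K"
  shows "over_ideal (C \<star> UNIV)"
proof -
  have "r * a \<in> C \<star> UNIV" if "a \<in> C \<star> UNIV" for r a
  proof -
    have "C \<star> UNIV \<subseteq> {a. r * a \<in> C \<star> UNIV}"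
    proof (rule prd_least)
      show "subspace {a. r * a \<in> C \<star> UNIV}"
        by (rule subspace_vimage_linear[OF linear_mult_left subspace_prd])
      show "c * y \<in> {a. r * a \<in> C \<star> UNIV}" if "c \<in> C" for c y
      proof -
        have "(c * r - r * c) * y \<in> C \<star> UNIV"
          using assms[OF that] K_right K_subset_prd by blast
        moreover have "c * (r * y) \<in> C \<star> UNIV" using that by (simp add: prd_mem)
        ultimately have "c * (r * y) - (c * r - r * c) * y \<in> C \<star> UNIV"
          using subspace_diff[OF subspace_prd] by blast
        thus ?thesis by (simp add: algebra_simps)
      qed
    qed (auto simp: K_left K_mem_prd)
    with that show ?thesis by auto
  qed
  thus ?thesis
    unfolding over_ideal_def using subspace_prd K_subset_prd prd_right[of _ C UNIV] by auto
qed

section \<open>Nilpotency modulo an ideal and Nakayama's lemma\<close>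

definition nilpotent_over :: "'r set \<Rightarrow> 'r set \<Rightarrow> bool" where
  "nilpotent_over X Q \<longleftrightarrow> (\<exists>n. \<forall>xs. length xs = n \<longrightarrow> set xs \<subseteq> X \<longrightarrow> prod_list xs \<in> Q)"

text \<open>A product of \<open>n * m\<close> factors from \<open>Y\<close> is cut into
  \<open>n\<close> blocks of length \<open>m\<close>, and each block is a single factor from
  \<open>X\<close>. Nilpotency is stated through lists so that this regrouping is a matter of
  \<open>take\<close> and \<open>drop\<close>.\<close>

lemma nilpotent_over_trans:
  assumes "nilpotent_over X Q" "nilpotent_over Y X"
  shows "nilpotent_over Y Q"
proof -
  from assms obtain n m where n: "\<And>xs. length xs = n \<Longrightarrow> set xs \<subseteq> X \<Longrightarrow> prod_list xs \<in> Q"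
    and m: "\<And>xs. length xs = m \<Longrightarrow> set xs \<subseteq> Y \<Longrightarrow> prod_list xs \<in> X"
    unfolding nilpotent_over_def by meson
  have *: "\<exists>ys. length ys = k \<and> set ys \<subseteq> X \<and> prod_list xs = prod_list ys"
    if "length xs = k * m" "set xs \<subseteq> Y" for k xs
    using that
  proof (induction k arbitrary: xs)
    case (Suc k)
    let ?a = "take m xs" and ?b = "drop m xs"
    have "prod_list ?a \<in> X"
      by (rule m) (use Suc.prems in \<open>auto dest: in_set_takeD\<close>)
    moreover have "\<exists>ys. length ys = k \<and> set ys \<subseteq> X \<and> prod_list ?b = prod_list ys"
      by (rule Suc.IH) (use Suc.prems in \<open>auto dest: in_set_dropD\<close>)
    then obtain ys where "length ys = k" "set ys \<subseteq> X" "prod_list ?b = prod_list ys" by blast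
    moreover have "prod_list xs = prod_list ?a * prod_list ?b"
      by (metis append_take_drop_id prod_list.append)
    ultimately show ?case by (intro exI[of _ "prod_list ?a # ys"]) simp
  qed simp
  have "prod_list xs \<in> Q" if "length xs = n * m" "set xs \<subseteq> Y" for xs
    using *[OF that] n by metis
  thus ?thesis unfolding nilpotent_over_def by blast
qed

lemma nilpotent_over_mono: "nilpotent_over X Q \<Longrightarrow> Y \<subseteq> X \<Longrightarrow> nilpotent_over Y Q"
  unfolding nilpotent_over_def by (meson subset_trans)

text \<open>As \<open>x\<close> is central modulo \<open>Q\<close>, its powers collect on the right:
  a product of \<open>k\<close> elements \<open>q + r * x\<close> is congruent to a left multiple of
  \<open>x ^ k\<close>.\<close>

lemma nilpotent_over_adjoin:
  assumes Q: "over_ideal Q" and c: "\<And>a. x * a - a * x \<in> Q" and n: "x ^ n \<in> Q"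
  shows "nilpotent_over {q + r * x | q r. q \<in> Q} Q"
proof -
  note Q' = over_idealD[OF Q]
  have *: "\<exists>q r. q \<in> Q \<and> prod_list xs = q + r * x ^ length xs"
    if "set xs \<subseteq> {q + r * x | q r. q \<in> Q}" for xs
    using that
  proof (induction xs)
    case Nil
    show ?case using subspace_0[OF Q'(1)] by (intro exI[of _ 0] exI[of _ 1]) simp
  next
    case (Cons y ys)
    then obtain q r q' r' where *: "q \<in> Q" "y = q + r * x" "q' \<in> Q"
      "prod_list ys = q' + r' * x ^ length ys" by auto
    \<comment> \<open>These are the terms of the product that fall into \<open>Q\<close>: those with
      a factor \<open>q\<close> or \<open>q'\<close>, and the error made by moving \<open>x\<close>
      past \<open>r'\<close>.\<close>
    have "q * prod_list ys + r * x * q' + r * (x * r' - r' * x) * x ^ length ys \<in> Q"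
      using * c Q' by (intro subspace_add[OF Q'(1)]) auto
    moreover have "prod_list (y # ys) =
      (q * prod_list ys + r * x * q' + r * (x * r' - r' * x) * x ^ length ys) + (r * r') * x ^ length (y # ys)"
      by (simp add: *(2)) (simp add: *(4) algebra_simps)
    ultimately show ?case by blast
  qed
  have "prod_list xs \<in> Q" if "set xs \<subseteq> {q + r * x | q r. q \<in> Q}" "length xs = n" for xs
    using *[OF that(1)] that(2) n Q' subspace_add[OF Q'(1)] by metis
  thus ?thesis unfolding nilpotent_over_def by blast
qed

text \<open>Elements that are central and nilpotent modulo \<open>Q\<close> are absorbed into
  \<open>Q\<close> one at a time. The hypotheses on the remaining elements persist for the larger
  ideal, and \<open>nilpotent_over_trans\<close> glues the layers.\<close>

lemma nilpotent_over_adjoin_finite: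
  assumes "finite G" "over_ideal Q" "\<And>x a. x \<in> G \<Longrightarrow> x * a - a * x \<in> Q" "\<And>x. x \<in> G \<Longrightarrow> \<exists>n. x ^ n \<in> Q"
  shows "nilpotent_over (span (Q \<union> {r * x | r x. x \<in> G})) Q"
  using assms
proof (induction G arbitrary: Q rule: finite_induct)
  case empty
  have "span Q = Q" using empty by (simp add: over_idealD(1))
  moreover
  have "prod_list xs \<in> Q" if "length xs = 1" "set xs \<subseteq> Q" for xs
    using that by (cases xs) auto
  then have "nilpotent_over Q Q" unfolding nilpotent_over_def by blast
  ultimately show ?case by (simp del: span_eq_iff)
next
  case (insert x G)
  note Q' = over_idealD[OF insert.prems(1)]
  let ?Q = "{q + r * x | q r. q \<in> Q}"
  have sub: "subspace ?Q"
    unfolding subspace_def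
  proof safe
    show "\<exists>q r. 0 = q + r * x \<and> q \<in> Q" using subspace_0[OF Q'(1)] by (intro exI[of _ 0]) auto
    fix q r q' r' assume "q \<in> Q" "q' \<in> Q"
    thus "\<exists>q'' r''. q + r * x + (q' + r' * x) = q'' + r'' * x \<and> q'' \<in> Q"
      using subspace_add[OF Q'(1)] by (intro exI[of _ "q + q'"] exI[of _ "r + r'"]) (auto simp: algebra_simps)
  next
    fix c q r assume "q \<in> Q"
    thus "\<exists>q'' r''. scl c (q + r * x) = q'' + r'' * x \<and> q'' \<in> Q"
      using subspace_scale[OF Q'(1)]
      by (intro exI[of _ "scl c q"] exI[of _ "scl c r"]) (auto simp: scale_right_distrib scl_mult_left)
  qed
  have QQ: "Q \<subseteq> ?Q" by (force intro: exI[of _ 0])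
  have "over_ideal ?Q"
    unfolding over_ideal_def
  proof (intro conjI sub allI ballI)
    show "K \<subseteq> ?Q" using Q' QQ by blast
  next
    fix s t assume "t \<in> ?Q"
    then obtain q r where t: "t = q + r * x" "q \<in> Q" by auto
    have "s * t = s * q + (s * r) * x" using t by (simp add: algebra_simps)
    then show "s * t \<in> ?Q" using t Q' by blast
    have "t * s = (q * s + r * (x * s - s * x)) + (r * s) * x" using t by (simp add: algebra_simps)
    moreover have "q * s + r * (x * s - s * x) \<in> Q"
      using t Q' insert.prems(2) by (intro subspace_add[OF Q'(1)]) auto
    ultimately show "t * s \<in> ?Q" by blast
  qed
  then have "nilpotent_over (span (?Q \<union> {r * x | r x. x \<in> G})) ?Q"
    by (intro insert.IH) (use insert.prems QQ in blast)+
  moreover obtain n where "x ^ n \<in> Q" using insert.prems by blast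
  then have "nilpotent_over ?Q Q"
    using nilpotent_over_adjoin insert.prems by blast
  ultimately have "nilpotent_over (span (?Q \<union> {r * x | r x. x \<in> G})) Q"
    by (rule nilpotent_over_trans[rotated])
  moreover have "Q \<union> {r * y | r y. y \<in> insert x G} \<subseteq> ?Q \<union> {r * x | r x. x \<in> G}"
    using QQ subspace_0[OF Q'(1)] by (auto intro: exI[of _ 0]) (metis add_0_left)+
  ultimately show ?case using nilpotent_over_mono span_mono by blast
qed

text \<open>Iterating the inclusion puts \<open>X\<close> inside the product of \<open>X\<close>
  with all \<open>n\<close>-fold products from \<open>J\<close>, for every \<open>n\<close>; for
  some \<open>n\<close> these products lie in \<open>K\<close>.\<close>

lemma nakayama:
  assumes "nilpotent_over J K" "X \<subseteq> X \<star> J"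
  shows "X \<subseteq> K"
proof -
  have *: "X \<subseteq> X \<star> {prod_list xs | xs. length xs = n \<and> set xs \<subseteq> J}" (is "_ \<subseteq> X \<star> ?P n") for n
  proof (induction n)
    case 0
    show ?case using prd_mem[of _ X 1] by force
  next
    case (Suc n)
    have "X \<star> ?P n \<subseteq> X \<star> ?P (Suc n)"
    proof (rule prd_least[OF subspace_prd K_subset_prd])
      fix x y assume "x \<in> X" "y \<in> ?P n"
      then obtain xs where y: "y = prod_list xs" "length xs = n" "set xs \<subseteq> J" by auto
      have "X \<star> J \<subseteq> {a. a * y \<in> X \<star> ?P (Suc n)}"
      proof (rule prd_least)
        show "subspace {a. a * y \<in> X \<star> ?P (Suc n)}"
          by (rule subspace_vimage_linear[OF linear_mult_right subspace_prd])
        show "x * j \<in> {a. a * y \<in> X \<star> ?P (Suc n)}" if "x \<in> X" "j \<in> J" for x j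
          using that y by (auto simp: mult.assoc intro!: prd_mem exI[of _ "j # xs"])
      qed (auto simp: K_right K_mem_prd)
      with \<open>x \<in> X\<close> assms(2) show "x * y \<in> X \<star> ?P (Suc n)" by blast
    qed
    with Suc show ?case by blast
  qed
  obtain n where "?P n \<subseteq> K" using assms(1) unfolding nilpotent_over_def by blast
  then have "X \<star> ?P n \<subseteq> K"
    by (intro prd_least subspace_K) (auto intro: K_left)
  with * show ?thesis by blast
qed

end

section \<open>Contracted semigroup algebras\<close>

text \<open>\<open>S\<close> models the preimage of a multiplicative basis together with zero, and
  \<open>K\<close> is the fibre over zero. The axiom \<open>functional\<close> encodes linear
  independence of the basis in the form in which it is used: every 0-1 assignment to the classes of
  \<open>S\<close> modulo \<open>K\<close> that is 0 on the zero class extends to a linear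
  form.\<close>

locale contracted_semigroup_algebra = algebra_modulo scl K
  for scl :: "'f::field \<Rightarrow> 'r::ring_1 \<Rightarrow> 'r" and K +
  fixes S :: "'r set"
  assumes S_mult: "s \<in> S \<Longrightarrow> t \<in> S \<Longrightarrow> s * t \<in> S"
    and K_subset_S: "K \<subseteq> S"
    and span_S: "span S = UNIV"
    and functional: "\<lbrakk>\<And>s t. s \<in> S \<Longrightarrow> t \<in> S \<Longrightarrow> s - t \<in> K \<Longrightarrow> P s = P t; \<And>s. s \<in> K \<Longrightarrow> \<not> P s\<rbrakk>
      \<Longrightarrow> \<exists>f. Vector_Spaces.linear scl (*) f \<and> (\<forall>s\<in>S. f s = of_bool (P s))"
begin

text \<open>For an ideal \<open>X\<close> containing \<open>K\<close> this says that only elements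
  of \<open>S\<close> are identified with each other or with zero, so the quotient by
  \<open>X\<close> is again a contracted semigroup algebra.\<close>

definition contracted :: "'r set \<Rightarrow> bool" where
  "contracted X \<longleftrightarrow> X \<subseteq> span {s - t | s t. s \<in> S \<and> t \<in> S \<and> s - t \<in> X}"

lemma zero_in_S: "0 \<in> S"
  using K_subset_S subspace_0[OF subspace_K] by blast

text \<open>The nonzero classes of \<open>S\<close> modulo \<open>X\<close> are independent, so in
  \<open>2u - v - w\<close> the coefficient of each such class must vanish. With 1 and 2 nonzero in
  the field, this forces \<open>u\<close>, \<open>v\<close> and \<open>w\<close> into one
  class.\<close>

lemma contracted_double:
  assumes char: "CHAR('f) > 2" and X: "contracted X" "subspace X" "K \<subseteq> X"
    and S: "u \<in> S" "v \<in> S" "w \<in> S" and eq: "u + u - v - w \<in> X"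
  shows "u - v \<in> X"
proof -
  have two: "(1 + 1 :: 'f) \<noteq> 0"
    using char of_nat_eq_0_iff_char_dvd[of 2, where 'a='f] by (auto dest: dvd_imp_le)
  \<comment> \<open>This is the indicator of the class of \<open>a\<close> modulo \<open>X\<close>.
    It kills every difference \<open>s - t\<close> in \<open>X\<close> because \<open>s\<close> and
    \<open>t\<close> are then in the same class, and \<open>X\<close> is spanned by such
    differences.\<close>
  have class_functional: "\<exists>f. Vector_Spaces.linear scl (*) f \<and> (\<forall>s\<in>S. f s = of_bool (s - a \<in> X)) \<and> (\<forall>x\<in>X. f x = 0)"
    if "a \<notin> X" for a
  proof -
    have iff: "s - a \<in> X \<longleftrightarrow> t - a \<in> X" if "s - t \<in> X" for s t
      using that subspace_diff[OF X(2), of "s - a" "s - t"] subspace_add[OF X(2), of "t - a" "s - t"]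
      by auto
    have "\<not> s - a \<in> X" if "s \<in> X" for s
      using that \<open>a \<notin> X\<close> subspace_diff[OF X(2), of s "s - a"] by auto
    then obtain f where f: "Vector_Spaces.linear scl (*) f" "\<forall>s\<in>S. f s = of_bool (s - a \<in> X)"
      using functional[of "\<lambda>s. s - a \<in> X"] iff X(3) by blast
    interpret f: Vector_Spaces.linear scl "(*)" f by fact
    have "span {s - t | s t. s \<in> S \<and> t \<in> S \<and> s - t \<in> X} \<subseteq> {x. f x = 0}"
    proof (rule span_minimal)
      show "subspace {x. f x = 0}" by (simp add: subspace_def f.add f.zero f.scale)
      have "f (s - t) = 0" if "s \<in> S" "t \<in> S" "s - t \<in> X" for s t
        using f(2) that iff[OF that(3)] by (simp add: f.diff)
      then show "{s - t | s t. s \<in> S \<and> t \<in> S \<and> s - t \<in> X} \<subseteq> {x. f x = 0}" by blast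
    qed
    with f X(1) show ?thesis unfolding contracted_def by blast
  qed
  show ?thesis
  proof (cases "u \<in> X")
    case False
    then obtain f where f: "Vector_Spaces.linear scl (*) f" "\<forall>s\<in>S. f s = of_bool (s - u \<in> X)" "\<forall>x\<in>X. f x = 0"
      using class_functional by blast
    interpret f: Vector_Spaces.linear scl "(*)" f by fact
    have "f u + f u - f v - f w = 0" using f(3) eq by (metis f.add f.diff)
    \<comment> \<open>The indicator of the class of \<open>u\<close> turns the relation into 2 =
      [v ~ u] + [w ~ u], and both brackets must equal 1.\<close>
    then have "v - u \<in> X" using f(2) S two subspace_0[OF X(2)]
      by (cases "v - u \<in> X"; cases "w - u \<in> X") auto
    then show ?thesis using subspace_neg[OF X(2)] by (metis minus_diff_eq)
  next
    case True
    \<comment> \<open>Here \<open>u\<close> counts as zero. If \<open>v\<close> did not, the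
      indicator of its class would give 1 + [w ~ v] = 0, where the left side is 1 or 2.\<close>
    have "v \<in> X"
    proof (rule ccontr)
      assume "v \<notin> X"
      then obtain f where f: "Vector_Spaces.linear scl (*) f" "\<forall>s\<in>S. f s = of_bool (s - v \<in> X)" "\<forall>x\<in>X. f x = 0"
        using class_functional by blast
      interpret f: Vector_Spaces.linear scl "(*)" f by fact
      have "f u + f u - f v - f w = 0" using f(3) eq by (metis f.add f.diff)
      moreover have "f u = 0" using f(3) True by blast
      ultimately have "f v + f w = 0" by (simp add: eq_neg_iff_add_eq_0[symmetric] neg_eq_iff_add_eq_0)
      then show False using f(2) S two subspace_0[OF X(2)]
        by (cases "w - v \<in> X") auto
    qed
    with True show ?thesis using subspace_diff[OF X(2)] by blast
  qed
qed

text \<open>For \<open>v\<close> in \<open>S\<close> and \<open>s\<close>, \<open>t\<close> in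
  \<open>S\<close>, the product of \<open>s - t\<close> with \<open>v\<close> is the difference of
  \<open>s * v\<close> and \<open>t * v\<close>, both again in \<open>S\<close>; bilinearity does
  the rest.\<close>

lemma contracted_prd:
  assumes X: "contracted X" "\<And>x r. x \<in> X \<Longrightarrow> x * r \<in> X" and T: "T \<subseteq> span (S \<inter> T)"
  shows "contracted (X \<star> T)"
proof -
  let ?G = "{s - t | s t. s \<in> S \<and> t \<in> S \<and> s - t \<in> X \<star> T}"
  have "X \<star> T \<subseteq> span ?G"
  proof (rule prd_least)
    have "k \<in> ?G" if "k \<in> K" for k
      using that K_subset_S zero_in_S K_mem_prd[OF that]
      by (intro CollectI exI[of _ k] exI[of _ 0]) auto
    then show "K \<subseteq> span ?G" using span_base by blast
  next
    fix x y assume "x \<in> X" "y \<in> T"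
    then have "x \<in> span {s - t | s t. s \<in> S \<and> t \<in> S \<and> s - t \<in> X}" "y \<in> span (S \<inter> T)"
      using X(1) T unfolding contracted_def by auto
    then show "x * y \<in> span ?G"
    proof (rule span_mult_mem)
      fix u v assume "u \<in> {s - t | s t. s \<in> S \<and> t \<in> S \<and> s - t \<in> X}" "v \<in> S \<inter> T"
      then obtain s t where *: "u = s - t" "s \<in> S" "t \<in> S" "s - t \<in> X" "v \<in> S" "v \<in> T" by auto
      have "u * v = s * v - t * v" by (simp add: * algebra_simps)
      moreover have "s * v - t * v \<in> X \<star> T" using prd_mem[of "s - t" X v T] * by (simp add: algebra_simps)
      ultimately show "u * v \<in> span ?G" using S_mult * by (intro span_base) auto
    qed simp
  qed simp
  then show ?thesis unfolding contracted_def .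
qed

lemma spanned_by_S_prd:
  assumes "X \<subseteq> span (S \<inter> X)" "Y \<subseteq> span (S \<inter> Y)"
  shows "X \<star> Y \<subseteq> span (S \<inter> (X \<star> Y))"
proof (rule prd_least)
  show "K \<subseteq> span (S \<inter> (X \<star> Y))" using K_subset_S K_mem_prd span_base by blast
  fix x y assume "x \<in> X" "y \<in> Y"
  with assms have "x \<in> span (S \<inter> X)" "y \<in> span (S \<inter> Y)" by auto
  then show "x * y \<in> span (S \<inter> (X \<star> Y))"
    by (rule span_mult_mem) (auto intro!: span_base S_mult prd_mem)
qed simp

text \<open>For \<open>u\<close>, \<open>v\<close>, \<open>r\<close> in \<open>S\<close> the element
  \<open>(u * v - v * u) * r\<close> is visibly a difference of elements of \<open>S\<close>. Since
  \<open>S\<close> spans the algebra, multilinearity reaches every commutator and every right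
  factor.\<close>

lemma contracted_commutator_ideal:
  assumes C: "C \<subseteq> span (K \<union> {a * b - b * a | a b. True})" and comm: "\<And>a b. a * b - b * a \<in> C \<star> UNIV"
  shows "contracted (C \<star> UNIV)"
proof -
  let ?G = "{s - t | s t. s \<in> S \<and> t \<in> S \<and> s - t \<in> C \<star> UNIV}"
  have KG: "K \<subseteq> ?G"
  proof
    fix k assume "k \<in> K"
    then show "k \<in> ?G"
      using K_subset_S zero_in_S K_mem_prd[of k]
      by (intro CollectI exI[of _ k] exI[of _ 0]) auto
  qed
  have GI: "(a * b - b * a) * r \<in> C \<star> UNIV" for a b r
    using comm prd_right by auto
  have *: "(a * b - b * a) * r \<in> span ?G" if "r \<in> S" for a b r
  proof -
    have "a \<in> span S" "b \<in> span S" by (auto simp: span_S)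
    then have "a * b - b * a \<in> {x. x * r \<in> span ?G}"
    proof (rule span_commutator_mem)
      fix u v assume "u \<in> S" "v \<in> S"
      then have "u * v * r - v * u * r \<in> ?G"
        using GI[of u v r] S_mult that
        by (intro CollectI exI[of _ "u * v * r"] exI[of _ "v * u * r"]) (simp add: left_diff_distrib)
      then show "u * v - v * u \<in> {x. x * r \<in> span ?G}"
        using span_base by (auto simp: left_diff_distrib)
    qed (rule subspace_vimage_linear[OF linear_mult_right subspace_span])
    then show ?thesis by simp
  qed
  have "C \<star> UNIV \<subseteq> span ?G"
  proof (rule prd_least)
    show "K \<subseteq> span ?G" using KG span_base by blast
    fix c r assume "c \<in> C"
    with C have "c \<in> span (K \<union> {a * b - b * a | a b. True})" by blast
    moreover have "r \<in> span S" by (simp add: span_S)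
    ultimately show "c * r \<in> span ?G"
    proof (rule span_mult_mem)
      fix u v assume u: "u \<in> K \<union> {a * b - b * a | a b. True}" and v: "v \<in> S"
      show "u * v \<in> span ?G"
      proof (cases "u \<in> K")
        case True
        then have "u * v \<in> ?G" using K_right KG by blast
        then show ?thesis by (rule span_base)
      next
        case False
        then obtain a b where "u = a * b - b * a" using u by blast
        then show ?thesis using *[OF v, of a b] by simp
      qed
    qed simp
  qed simp
  then show ?thesis unfolding contracted_def .
qed

text \<open>The Lie algebra is abstracted away: \<open>C\<close> stands for the brackets,
  \<open>J\<close> for the augmentation ideal, and the last hypothesis supplies a partial derivative
  in the direction of \<open>b\<close>.\<close>

lemma no_contracted_radical:
  assumes char: "CHAR('f) > 2"
    and J: "over_ideal J" "J \<subseteq> span (S \<inter> J)" "nilpotent_over J K"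
    and C: "C \<subseteq> J \<star> J" "C \<subseteq> span (K \<union> {a * b - b * a | a b. a \<in> J \<and> b \<in> J})" "\<not> C \<subseteq> K"
    and central: "\<And>c a. c \<in> C \<Longrightarrow> c * a - a * c \<in> K"
    and comm: "\<And>a b. a * b - b * a \<in> C \<star> UNIV"
    and derivation: "\<And>b. b \<in> J \<Longrightarrow> b \<notin> J \<star> J \<Longrightarrow>
      \<exists>D. Vector_Spaces.linear scl scl D \<and> (\<forall>a b. D (a * b) = D a * b + a * D b) \<and>
        D ` K \<subseteq> K \<and> D ` C \<subseteq> K \<and> D b - 1 \<in> J"
  shows False
proof -
  define I where "I = C \<star> UNIV"
  define J2 where "J2 = J \<star> J"
  note J' = over_idealD[OF J(1)]
  have I: "over_ideal I" unfolding I_def by (rule over_ideal_central_prd) (rule central)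
  note I' = over_idealD[OF I]
  have J2: "over_ideal J2" unfolding J2_def by (rule over_ideal_prd) (use J' in auto)
  note J2' = over_idealD[OF J2]
  have IJ: "over_ideal (I \<star> J)" by (rule over_ideal_prd) (use I' J' in auto)
  note IJ' = over_idealD[OF IJ]
  have IJ2: "over_ideal (I \<star> J2)" by (rule over_ideal_prd) (use I' J2' in auto)
  note IJ2' = over_idealD[OF IJ2]
  have CI: "C \<subseteq> I" unfolding I_def using prd_mem[of _ C 1] by fastforce
  have I_J2: "I \<subseteq> J2" unfolding I_def
    by (rule prd_least) (use C(1) J2' in \<open>auto simp: J2_def\<close>)
  \<comment> \<open>Modulo \<open>K\<close> an element \<open>j\<close> passes the central
    \<open>c\<close>, so \<open>j * (c * r)\<close> becomes \<open>c * (j * r)\<close> with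
    \<open>j * r\<close> in \<open>J\<close>.\<close>
  have JI: "J \<star> I \<subseteq> I \<star> J"
  proof (rule prd_least[OF IJ'(1,2)])
    fix j i assume j: "j \<in> J" and "i \<in> I"
    have "I \<subseteq> {a. j * a \<in> I \<star> J}"
      unfolding I_def
    proof (rule prd_least, fold I_def)
      show "subspace {a. j * a \<in> I \<star> J}" by (rule subspace_vimage_linear[OF linear_mult_left IJ'(1)])
      fix c r assume c: "c \<in> C"
      have "c * (j * r) \<in> I \<star> J" using c CI j J'(4) by (intro prd_mem) auto
      moreover have "(c * j - j * c) * r \<in> I \<star> J" by (intro K_mem_prd K_right central c)
      ultimately have "c * (j * r) - (c * j - j * c) * r \<in> I \<star> J"
        by (rule subspace_diff[OF IJ'(1)])
      then show "c * r \<in> {a. j * a \<in> I \<star> J}" by (simp add: algebra_simps)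
    qed (auto simp: K_left K_mem_prd)
    with \<open>i \<in> I\<close> show "j * i \<in> I \<star> J" by auto
  qed
  \<comment> \<open>Otherwise all commutators of \<open>J\<close> would lie in
    \<open>I \<star> J\<close>, hence so would \<open>C\<close> and then \<open>I\<close>; Nakayama
    would give \<open>I \<subseteq> K\<close>, although \<open>C\<close> is not contained in
    \<open>K\<close>.\<close>
  have "\<exists>b1 b2. b1 \<in> S \<inter> J \<and> b2 \<in> S \<inter> J \<and> b1 * b2 - b2 * b1 \<notin> I \<star> J"
  proof (rule ccontr)
    assume "\<not> ?thesis"
    then have *: "a * b - b * a \<in> I \<star> J" if "a \<in> S \<inter> J" "b \<in> S \<inter> J" for a b
      using that by blast
    have **: "a * b - b * a \<in> I \<star> J" if "a \<in> J" "b \<in> J" for a b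
      by (rule span_commutator_mem[of _ "S \<inter> J" _ "S \<inter> J"]) (use that J(2) * IJ' in auto)
    have "span (K \<union> {a * b - b * a | a b. a \<in> J \<and> b \<in> J}) \<subseteq> I \<star> J"
      by (rule span_minimal[OF _ IJ'(1)]) (use ** IJ'(2) in auto)
    with C(2) have "C \<subseteq> I \<star> J" by blast
    then have "I \<subseteq> I \<star> J"
      using prd_least[OF IJ'(1,2), of C UNIV] IJ'(4) unfolding I_def by blast
    with nakayama J(3) have "I \<subseteq> K" by blast
    with CI C(3) show False by blast
  qed
  then obtain b1 b2 where b: "b1 \<in> S" "b1 \<in> J" "b2 \<in> S" "b2 \<in> J" and c: "b1 * b2 - b2 * b1 \<notin> I \<star> J"
    by blast
  define c where "c = b1 * b2 - b2 * b1"
  have cI: "c \<in> I" unfolding c_def I_def by (rule comm)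
  \<comment> \<open>The commutator with \<open>b2\<close> is a derivation with values in
    \<open>I\<close>, so it maps \<open>J2\<close> into \<open>J \<star> I\<close> plus
    \<open>I \<star> J\<close>, that is, into \<open>I \<star> J\<close>. The commutator of
    \<open>b1\<close> and \<open>b2\<close> lies outside that ideal.\<close>
  have "b1 \<notin> J2"
  proof
    have "J2 \<subseteq> {a. a * b2 - b2 * a \<in> I \<star> J}"
      unfolding J2_def
    proof (rule prd_least)
      show "subspace {a. a * b2 - b2 * a \<in> I \<star> J}"
        by (rule subspace_vimage_linear[OF linear_commutator_right IJ'(1)])
      show "K \<subseteq> {a. a * b2 - b2 * a \<in> I \<star> J}"
        using K_left K_right subspace_diff[OF subspace_K] K_mem_prd by auto
      fix j j' assume j: "j \<in> J" "j' \<in> J"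
      have "j * (j' * b2 - b2 * j') \<in> I \<star> J"
        using JI prd_mem[of j J _ I] comm j unfolding I_def by blast
      moreover have "(j * b2 - b2 * j) * j' \<in> I \<star> J"
        using comm j unfolding I_def by (intro prd_mem) auto
      ultimately have "j * (j' * b2 - b2 * j') + (j * b2 - b2 * j) * j' \<in> I \<star> J"
        by (rule subspace_add[OF IJ'(1)])
      then show "j * j' \<in> {a. a * b2 - b2 * a \<in> I \<star> J}" by (simp add: algebra_simps)
    qed
    moreover assume "b1 \<in> J2"
    ultimately show False using c by blast
  qed
  \<comment> \<open>By the Leibniz rule the commutator of \<open>z * r\<close> with
    \<open>b1\<close> is \<open>z\<close> times a commutator, modulo \<open>K\<close>. Both factors
    lie in \<open>I\<close>, and \<open>I \<subseteq> J2\<close>.\<close>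
  have "I \<subseteq> {a. a * b1 - b1 * a \<in> I \<star> J2}"
    unfolding I_def
  proof (rule prd_least, fold I_def)
    show "subspace {a. a * b1 - b1 * a \<in> I \<star> J2}"
      by (rule subspace_vimage_linear[OF linear_commutator_right IJ2'(1)])
    show "K \<subseteq> {a. a * b1 - b1 * a \<in> I \<star> J2}"
      using K_left K_right subspace_diff[OF subspace_K] K_mem_prd by auto
    fix z r assume z: "z \<in> C"
    have "z * (r * b1 - b1 * r) \<in> I \<star> J2"
      using z CI I_J2 comm[of r b1, folded I_def] by (intro prd_mem) auto
    moreover have "(z * b1 - b1 * z) * r \<in> I \<star> J2"
      by (intro K_mem_prd K_right central z)
    ultimately have "z * (r * b1 - b1 * r) + (z * b1 - b1 * z) * r \<in> I \<star> J2"
      by (rule subspace_add[OF IJ2'(1)])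
    then show "z * r \<in> {a. a * b1 - b1 * a \<in> I \<star> J2}" by (simp add: algebra_simps)
  qed
  with cI have "c * b1 - b1 * c \<in> I \<star> J2" by blast
  then have eq: "b1 * b2 * b1 + b1 * b2 * b1 - b1 * b1 * b2 - b2 * b1 * b1 \<in> I \<star> J2"
    by (simp add: c_def algebra_simps)
  have contr: "contracted (I \<star> J2)"
  proof (rule contracted_prd)
    have "C \<subseteq> span (K \<union> {a * b - b * a | a b. True})"
      by (rule subset_trans[OF C(2)]) (rule span_mono, auto)
    then show "contracted I" unfolding I_def by (rule contracted_commutator_ideal) (rule comm)
    show "J2 \<subseteq> span (S \<inter> J2)" unfolding J2_def by (rule spanned_by_S_prd) (rule J)+
  qed (rule I')
  \<comment> \<open>\<open>contracted_double\<close> with \<open>u = b1 * b2 * b1\<close>; the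
    resulting difference is the negative of \<open>b1 * c\<close>.\<close>
  have "b1 * b2 * b1 - b1 * b1 * b2 \<in> I \<star> J2"
    by (rule contracted_double[OF char contr IJ2'(1,2) _ _ _ eq]) (intro S_mult b)+
  then have "- (b1 * b2 * b1 - b1 * b1 * b2) \<in> I \<star> J2" by (rule subspace_neg[OF IJ2'(1)])
  then have b1c: "b1 * c \<in> I \<star> J2" by (simp add: c_def algebra_simps)
  obtain D where D: "Vector_Spaces.linear scl scl D" "\<And>a b. D (a * b) = D a * b + a * D b"
    "D ` K \<subseteq> K" "D ` C \<subseteq> K" "D b1 - 1 \<in> J"
    using derivation[OF b(2)] \<open>b1 \<notin> J2\<close> unfolding J2_def by blast
  have DI: "I \<subseteq> {a. D a \<in> I}"
    unfolding I_def
  proof (rule prd_least, fold I_def)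
    show "subspace {a. D a \<in> I}" by (rule subspace_vimage_linear[OF D(1) I'(1)])
    show "K \<subseteq> {a. D a \<in> I}" using D(3) I'(2) by blast
    show "z * r \<in> {a. D a \<in> I}" if "z \<in> C" for z r
    proof -
      have "D z \<in> I" "z \<in> I" using that D(4) CI I'(2) by auto
      then show ?thesis using I'(4) by (simp add: D(2) subspace_add[OF I'(1)])
    qed
  qed
  have DJ2: "J2 \<subseteq> {a. D a \<in> J}"
    unfolding J2_def
  proof (rule prd_least)
    show "subspace {a. D a \<in> J}" by (rule subspace_vimage_linear[OF D(1) J'(1)])
    show "K \<subseteq> {a. D a \<in> J}" using D(3) J'(2) by blast
    show "z * r \<in> {a. D a \<in> J}" if "z \<in> J" "r \<in> J" for z r
      using that J' by (auto simp: D(2) intro!: subspace_add[OF J'(1)])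
  qed
  have J2J: "J2 \<subseteq> J" unfolding J2_def by (rule prd_subset_left) (rule J)
  \<comment> \<open>The Leibniz rule gives \<open>D z * r\<close> with \<open>D z\<close> in
    \<open>I\<close> and \<open>r\<close> in \<open>J\<close>, and \<open>z * D r\<close> with
    \<open>z\<close> in \<open>I\<close> and \<open>D r\<close> in \<open>J\<close>.\<close>
  have "I \<star> J2 \<subseteq> {a. D a \<in> I \<star> J}"
  proof (rule prd_least)
    show "subspace {a. D a \<in> I \<star> J}" by (rule subspace_vimage_linear[OF D(1) IJ'(1)])
    show "K \<subseteq> {a. D a \<in> I \<star> J}" using D(3) K_mem_prd by blast
    show "z * r \<in> {a. D a \<in> I \<star> J}" if "z \<in> I" "r \<in> J2" for z r
      using that DI DJ2 J2J by (auto simp: D(2) intro!: subspace_add[OF IJ'(1)] prd_mem)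
  qed
  with b1c have "D b1 * c + b1 * D c \<in> I \<star> J" by (auto simp: D(2))
  moreover have "b1 * D c \<in> I \<star> J" using JI prd_mem[of b1 J "D c" I] b DI cI by blast
  moreover have "(D b1 - 1) * c \<in> I \<star> J" using JI prd_mem[of "D b1 - 1" J c I] D(5) cI by blast
  \<comment> \<open>Since \<open>D b1\<close> is 1 modulo \<open>J\<close>, what remains of
    \<open>D (b1 * c)\<close> after removing terms in \<open>J \<star> I\<close> is \<open>c\<close>
    itself.\<close>
  ultimately have "(D b1 * c + b1 * D c) - b1 * D c - (D b1 - 1) * c \<in> I \<star> J"
    by (intro subspace_diff[OF IJ'(1)])
  then have "c \<in> I \<star> J" by (simp add: algebra_simps)
  with c show False unfolding c_def by blast
qed

end

section \<open>The free algebra and its derivations\<close>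

definition word_monomial :: "'l list \<Rightarrow> 'l word \<Rightarrow>\<^sub>0 'f::field" where
  "word_monomial xs = Poly_Mapping.single (Word xs) 1"

definition scalar_mult :: "'f::field \<Rightarrow> ('l word \<Rightarrow>\<^sub>0 'f) \<Rightarrow> 'l word \<Rightarrow>\<^sub>0 'f" where
  "scalar_mult c a = Poly_Mapping.single 0 c * a"

lemma poly_mapping_sum_single:
  fixes a :: "'a \<Rightarrow>\<^sub>0 'b::comm_monoid_add"
  shows "a = (\<Sum>w\<in>Poly_Mapping.keys a. Poly_Mapping.single w (Poly_Mapping.lookup a w))"
  by (rule poly_mapping_eqI) (auto simp: lookup_sum lookup_single when_def in_keys_iff)

lemma poly_mapping_single_induct:
  fixes a :: "'a \<Rightarrow>\<^sub>0 'b::comm_monoid_add"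
  assumes "P 0" "\<And>w c. P (Poly_Mapping.single w c)" "\<And>a b. P a \<Longrightarrow> P b \<Longrightarrow> P (a + b)"
  shows "P a"
proof -
  have "P (\<Sum>w\<in>A. Poly_Mapping.single w (Poly_Mapping.lookup a w))" if "finite A" for A
    using that by (induction A rule: finite_induct) (auto intro: assms)
  then show ?thesis by (subst poly_mapping_sum_single) simp
qed

lemma single_zero_commute:
  fixes a :: "'l word \<Rightarrow>\<^sub>0 'f::field"
  shows "a * Poly_Mapping.single 0 c = Poly_Mapping.single 0 c * a"
  by (induction a rule: poly_mapping_single_induct)
    (simp_all add: mult_single distrib_left distrib_right mult.commute)

lemma plus_Word: "Word xs + Word ys = Word (xs @ ys)"
  by (simp add: plus_word_def)

lemma monomial_append: "word_monomial (xs @ ys) = word_monomial xs * word_monomial ys"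
  by (simp add: word_monomial_def mult_single plus_Word)

lemma monomial_Nil: "word_monomial [] = 1"
  unfolding word_monomial_def by (simp flip: zero_word_def)

lemma monomial_singleton: "word_monomial [x] = generator x"
  by (simp add: word_monomial_def generator_def)

lemma monomial_Cons: "word_monomial (x # xs) = generator x * word_monomial xs"
  using monomial_append[of "[x]" xs] by (simp add: monomial_singleton)

lemma single_eq_scalar_mult_monomial:
  "Poly_Mapping.single w c = scalar_mult c (word_monomial (letters w))"
  by (simp add: scalar_mult_def word_monomial_def mult_single)

interpretation free: scalar_algebra "scalar_mult :: 'f::field \<Rightarrow> ('l word \<Rightarrow>\<^sub>0 'f) \<Rightarrow> _"
proof unfold_locales
  fix c d :: 'f and a b :: "'l word \<Rightarrow>\<^sub>0 'f"
  show "scalar_mult c (a + b) = scalar_mult c a + scalar_mult c b"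
    by (simp add: scalar_mult_def distrib_left)
  show "scalar_mult (c + d) a = scalar_mult c a + scalar_mult d a"
    by (simp add: scalar_mult_def distrib_right single_add)
  have "Poly_Mapping.single 0 c * Poly_Mapping.single 0 d = (Poly_Mapping.single 0 (c * d) :: 'l word \<Rightarrow>\<^sub>0 'f)"
    by (simp add: mult_single)
  then show "scalar_mult c (scalar_mult d a) = scalar_mult (c * d) a"
    by (metis scalar_mult_def mult.assoc)
  show "scalar_mult 1 a = a" by (simp add: scalar_mult_def)
  show "scalar_mult c a * b = scalar_mult c (a * b)" by (simp add: scalar_mult_def mult.assoc)
  show "a * scalar_mult c b = scalar_mult c (a * b)"
    by (simp only: scalar_mult_def mult.assoc[symmetric] single_zero_commute)
qed

lemma free_induct [case_names add scale monomial]: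
  assumes "\<And>a b. P a \<Longrightarrow> P b \<Longrightarrow> P (a + b)" "\<And>c a. P a \<Longrightarrow> P (scalar_mult c a)" "\<And>xs. P (word_monomial xs)"
  shows "P a"
proof (induction a rule: poly_mapping_single_induct)
  case 1
  have "P (scalar_mult 0 1)" using assms(2,3) by (metis monomial_Nil)
  then show ?case by simp
qed (auto simp: single_eq_scalar_mult_monomial assms)

text \<open>Every word arises from the empty one by prepending letters. This serves as an induction
  principle for properties that are linear in the element.\<close>

lemma free_subspace_eq_UNIV:
  assumes "free.subspace Z" "1 \<in> Z" "\<And>x a. a \<in> Z \<Longrightarrow> generator x * a \<in> Z"
  shows "Z = UNIV"
proof -
  have "word_monomial xs \<in> Z" for xs
    by (induction xs) (auto simp: monomial_Nil monomial_Cons assms)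
  then have "a \<in> Z" for a
    by (induction a rule: free_induct)
      (auto intro: free.subspace_add[OF assms(1)] free.subspace_scale[OF assms(1)])
  then show ?thesis by blast
qed

text \<open>The scalars may act on the target through any additive map, since semilinear extensions occur below.\<close>

definition word_extend :: "('f::field \<Rightarrow> 'b \<Rightarrow> 'b) \<Rightarrow> ('l list \<Rightarrow> 'b) \<Rightarrow> ('l word \<Rightarrow>\<^sub>0 'f) \<Rightarrow> 'b::comm_monoid_add" where
  "word_extend s h a = (\<Sum>w\<in>Poly_Mapping.keys a. s (Poly_Mapping.lookup a w) (h (letters w)))"

text \<open>A larger index set lets two elements with different supports be summed over the same
  words.\<close>

lemma word_extend_superset:
  assumes "\<And>x. s 0 x = 0" "finite A" "Poly_Mapping.keys a \<subseteq> A"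
  shows "word_extend s h a = (\<Sum>w\<in>A. s (Poly_Mapping.lookup a w) (h (letters w)))"
  unfolding word_extend_def
  by (rule sum.mono_neutral_left) (use assms in \<open>auto simp: in_keys_iff\<close>)

lemma word_extend_add:
  assumes "\<And>x. s 0 x = 0" "\<And>c d x. s (c + d) x = s c x + s d x"
  shows "word_extend s h (a + b) = word_extend s h a + word_extend s h b"
proof -
  have "finite (Poly_Mapping.keys a \<union> Poly_Mapping.keys b)" by simp
  moreover note Poly_Mapping.keys_add[of a b]
  ultimately show ?thesis
    by (simp add: word_extend_superset[where A = "Poly_Mapping.keys a \<union> Poly_Mapping.keys b"] assms lookup_add sum.distrib)
qed

lemma word_extend_single:
  assumes "\<And>x. s 0 x = 0"
  shows "word_extend s h (Poly_Mapping.single w c) = s c (h (letters w))"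
  by (cases "c = 0") (simp_all add: word_extend_def assms)

lemma word_extend_scale:
  assumes "\<And>x. s 0 x = 0" "\<And>c x y. s c (x + y) = s c x + s c y" "\<And>c d x. s c (s d x) = s (c * d) x"
    "\<And>c d x. s (c + d) x = s c x + s d x"
  shows "word_extend s h (scalar_mult c a) = s c (word_extend s h a)"
proof (induction a rule: poly_mapping_single_induct)
  case 1
  have "s c 0 = s c (s 0 undefined)" by (simp add: assms)
  also have "\<dots> = 0" unfolding assms(3) by (simp add: assms)
  finally show ?case by (simp add: scalar_mult_def word_extend_def)
next
  case (2 w d)
  then show ?case by (simp add: word_extend_single scalar_mult_def mult_single assms)
next
  case (3 a b)
  then show ?case by (simp add: free.scale_right_distrib word_extend_add assms)
qed

lemma word_extend_linear:
  "Vector_Spaces.linear scalar_mult scalar_mult (word_extend scalar_mult h)"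
proof unfold_locales
  show "word_extend scalar_mult h (a + b) = word_extend scalar_mult h a + word_extend scalar_mult h b" for a b
    by (rule word_extend_add) (simp_all add: free.scale_left_distrib)
  show "word_extend scalar_mult h (scalar_mult c a) = scalar_mult c (word_extend scalar_mult h a)" for c a
    by (rule word_extend_scale) (simp_all add: free.scale_left_distrib free.scale_right_distrib)
qed

lemma word_extend_monomial: "word_extend scalar_mult h (word_monomial xs) = h xs"
  unfolding word_monomial_def by (subst word_extend_single) simp_all

section \<open>Derivations with prescribed values on the generators\<close>

primrec word_derivation :: "('l \<Rightarrow> 'l word \<Rightarrow>\<^sub>0 'f::field) \<Rightarrow> 'l list \<Rightarrow> 'l word \<Rightarrow>\<^sub>0 'f" where
  "word_derivation g [] = 0"
| "word_derivation g (x # xs) = g x * word_monomial xs + generator x * word_derivation g xs"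

lemma word_derivation_append:
  "word_derivation g (xs @ ys) = word_derivation g xs * word_monomial ys + word_monomial xs * word_derivation g ys"
  by (induction xs) (simp_all add: monomial_Nil monomial_Cons monomial_append algebra_simps)

text \<open>This is the unique derivation with values \<open>g\<close> on the generators. In a free
  algebra these values can be chosen arbitrarily; relations only matter when a derivation has to
  descend to a quotient.\<close>

definition derivation :: "('l \<Rightarrow> 'l word \<Rightarrow>\<^sub>0 'f::field) \<Rightarrow> ('l word \<Rightarrow>\<^sub>0 'f) \<Rightarrow> 'l word \<Rightarrow>\<^sub>0 'f" where
  "derivation g = word_extend scalar_mult (word_derivation g)"

interpretation derivation: Vector_Spaces.linear scalar_mult scalar_mult "derivation g"
  unfolding derivation_def by (rule word_extend_linear)

lemma derivation_mult: "derivation g (a * b) = derivation g a * b + a * derivation g b"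
proof (induction a rule: free_induct)
  case (monomial xs)
  show ?case
  proof (induction b rule: free_induct)
    case (monomial ys)
    show ?case
      by (simp flip: monomial_append add: derivation_def word_extend_monomial word_derivation_append)
  qed (simp_all add: derivation.add derivation.scale algebra_simps free.scl_mult_right free.scale_right_distrib)
qed (simp_all add: derivation.add derivation.scale algebra_simps free.scl_mult_left free.scale_right_distrib)

lemma derivation_generator: "derivation g (generator x) = g x"
  by (simp flip: monomial_singleton add: derivation_def word_extend_monomial) (simp add: monomial_Nil)

section \<open>Two-sided ideals and the relations of the restricted enveloping algebra\<close>

definition two_sided :: "('a::ring_1) set \<Rightarrow> bool" where
  "two_sided T \<longleftrightarrow> 0 \<in> T \<and> (\<forall>a\<in>T. \<forall>b\<in>T. a + b \<in> T) \<and> (\<forall>r. \<forall>t\<in>T. r * t \<in> T \<and> t * r \<in> T)"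

lemma two_sidedD:
  assumes "two_sided T"
  shows "0 \<in> T" "a \<in> T \<Longrightarrow> b \<in> T \<Longrightarrow> a + b \<in> T" "t \<in> T \<Longrightarrow> r * t \<in> T" "t \<in> T \<Longrightarrow> t * r \<in> T"
    "t \<in> T \<Longrightarrow> - t \<in> T" "a \<in> T \<Longrightarrow> b \<in> T \<Longrightarrow> a - b \<in> T"
proof -
  show *: "0 \<in> T" "a \<in> T \<Longrightarrow> b \<in> T \<Longrightarrow> a + b \<in> T" "t \<in> T \<Longrightarrow> r * t \<in> T" "t \<in> T \<Longrightarrow> t * r \<in> T"
    for a b t r
    using assms unfolding two_sided_def by auto
  show neg: "t \<in> T \<Longrightarrow> - t \<in> T" for t using *(3)[of t "-1"] by simp
  show "a \<in> T \<Longrightarrow> b \<in> T \<Longrightarrow> a - b \<in> T" using *(2)[of a "- b"] neg by simp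
qed

text \<open>Multiplying by a scalar is multiplying by an element of the free algebra.\<close>

lemma two_sided_subspace:
  "two_sided T \<Longrightarrow> free.subspace T"
  unfolding free.subspace_def scalar_mult_def by (auto dest: two_sidedD)

definition ideal_closure :: "('a::ring_1) set \<Rightarrow> 'a set" where
  "ideal_closure X = \<Inter>{T. two_sided T \<and> X \<subseteq> T}"

lemma two_sided_ideal_closure: "two_sided (ideal_closure X)"
  unfolding ideal_closure_def two_sided_def by blast

lemma ideal_closure_superset: "X \<subseteq> ideal_closure X"
  unfolding ideal_closure_def by blast

lemma ideal_closure_least: "two_sided T \<Longrightarrow> X \<subseteq> T \<Longrightarrow> ideal_closure X \<subseteq> T"
  unfolding ideal_closure_def by blast

text \<open>By the Leibniz rule, the elements of the ideal that are mapped into the ideal form an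
  ideal themselves. Hence testing the generating relations suffices for a derivation to descend to
  the quotient.\<close>

lemma derivation_ideal_closure:
  assumes "\<And>x. x \<in> X \<Longrightarrow> derivation g x \<in> ideal_closure X" "a \<in> ideal_closure X"
  shows "derivation g a \<in> ideal_closure X"
proof -
  let ?K = "ideal_closure X"
  note K = two_sidedD[OF two_sided_ideal_closure[of X]]
  have "two_sided {a \<in> ?K. derivation g a \<in> ?K}"
    unfolding two_sided_def by (auto simp: derivation.add derivation.zero derivation_mult intro: K)
  then have "?K \<subseteq> {a \<in> ?K. derivation g a \<in> ?K}"
    by (rule ideal_closure_least) (use assms(1) ideal_closure_superset in blast)
  with assms(2) show ?thesis by blast
qed

definition restricted_relations ::
  "('f::field \<Rightarrow> 'l::ab_group_add \<Rightarrow> 'l) \<Rightarrow> ('l \<Rightarrow> 'l \<Rightarrow> 'l) \<Rightarrow> ('l \<Rightarrow> 'l) \<Rightarrow> ('l word \<Rightarrow>\<^sub>0 'f) set" where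
  "restricted_relations scale bracket pmap =
     enveloping_relations scale bracket \<union> {generator x ^ CHAR('f) - generator (pmap x) | x. True}"

text \<open>All relations are imposed on the free algebra at once, whereas
  \<open>restricted_enveloping_algebra\<close> imposes them in two stages. The two are identified in
  \<open>restricted_enveloping_algebra_presentation\<close>.\<close>

definition restricted_ideal ::
  "('f::field \<Rightarrow> 'l::ab_group_add \<Rightarrow> 'l) \<Rightarrow> ('l \<Rightarrow> 'l \<Rightarrow> 'l) \<Rightarrow> ('l \<Rightarrow> 'l) \<Rightarrow> ('l word \<Rightarrow>\<^sub>0 'f) set" where
  "restricted_ideal scale bracket pmap = ideal_closure (restricted_relations scale bracket pmap)"

lemma restricted_relations_subset_iff:
  fixes scale :: "'f::field \<Rightarrow> 'l::ab_group_add \<Rightarrow> 'l"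
  shows "restricted_relations scale bracket pmap \<subseteq> T \<longleftrightarrow>
    (\<forall>x y. generator (x + y) - (generator x + generator y) \<in> T) \<and>
    (\<forall>c x. generator (scale c x) - scalar_mult c (generator x) \<in> T) \<and>
    (\<forall>x y. generator x * generator y - generator y * generator x - generator (bracket x y) \<in> T) \<and>
    (\<forall>x. generator x ^ CHAR('f) - generator (pmap x) \<in> T)"
proof -
  have 1: "{f x | x. True} \<subseteq> T \<longleftrightarrow> (\<forall>x. f x \<in> T)" for f :: "'a \<Rightarrow> 'b" and T by blast
  have 2: "{f x y | x y. True} \<subseteq> T \<longleftrightarrow> (\<forall>x y. f x y \<in> T)" for f :: "'a \<Rightarrow> 'c \<Rightarrow> 'b" and T by blast
  show ?thesis
    unfolding restricted_relations_def enveloping_relations_def scalar_mult_def Un_subset_iff 1 2 conj_assoc ..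
qed

lemma of_nat_char_eq_zero: "of_nat n = (0::'f::field) \<Longrightarrow> (of_nat n :: 'l word \<Rightarrow>\<^sub>0 'f) = 0"
  by (metis single_of_nat single_zero)

section \<open>Powers of derivations and derivatives of powers in characteristic p\<close>

definition is_derivation :: "(('l word \<Rightarrow>\<^sub>0 'f::field) \<Rightarrow> 'l word \<Rightarrow>\<^sub>0 'f) \<Rightarrow> bool" where
  "is_derivation D \<longleftrightarrow> Vector_Spaces.linear scalar_mult scalar_mult D \<and> (\<forall>a b. D (a * b) = D a * b + a * D b)"

lemma is_derivationI:
  assumes "\<And>a b. D (a + b) = D a + D b" "\<And>c a. D (scalar_mult c a) = scalar_mult c (D a)"
    "\<And>a b. D (a * b) = D a * b + a * D b"
  shows "is_derivation D"
  unfolding is_derivation_def by (auto intro!: assms Vector_Spaces.linear.intro module_hom_axioms.intro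
    module_hom.intro free.module_axioms free.vector_space_axioms)

lemma is_derivationD:
  assumes "is_derivation D"
  shows "D (a + b) = D a + D b" "D (scalar_mult c a) = scalar_mult c (D a)" "D (a * b) = D a * b + a * D b"
    "D 0 = 0" "D (a - b) = D a - D b" "D 1 = 0" "D (- a) = - D a"
proof -
  interpret Vector_Spaces.linear scalar_mult scalar_mult D using assms unfolding is_derivation_def by blast
  show "D (a + b) = D a + D b" "D (scalar_mult c a) = scalar_mult c (D a)" "D 0 = 0" "D (a - b) = D a - D b"
    "D (- a) = - D a"
    by (rule add scale zero diff neg)+
  show *: "D (a * b) = D a * b + a * D b" for a b using assms unfolding is_derivation_def by blast
  show "D 1 = 0" using *[of 1 1] by simp
qed

lemma is_derivation_derivation: "is_derivation (derivation g)"
  unfolding is_derivation_def by (auto intro: derivation.linear_axioms derivation_mult)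

lemma is_derivation_diff:
  assumes "is_derivation D" "is_derivation E" shows "is_derivation (\<lambda>a. D a - E a)"
  by (rule is_derivationI)
    (simp_all add: is_derivationD[OF assms(1)] is_derivationD[OF assms(2)] free.scale_right_diff_distrib algebra_simps)

lemma is_derivation_scale:
  assumes "is_derivation D" shows "is_derivation (\<lambda>a. scalar_mult c (D a))"
  by (rule is_derivationI)
    (simp_all add: is_derivationD[OF assms] free.scale_right_distrib free.scl_mult_left free.scl_mult_right mult.commute)

lemma is_derivation_commutator:
  assumes "is_derivation D" "is_derivation E" shows "is_derivation (\<lambda>a. D (E a) - E (D a))"
  by (rule is_derivationI)
    (simp_all add: is_derivationD[OF assms(1)] is_derivationD[OF assms(2)] free.scale_right_diff_distrib algebra_simps)

text \<open>Pascal's rule, isolated because it drives two binomial formulas: for powers of a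
  derivation on a product, and for powers of the operators \<open>weyl_operator x\<close>.\<close>

lemma sum_binomial_step:
  fixes F :: "nat \<Rightarrow> nat \<Rightarrow> 'r::ring_1"
  shows "(\<Sum>k\<le>n. of_nat (n choose k) * (F (Suc k) (n - k) + F k (Suc (n - k)))) =
    (\<Sum>k\<le>Suc n. of_nat (Suc n choose k) * F k (Suc n - k))"
proof -
  have "(\<Sum>k\<le>Suc n. of_nat (Suc n choose k) * F k (Suc n - k)) =
    F 0 (Suc n) + (\<Sum>k\<le>n. of_nat ((n choose k) + (n choose Suc k)) * F (Suc k) (n - k))"
    by (subst sum.atMost_Suc_shift)
      (simp only: binomial_Suc_Suc diff_Suc_Suc binomial_n_0 of_nat_1 mult_1_left minus_nat.diff_0)
  also have "\<dots> = (F 0 (Suc n) + (\<Sum>k\<le>n. of_nat (n choose Suc k) * F (Suc k) (n - k))) +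
      (\<Sum>k\<le>n. of_nat (n choose k) * F (Suc k) (n - k))"
    by (simp only: of_nat_add distrib_right sum.distrib add_ac)
  also have "F 0 (Suc n) + (\<Sum>k\<le>n. of_nat (n choose Suc k) * F (Suc k) (n - k)) =
      (\<Sum>k\<le>Suc n. of_nat (n choose k) * F k (Suc n - k))"
    by (subst sum.atMost_Suc_shift) simp
  also have "\<dots> = (\<Sum>k\<le>n. of_nat (n choose k) * F k (Suc (n - k)))"
    by (simp add: Suc_diff_le binomial_eq_0)
  finally show ?thesis by (simp add: distrib_left sum.distrib)
qed

lemma derivation_pow_mult:
  assumes "is_derivation D"
  shows "(D ^^ n) (a * b) = (\<Sum>k\<le>n. of_nat (n choose k) * ((D ^^ k) a * (D ^^ (n - k)) b))"
proof (induction n)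
  case (Suc n)
  note D = is_derivationD[OF assms]
  have D_of_nat: "D (of_nat m * x) = of_nat m * D x" for m x
    by (induction m) (simp_all add: D distrib_right)
  have D_sum: "D (sum f A) = (\<Sum>i\<in>A. D (f i))" for f and A :: "nat set"
    by (induction A rule: infinite_finite_induct) (simp_all add: D)
  have "(D ^^ Suc n) (a * b) =
    (\<Sum>k\<le>n. of_nat (n choose k) * ((D ^^ Suc k) a * (D ^^ (n - k)) b + (D ^^ k) a * (D ^^ Suc (n - k)) b))"
    by (simp add: Suc D_sum D_of_nat) (simp add: D)
  also have "\<dots> = (\<Sum>k\<le>Suc n. of_nat (Suc n choose k) * ((D ^^ k) a * (D ^^ (Suc n - k)) b))"
    by (rule sum_binomial_step[where F = "\<lambda>k l. (D ^^ k) a * (D ^^ l) b"])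
  finally show ?case .
qed simp

text \<open>A prime p divides the binomial coefficients with 0 < k < p, so only the two ends of the
  sum survive.\<close>

lemma sum_binomial_prime_char:
  fixes F :: "nat \<Rightarrow> 'l word \<Rightarrow>\<^sub>0 'f::field"
  assumes "prime CHAR('f)"
  shows "(\<Sum>k\<le>CHAR('f). of_nat (CHAR('f) choose k) * F k) = F 0 + F CHAR('f)"
proof -
  have p: "CHAR('f) > 0" using assms by (rule prime_gt_0_nat)
  have "(\<Sum>k\<le>CHAR('f). of_nat (CHAR('f) choose k) * F k) =
      (\<Sum>k\<in>{0, CHAR('f)}. of_nat (CHAR('f) choose k) * F k)"
  proof (rule sum.mono_neutral_right)
    show "\<forall>k\<in>{..CHAR('f)} - {0, CHAR('f)}. of_nat (CHAR('f) choose k) * F k = 0"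
    proof
      fix k assume "k \<in> {..CHAR('f)} - {0, CHAR('f)}"
      then have "CHAR('f) dvd (CHAR('f) choose k)"
        by (intro dvd_choose_prime) (use assms in auto)
      then have "(of_nat (CHAR('f) choose k) :: 'f) = 0"
        using of_nat_eq_0_iff_char_dvd by blast
      then have "(of_nat (CHAR('f) choose k) :: 'l word \<Rightarrow>\<^sub>0 'f) = 0" by (rule of_nat_char_eq_zero)
      then show "of_nat (CHAR('f) choose k) * F k = 0" by simp
    qed
  qed auto
  also have "\<dots> = F 0 + F CHAR('f)" using p by simp
  finally show ?thesis .
qed

text \<open>In the Leibniz formula for the p-th power all mixed terms have a coefficient divisible
  by p.\<close>

lemma is_derivation_pow_char:
  fixes D :: "('l word \<Rightarrow>\<^sub>0 'f::field) \<Rightarrow> _"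
  assumes "is_derivation D" "prime CHAR('f)"
  shows "is_derivation (D ^^ CHAR('f))"
proof (rule is_derivationI)
  note D = is_derivationD[OF assms(1)]
  show "(D ^^ n) (a + b) = (D ^^ n) a + (D ^^ n) b" for n a b
    by (induction n) (simp_all add: D)
  show "(D ^^ n) (scalar_mult c a) = scalar_mult c ((D ^^ n) a)" for n c a
    by (induction n) (simp_all add: D)
  show "(D ^^ CHAR('f)) (a * b) = (D ^^ CHAR('f)) a * b + a * (D ^^ CHAR('f)) b" for a b
    unfolding derivation_pow_mult[OF assms(1)] sum_binomial_prime_char[OF assms(2)] by simp
qed

text \<open>The elements mapped into \<open>T\<close> form a subspace that contains 1 and is closed
  under left multiplication by generators. Identities between derivations modulo \<open>T\<close>
  are therefore checked on generators only.\<close>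

lemma derivation_into_ideal:
  assumes D: "is_derivation D" and T: "two_sided T" and gen: "\<And>x. D (generator x) \<in> T"
  shows "D a \<in> T"
proof -
  note T' = two_sidedD[OF T]
  have "{a. D a \<in> T} = UNIV"
  proof (rule free_subspace_eq_UNIV)
    have "Vector_Spaces.linear scalar_mult scalar_mult D" using D unfolding is_derivation_def by blast
    then show "free.subspace {a. D a \<in> T}"
      by (rule free.subspace_vimage_linear) (rule two_sided_subspace[OF T])
  qed (use T' gen in \<open>auto simp: is_derivationD[OF D]\<close>)
  then show ?thesis by blast
qed

text \<open>As \<open>a\<close> and \<open>D a\<close> commute modulo \<open>T\<close>, the
  derivative of \<open>a ^ n\<close> is \<open>n\<close> times \<open>a ^ (n - 1) * D a\<close> for
  positive \<open>n\<close>, and the coefficient vanishes for \<open>n = CHAR('f)\<close>.\<close>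

lemma derivation_power_char:
  fixes a :: "'l word \<Rightarrow>\<^sub>0 'f::field"
  assumes D: "is_derivation D" and T: "two_sided T" and comm: "a * D a - D a * a \<in> T"
  shows "D (a ^ CHAR('f)) \<in> T"
proof (cases "CHAR('f)")
  \<comment> \<open>In characteristic zero the power in question is 1, which a derivation
    kills.\<close>
  case 0
  then show ?thesis using two_sidedD(1)[OF T] by (simp add: is_derivationD[OF D])
next
  case (Suc m)
  note T' = two_sidedD[OF T]
  have "D (a ^ Suc n) - of_nat (Suc n) * (a ^ n * D a) \<in> T" for n
  proof (induction n)
    case 0
    then show ?case using T'(1) by simp
  next
    case (Suc n)
    have pow: "a ^ k * D a - D a * a ^ k \<in> T" for k
    proof (induction k)
      case 0
      then show ?case using T'(1) by simp
    next
      case (Suc k)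
      have "a * (a ^ k * D a - D a * a ^ k) + (a * D a - D a * a) * a ^ k \<in> T"
        by (intro T'(2) T'(3)[OF Suc] T'(4)[OF comm])
      then show ?case by (simp add: algebra_simps)
    qed
    have "a * (D (a ^ Suc n) - of_nat (Suc n) * (a ^ n * D a)) - (a ^ Suc n * D a - D a * a ^ Suc n) \<in> T"
      by (intro T'(6) T'(3)[OF Suc] pow)
    moreover have "a * (of_nat k * b) = of_nat k * (a * b)" for k b
      by (metis mult.assoc mult_of_nat_commute)
    ultimately show ?case
      by (simp add: is_derivationD(3)[OF D] algebra_simps)
  qed
  from this[of m] have "D (a ^ CHAR('f)) - of_nat CHAR('f) * (a ^ m * D a) \<in> T" by (simp only: Suc)
  moreover have "(of_nat CHAR('f) :: 'l word \<Rightarrow>\<^sub>0 'f) = 0" by (rule of_nat_char_eq_zero) simp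
  ultimately show ?thesis by simp
qed

section \<open>Noncommutativity of the enveloping algebra\<close>

lemma vector_space_field_mult: "vector_space ((*) :: 'f::field \<Rightarrow> 'f \<Rightarrow> 'f)"
  by unfold_locales (simp_all add: algebra_simps)

text \<open>A basis of \<open>P\<close> stays independent when \<open>x\<close> is adjoined; the
  functional is the coordinate of \<open>x\<close>.\<close>

lemma separating_functional:
  assumes "vector_space scale" "Modules.module.subspace scale P" "x \<notin> P"
  shows "\<exists>f. Vector_Spaces.linear scale (*) f \<and> f x = 1 \<and> (\<forall>y\<in>P. f y = 0)"
proof -
  interpret V: vector_space scale by fact
  interpret W: vector_space_pair scale "(*)"
    by (rule vector_space_pair.intro) (fact assms(1), rule vector_space_field_mult)
  obtain B where B: "B \<subseteq> P" "V.independent B" "P \<subseteq> V.span B"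
    using V.maximal_independent_subset by blast
  have "V.span B \<subseteq> P" using B(1) assms(2) by (rule V.span_minimal)
  then have "x \<notin> V.span B" using assms(3) by blast
  then have ind: "V.independent (insert x B)" and "x \<notin> B"
    using B(2) by (auto simp: V.independent_insert V.span_base)
  define f where "f = W.construct (insert x B) (\<lambda>y. if y = x then 1 else 0)"
  have lin: "Vector_Spaces.linear scale (*) f" unfolding f_def by (rule W.linear_construct[OF ind])
  interpret f: Vector_Spaces.linear scale "(*)" f by (rule lin)
  have fb: "f y = (if y = x then 1 else 0)" if "y \<in> insert x B" for y
    unfolding f_def by (rule W.construct_basis[OF ind that])
  have "V.span B \<subseteq> {y. f y = 0}"
    by (rule V.span_minimal) (use fb \<open>x \<notin> B\<close> in \<open>auto simp: V.subspace_def f.zero f.add f.scale\<close>)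
  with fb B(3) lin show ?thesis by (intro exI[of _ f]) auto
qed

text \<open>The universal property of the free algebra for maps into a commutative ring that are
  semilinear through \<open>\<rho>\<close>. Commutativity lets the scalars of the second factor pass
  the letters of the first.\<close>

lemma word_extend_mult:
  fixes s :: "'f::field \<Rightarrow> 'b \<Rightarrow> 'b::comm_ring_1"
  assumes s: "\<And>c x. s c x = \<rho> c * x" "\<rho> 0 = 0" "\<And>c d. \<rho> (c + d) = \<rho> c + \<rho> d" "\<And>c d. \<rho> (c * d) = \<rho> c * \<rho> d"
  shows "word_extend s (\<lambda>xs. prod_list (map \<iota> xs)) (a * b) =
    word_extend s (\<lambda>xs. prod_list (map \<iota> xs)) a * word_extend s (\<lambda>xs. prod_list (map \<iota> xs)) b"
    (is "?\<Phi> (a * b) = ?\<Phi> a * ?\<Phi> b")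
proof -
  have s0: "s 0 x = 0" for x by (simp add: s)
  have sadd: "s (c + d) x = s c x + s d x" for c d x by (simp add: s distrib_right)
  note add = word_extend_add[of s, OF s0 sadd]
  note single = word_extend_single[of s, OF s0]
  have zero: "?\<Phi> 0 = 0" by (simp add: word_extend_def)
  show ?thesis
  proof (induction a rule: poly_mapping_single_induct)
    case (2 u c)
    show ?case
    proof (induction b rule: poly_mapping_single_induct)
      case (2 v d)
      show ?case by (simp only: mult_single single plus_word_def) (simp add: s mult_ac)
    qed (simp_all add: zero add distrib_left)
  qed (simp_all add: zero add distrib_right)
qed

section \<open>The abelian case: nonzero elements survive in the enveloping algebra\<close>

locale semilinear_power_map = vector_space scale
  for scale :: "'f::field \<Rightarrow> 'l::ab_group_add \<Rightarrow> 'l" +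
  fixes q :: "'l \<Rightarrow> 'l"
  assumes prime_char: "prime CHAR('f)"
    and q_add: "q (x + y) = q x + q y"
    and q_scale: "q (scale c x) = scale (c ^ CHAR('f)) (q x)"
begin

lemma q_zero: "q 0 = 0"
  using q_add[of 0 0] by simp

lemma q_pow_zero: "(q ^^ n) 0 = 0"
  by (induction n) (simp_all add: q_zero)

lemma q_pow_add: "(q ^^ n) (x + y) = (q ^^ n) x + (q ^^ n) y"
  by (induction n) (simp_all add: q_add)

lemma q_pow_scale: "(q ^^ n) (scale c x) = scale (c ^ (CHAR('f) ^ n)) ((q ^^ n) x)"
  by (induction n) (simp_all add: q_scale power_mult[symmetric] mult.commute)

text \<open>
  The target is a truncated polynomial ring in one variable \<open>t\<close>. A generator \<open>x\<close> is sent to the sum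
  of \<open>(\<phi> (q^k x) t)^(p^(m - k))\<close> over \<open>k \<le> m\<close>, which intertwines \<open>q\<close> and the \<open>p\<close>-th power.
  Letting scalars act through the \<open>m\<close>-th Frobenius power makes this map linear without
  extracting \<open>p\<close>-th roots in the ground field.
\<close>

lemma generator_notin_commutative_ideal:
  assumes nil: "\<And>x. (q ^^ Suc m) x = 0" and z: "z \<noteq> 0"
  shows "generator z \<notin> restricted_ideal scale (\<lambda>_ _. 0) q"
proof
  assume in_ideal: "generator z \<in> restricted_ideal scale (\<lambda>_ _. 0) q"
  let ?p = "CHAR('f)"
  have primeP: "prime CHAR('f poly)" using prime_char by simp
  obtain \<phi> where \<phi>: "Vector_Spaces.linear scale (*) \<phi>" "\<phi> z = 1"
    using separating_functional[OF vector_space_axioms subspace_single_0] z by blast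
  interpret \<phi>: Vector_Spaces.linear scale "(*)" \<phi> by fact
  define \<iota> where "\<iota> x = (\<Sum>k\<le>m. monom (\<phi> ((q ^^ k) x)) 1 ^ (?p ^ (m - k)))" for x
  define \<rho> :: "'f \<Rightarrow> 'f poly" where "\<rho> c = monom (c ^ (?p ^ m)) 0" for c
  define s where "s c P = \<rho> c * P" for c P
  define \<Phi> where "\<Phi> = word_extend s (\<lambda>xs. prod_list (map \<iota> xs))"
  have \<rho>0: "\<rho> 0 = 0" using prime_char by (simp add: \<rho>_def prime_gt_0_nat)
  have \<rho>_add: "\<rho> (c + d) = \<rho> c + \<rho> d" for c d
    unfolding \<rho>_def by (simp add: freshmans_dream'[OF prime_char refl] add_monom)
  have \<rho>_mult: "\<rho> (c * d) = \<rho> c * \<rho> d" for c d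
    unfolding \<rho>_def by (simp add: power_mult_distrib mult_monom)
  have s0: "s 0 x = 0" for x by (simp add: s_def \<rho>0)
  have s_add: "s (c + d) x = s c x + s d x" for c d x by (simp add: s_def \<rho>_add distrib_right)
  have \<Phi>_zero: "\<Phi> 0 = 0" by (simp add: \<Phi>_def word_extend_def)
  have \<Phi>_add: "\<Phi> (a + b) = \<Phi> a + \<Phi> b" for a b
    unfolding \<Phi>_def by (rule word_extend_add[of s, OF s0 s_add])
  have \<Phi>_diff: "\<Phi> (a - b) = \<Phi> a - \<Phi> b" for a b
    using \<Phi>_add[of "a - b" b] by simp
  have \<Phi>_mult: "\<Phi> (a * b) = \<Phi> a * \<Phi> b" for a b
    unfolding \<Phi>_def by (rule word_extend_mult[of s \<rho>, OF s_def \<rho>0 \<rho>_add \<rho>_mult])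
  have \<Phi>_single: "\<Phi> (Poly_Mapping.single w c) = s c (prod_list (map \<iota> (letters w)))" for w c
    unfolding \<Phi>_def by (rule word_extend_single[of s, OF s0])
  have letters_zero: "letters (0 :: 'l word) = []" by (simp add: zero_word_def)
  have \<rho>1: "\<rho> 1 = 1" by (simp add: \<rho>_def)
  have \<Phi>_gen: "\<Phi> (generator x) = \<iota> x" for x
    unfolding generator_def \<Phi>_single by (simp add: s_def \<rho>1)
  have \<Phi>_scalar: "\<Phi> (scalar_mult c a) = \<rho> c * \<Phi> a" for c a
    unfolding scalar_mult_def \<Phi>_mult \<Phi>_single by (simp add: s_def letters_zero)
  have \<Phi>_one: "\<Phi> 1 = 1" using \<Phi>_single[of 0 1] letters_zero by (simp add: s_def \<rho>1)
  have \<Phi>_power: "\<Phi> (a ^ n) = \<Phi> a ^ n" for a n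
    by (induction n) (simp_all add: \<Phi>_one \<Phi>_mult)
  have \<iota>_add: "\<iota> (x + y) = \<iota> x + \<iota> y" for x y
    unfolding \<iota>_def
    by (simp add: q_pow_add \<phi>.add add_monom[symmetric] freshmans_dream'[OF primeP] sum.distrib)
  have \<iota>_scale: "\<iota> (scale c x) = \<rho> c * \<iota> x" for c x
    unfolding \<iota>_def \<rho>_def sum_distrib_left
  proof (rule sum.cong[OF refl])
    fix k assume "k \<in> {..m}"
    \<comment> \<open>The map \<open>q ^^ k\<close> twists a scalar by \<open>?p ^ k\<close> and the
      outer power by \<open>?p ^ (m - k)\<close>. The total does not depend on \<open>k\<close>, so
      the scalar leaves the sum as \<open>\<rho> c\<close>.\<close>
    then have "?p ^ k * ?p ^ (m - k) = ?p ^ m" by (simp add: power_add[symmetric])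
    then show "monom (\<phi> ((q ^^ k) (scale c x))) 1 ^ ?p ^ (m - k) =
         monom (c ^ ?p ^ m) 0 * monom (\<phi> ((q ^^ k) x)) 1 ^ ?p ^ (m - k)"
      by (simp add: q_pow_scale \<phi>.scale monom_power mult_monom power_mult_distrib power_mult[symmetric])
  qed
  have \<iota>0: "\<iota> 0 = 0" using \<iota>_scale[of 0 0] by (simp add: \<rho>0)
  \<comment> \<open>The p-th power moves every term one place along the sum and so yields
    \<open>\<iota> (q x)\<close>, except that the term with \<open>k = 0\<close> is left over. The
    last term of \<open>\<iota> (q x)\<close> has no counterpart, but it vanishes by
    \<open>nil\<close>.\<close>
  have \<iota>_power: "\<iota> x ^ ?p - \<iota> (q x) = monom (\<phi> x) 1 ^ (?p ^ Suc m)" for x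
  proof -
    have "\<iota> x ^ ?p = (\<Sum>k\<le>m. (monom (\<phi> ((q ^^ k) x)) 1 ^ (?p ^ (m - k))) ^ ?p)"
      unfolding \<iota>_def by (rule freshmans_dream_sum[OF primeP]) simp
    also have "\<dots> = (\<Sum>k<Suc m. monom (\<phi> ((q ^^ k) x)) 1 ^ (?p ^ (Suc m - k)))"
      unfolding lessThan_Suc_atMost
      by (rule sum.cong) (simp_all add: power_mult[symmetric] Suc_diff_le mult.commute)
    also have "\<dots> = monom (\<phi> x) 1 ^ (?p ^ Suc m) + (\<Sum>k<m. monom (\<phi> ((q ^^ Suc k) x)) 1 ^ (?p ^ (m - k)))"
      by (subst sum.lessThan_Suc_shift) simp
    also have "(\<Sum>k<m. monom (\<phi> ((q ^^ Suc k) x)) 1 ^ (?p ^ (m - k))) =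
        (\<Sum>k<Suc m. monom (\<phi> ((q ^^ Suc k) x)) 1 ^ (?p ^ (m - k)))"
      using nil[of x] by (simp add: \<phi>.zero)
    also have "\<dots> = \<iota> (q x)"
      unfolding \<iota>_def lessThan_Suc_atMost by (simp add: funpow_swap1)
    finally show ?thesis by simp
  qed
  \<comment> \<open>Truncation at degree \<open>?p ^ Suc m\<close> removes exactly the leftover term
    of \<open>\<iota>_power\<close>.\<close>
  define T where "T = {a. monom 1 (?p ^ Suc m) dvd \<Phi> a}"
  have T: "two_sided T"
    unfolding two_sided_def T_def by (auto simp: \<Phi>_zero \<Phi>_add \<Phi>_mult)
  have "restricted_relations scale (\<lambda>_ _. 0) q \<subseteq> T"
    unfolding restricted_relations_subset_iff T_def
  proof (intro conjI allI CollectI)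
    fix x
    have "monom (\<phi> x) 1 ^ (?p ^ Suc m) = monom 1 (?p ^ Suc m) * monom (\<phi> x ^ (?p ^ Suc m)) 0"
      by (simp only: monom_power mult_monom) simp
    then show "monom 1 (?p ^ Suc m) dvd \<Phi> (generator x ^ ?p - generator (q x))"
      by (simp only: \<Phi>_diff \<Phi>_power \<Phi>_gen \<iota>_power dvd_triv_left)
  qed (simp_all add: \<Phi>_diff \<Phi>_add \<Phi>_mult \<Phi>_gen \<Phi>_scalar \<iota>_add \<iota>_scale \<iota>0)
  then have "restricted_ideal scale (\<lambda>_ _. 0) q \<subseteq> T"
    unfolding restricted_ideal_def by (rule ideal_closure_least[OF T])
  with in_ideal have "monom 1 (?p ^ Suc m) dvd \<iota> z" by (auto simp: T_def \<Phi>_gen)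
  moreover have "?p ^ m < ?p ^ Suc m" using prime_gt_1_nat[OF prime_char] by simp
  ultimately have "coeff (\<iota> z) (?p ^ m) = 0" unfolding monom_1_dvd_iff' by blast
  \<comment> \<open>Only the term with \<open>k = 0\<close> has degree \<open>?p ^ m\<close>, and
    its coefficient is a power of \<open>\<phi> z = 1\<close>.\<close>
  moreover have "coeff (\<iota> z) (?p ^ m) = (\<Sum>k\<le>m. if k = 0 then 1 else 0)"
    unfolding \<iota>_def coeff_sum
  proof (rule sum.cong[OF refl])
    fix k assume "k \<in> {..m}"
    then have "?p ^ (m - k) = ?p ^ m \<longleftrightarrow> k = 0"
      using prime_gt_1_nat[OF prime_char] power_inject_exp[of ?p "m - k" m] by auto
    then show "coeff (monom (\<phi> ((q ^^ k) z)) 1 ^ ?p ^ (m - k)) (?p ^ m) = (if k = 0 then 1 else 0)"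
      by (simp add: monom_power \<phi>(2))
  qed
  ultimately show False by simp
qed

end

text \<open>Iterates of \<open>q\<close> are semilinear, so their kernels are subspaces, and an
  exponent that works on a finite spanning set works everywhere.\<close>

lemma (in semilinear_power_map) uniformly_nilpotent:
  assumes B: "finite B" "span B = UNIV" and nil: "p_nilpotent q"
  shows "\<exists>m. \<forall>x. (q ^^ Suc m) x = 0"
proof -
  have "\<forall>b. \<exists>n. (q ^^ n) b = 0" using nil unfolding p_nilpotent_def by blast
  then obtain n where n: "\<And>b. (q ^^ n b) b = 0" by metis
  have mono: "(q ^^ k) x = 0 \<Longrightarrow> k \<le> l \<Longrightarrow> (q ^^ l) x = 0" for k l x
    using funpow_add[of "l - k" k q] q_pow_zero by simp
  define m where "m = Max (insert 0 (n ` B))"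
  have "n b \<le> Suc m" if "b \<in> B" for b
    unfolding m_def using B(1) that by (intro le_SucI Max_ge) auto
  then have "B \<subseteq> {x. (q ^^ Suc m) x = 0}" using n mono by blast
  moreover have "subspace {x. (q ^^ Suc m) x = 0}"
    by (simp add: subspace_def q_pow_zero q_pow_add q_pow_scale del: funpow.simps)
  ultimately have "span B \<subseteq> {x. (q ^^ Suc m) x = 0}" by (rule span_minimal)
  then show ?thesis using B(2) by blast
qed

lemma two_sided_restricted_ideal: "two_sided (restricted_ideal scale bracket pmap)"
  unfolding restricted_ideal_def by (rule two_sided_ideal_closure)

lemma restricted_ideal_relations:
  fixes scale :: "'f::field \<Rightarrow> 'l::ab_group_add \<Rightarrow> 'l"
  shows "generator (x + y) - (generator x + generator y) \<in> restricted_ideal scale bracket pmap"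
    "generator (scale c x) - scalar_mult c (generator x) \<in> restricted_ideal scale bracket pmap"
    "generator x * generator y - generator y * generator x - generator (bracket x y) \<in> restricted_ideal scale bracket pmap"
    "generator x ^ CHAR('f) - generator (pmap x) \<in> restricted_ideal scale bracket pmap"
  using ideal_closure_superset[of "restricted_relations scale bracket pmap"]
  unfolding restricted_ideal_def restricted_relations_subset_iff by blast+

text \<open>\<open>generator 0\<close> is a one-letter word and not the zero of the free algebra;
  the scalar relation with coefficient 0 makes it vanish in the quotient.\<close>

lemma generator_zero_mem:
  assumes "vector_space scale"
  shows "generator 0 \<in> restricted_ideal scale bracket pmap"
proof -
  interpret vector_space scale by fact
  show ?thesis using restricted_ideal_relations(2)[of scale 0 0 bracket pmap] by simp
qed

section \<open>Representations of the free algebra on itself by operators\<close>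

definition word_action :: "('l \<Rightarrow> ('l word \<Rightarrow>\<^sub>0 'f) \<Rightarrow> 'l word \<Rightarrow>\<^sub>0 'f) \<Rightarrow> ('l word \<Rightarrow>\<^sub>0 'f::field) \<Rightarrow> ('l word \<Rightarrow>\<^sub>0 'f) \<Rightarrow> 'l word \<Rightarrow>\<^sub>0 'f" where
  "word_action L a v = word_extend scalar_mult (\<lambda>xs. foldr L xs v) a"

lemma word_action_left:
  "word_action L (a + b) v = word_action L a v + word_action L b v"
  "word_action L (scalar_mult c a) v = scalar_mult c (word_action L a v)"
  "word_action L 0 v = 0"
  "word_action L (a - b) v = word_action L a v - word_action L b v"
  "word_action L (word_monomial xs) v = foldr L xs v"
proof -
  interpret Vector_Spaces.linear scalar_mult scalar_mult "\<lambda>a. word_action L a v"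
    unfolding word_action_def by (rule word_extend_linear)
  show "word_action L (a + b) v = word_action L a v + word_action L b v"
    "word_action L (scalar_mult c a) v = scalar_mult c (word_action L a v)"
    "word_action L 0 v = 0" "word_action L (a - b) v = word_action L a v - word_action L b v"
    by (rule add scale zero diff)+
  show "word_action L (word_monomial xs) v = foldr L xs v"
    unfolding word_action_def by (rule word_extend_monomial)
qed

lemma word_action_generator: "word_action L (generator x) v = L x v"
  using word_action_left(5)[of L "[x]" v] by (simp add: monomial_singleton)

lemma word_action_mem:
  assumes T: "two_sided T" and L: "\<And>x v. v \<in> T \<Longrightarrow> L x v \<in> T" and "v \<in> T"
  shows "word_action L a v \<in> T"
proof (induction a rule: free_induct)
  case (monomial xs)
  show ?case unfolding word_action_left by (induction xs) (auto intro: L \<open>v \<in> T\<close>)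
qed (simp_all add: word_action_left two_sidedD[OF T] free.subspace_scale[OF two_sided_subspace[OF T]])

lemma word_action_mult:
  assumes "\<And>x u v. L x (u + v) = L x u + L x v" "\<And>x c v. L x (scalar_mult c v) = scalar_mult c (L x v)"
  shows "word_action L (a * b) v = word_action L a (word_action L b v)"
proof (induction a rule: free_induct)
  case (monomial xs)
  have foldr_add: "foldr L xs (u + w) = foldr L xs u + foldr L xs w" for u w
    by (induction xs) (simp_all add: assms)
  have foldr_scale: "foldr L xs (scalar_mult c w) = scalar_mult c (foldr L xs w)" for c w
    by (induction xs) (simp_all add: assms)
  show ?case
  proof (induction b rule: free_induct)
    case (monomial ys)
    show ?case by (simp flip: monomial_append add: word_action_left)
  next
    case (add a b)
    then show ?case unfolding distrib_left word_action_left foldr_add by simp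
  next
    case (scale c a)
    then show ?case by (simp add: free.scl_mult_right word_action_left foldr_scale)
  qed
qed (simp_all add: distrib_right free.scl_mult_left word_action_left)

lemma word_action_power:
  assumes "\<And>x u v. L x (u + v) = L x u + L x v" "\<And>x c v. L x (scalar_mult c v) = scalar_mult c (L x v)"
  shows "word_action L (generator x ^ n) v = (L x ^^ n) v"
proof (induction n)
  case 0
  then show ?case using word_action_left(5)[of L "[]" v] by (simp add: monomial_Nil)
next
  case (Suc n)
  then show ?case by (simp add: word_action_mult[of L, OF assms] word_action_generator)
qed

text \<open>Only the upper bound on the class is assumed here; a nonzero bracket enters later as the
  hypothesis \<open>nonabelian\<close>.\<close>

locale class2_restricted_lie_algebra = restricted_lie_algebra scale bracket pmap
  for scale :: "'f::field \<Rightarrow> 'l::ab_group_add \<Rightarrow> 'l" and bracket pmap +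
  assumes bracket_bracket: "bracket (bracket x y) z = 0"
    and char_gt_2: "CHAR('f) > 2"
begin

lemma bracket_zero_left: "bracket 0 x = 0"
  using bracket_add_left[of 0 0 x] by simp

lemma bracket_zero_right: "bracket x 0 = 0"
  using bracket_add_right[of x 0 0] by simp

lemma bracket_swap: "bracket y x = - bracket x y"
proof -
  have "bracket (x + y) (x + y) = bracket x y + bracket y x"
    unfolding bracket_add_left bracket_add_right by (simp add: bracket_self)
  then show ?thesis by (simp add: bracket_self eq_neg_iff_add_eq_0 add.commute)
qed

lemma bracket_bracket_right: "bracket z (bracket x y) = 0"
  using bracket_swap[of z "bracket x y"] by (simp add: bracket_bracket)

lemma coeff_ad_pencil:
  "coeff (ad_pencil bracket x y v) n =
    (case n of 0 \<Rightarrow> 0 | Suc m \<Rightarrow> bracket x (coeff v m)) + bracket y (coeff v n)"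
  unfolding ad_pencil_def by (simp add: coeff_pCons coeff_map_poly bracket_zero_right split: nat.split)

lemma ad_pencil_twice: "ad_pencil bracket x y (ad_pencil bracket x y v) = 0"
  by (rule poly_eqI)
    (simp add: coeff_ad_pencil bracket_add_right bracket_bracket_right bracket_zero_right split: nat.split)

lemma char_eq_Suc_Suc: "\<exists>n. CHAR('f) = Suc (Suc (Suc n))"
  using char_gt_2 by (intro exI[of _ "CHAR('f) - 3"]) simp

text \<open>In class 2 the operator \<open>ad_pencil\<close> squares to zero, and p > 2 means that
  it is applied at least twice, so Jacobson's correction terms vanish. Thus \<open>pmap\<close> is
  also a p-map for the zero bracket on the same space.\<close>

lemma pmap_add_class2: "pmap (x + y) = pmap x + pmap y"
proof -
  obtain n where n: "CHAR('f) = Suc (Suc (Suc n))" using char_eq_Suc_Suc by blast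
  have "jacobson_s scale bracket i x y = 0" for i
    unfolding jacobson_s_def by (simp add: n ad_pencil_twice)
  then show ?thesis by (simp add: pmap_add)
qed

lemma pmap_central: "bracket (pmap x) y = 0" "bracket y (pmap x) = 0"
proof -
  obtain n where "CHAR('f) = Suc (Suc (Suc n))" using char_eq_Suc_Suc by blast
  then show "bracket (pmap x) y = 0" by (simp add: ad_pmap bracket_bracket_right bracket_zero_right)
  then show "bracket y (pmap x) = 0" by (simp add: bracket_swap[of y])
qed

sublocale semilinear_power_map scale pmap
  by unfold_locales (use prime_CHAR_semidom[OF char_pos] pmap_add_class2 pmap_scale in auto)

section \<open>A representation of u(L) on the enveloping algebra of the abelian Lie algebra\<close>

definition half_bracket :: "'l \<Rightarrow> 'l \<Rightarrow> 'l" where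
  "half_bracket w e = scale (inverse 2) (bracket w e)"

lemma two_neq_zero: "(2 :: 'f) \<noteq> 0"
  using char_gt_2 of_nat_eq_0_iff_char_dvd[of 2, where 'a='f] by (auto dest: dvd_imp_le)

lemma half_bracket_double: "half_bracket x y + half_bracket x y = bracket x y"
proof -
  have "inverse 2 + inverse 2 = (1 :: 'f)" using two_neq_zero by (simp add: field_simps)
  then show ?thesis unfolding half_bracket_def scale_left_distrib[symmetric] by simp
qed

lemma half_bracket_simps:
  "half_bracket (x + y) z = half_bracket x z + half_bracket y z"
  "half_bracket z (x + y) = half_bracket z x + half_bracket z y"
  "half_bracket (scale c x) z = scale c (half_bracket x z)"
  "half_bracket z (scale c x) = scale c (half_bracket z x)"
  "half_bracket x x = 0" "half_bracket 0 x = 0" "half_bracket x 0 = 0"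
  "half_bracket x (half_bracket y z) = 0" "half_bracket (bracket x y) z = 0"
  "half_bracket (pmap x) z = 0" "half_bracket z (pmap x) = 0"
  unfolding half_bracket_def
  by (simp_all add: bracket_add_left bracket_add_right bracket_scale_left bracket_scale_right scale_right_distrib
    bracket_self bracket_zero_left bracket_zero_right bracket_bracket bracket_bracket_right pmap_central mult.commute)

lemma half_bracket_swap: "half_bracket y x = - half_bracket x y"
  unfolding half_bracket_def using bracket_swap[of y x] by simp

definition half_ad :: "'l \<Rightarrow> ('l word \<Rightarrow>\<^sub>0 'f) \<Rightarrow> 'l word \<Rightarrow>\<^sub>0 'f" where
  "half_ad w = derivation (\<lambda>e. generator (half_bracket w e))"

text \<open>
  The symmetric (Weyl) ordering: modulo the relations of the abelian Lie algebra on the same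
  space, the operators below satisfy the relations of the given Lie algebra.
\<close>

definition weyl_operator :: "'l \<Rightarrow> ('l word \<Rightarrow>\<^sub>0 'f) \<Rightarrow> 'l word \<Rightarrow>\<^sub>0 'f" where
  "weyl_operator w v = generator w * v + half_ad w v"

abbreviation "abelian_ideal \<equiv> restricted_ideal scale (\<lambda>_ _. 0) pmap"

lemma is_derivation_half_ad: "is_derivation (half_ad w)"
  unfolding half_ad_def by (rule is_derivation_derivation)

lemmas half_ad = is_derivationD[OF is_derivation_half_ad]

lemma half_ad_generator: "half_ad w (generator e) = generator (half_bracket w e)"
  unfolding half_ad_def by (rule derivation_generator)

lemmas abelian = two_sidedD[OF two_sided_restricted_ideal[of scale "\<lambda>_ _. 0" pmap]]

lemma gen_zero: "generator 0 \<in> abelian_ideal"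
  by (rule generator_zero_mem) (rule vector_space_axioms)

lemma abelian_commute: "generator x * generator y - generator y * generator x \<in> abelian_ideal"
  using abelian(2)[OF restricted_ideal_relations(3)[of x y "\<lambda>_ _. 0" scale pmap] gen_zero] by simp

lemma gen_uminus: "generator (- x) + generator x \<in> abelian_ideal"
  using abelian(6)[OF gen_zero restricted_ideal_relations(1)[of "- x" x scale "\<lambda>_ _. 0" pmap]]
  by (simp add: add.commute)

text \<open>The halved bracket is linear, which settles the linear relations; generators commute in
  the quotient, which settles the commutators. Both terms of a p-th power relation are mapped to
  zero: the power by \<open>derivation_power_char\<close>, the other because \<open>pmap\<close> has
  central values.\<close>

lemma half_ad_abelian_ideal:
  assumes "a \<in> abelian_ideal" shows "half_ad w a \<in> abelian_ideal"
  unfolding half_ad_def restricted_ideal_def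
proof (rule derivation_ideal_closure)
  show "a \<in> ideal_closure (restricted_relations scale (\<lambda>_ _. 0) pmap)"
    using assms unfolding restricted_ideal_def .
  have "restricted_relations scale (\<lambda>_ _. 0) pmap \<subseteq> {a. half_ad w a \<in> abelian_ideal}"
    unfolding restricted_relations_subset_iff mem_Collect_eq
  proof (intro conjI allI)
    fix x y c
    show "half_ad w (generator (x + y) - (generator x + generator y)) \<in> abelian_ideal"
      by (simp add: half_ad half_ad_generator half_bracket_simps restricted_ideal_relations)
    show "half_ad w (generator (scale c x) - scalar_mult c (generator x)) \<in> abelian_ideal"
      by (simp add: half_ad half_ad_generator half_bracket_simps restricted_ideal_relations)
    have "(generator (half_bracket w x) * generator y - generator y * generator (half_bracket w x)) +
      (generator x * generator (half_bracket w y) - generator (half_bracket w y) * generator x) - generator 0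
        \<in> abelian_ideal"
      by (intro abelian(2,6) abelian_commute gen_zero)
    then show "half_ad w (generator x * generator y - generator y * generator x - generator 0) \<in> abelian_ideal"
      by (simp add: half_ad half_ad_generator half_bracket_simps algebra_simps)
    have "half_ad w (generator x ^ CHAR('f)) \<in> abelian_ideal"
      by (rule derivation_power_char[OF is_derivation_half_ad two_sided_restricted_ideal])
        (simp add: half_ad_generator abelian_commute)
    then show "half_ad w (generator x ^ CHAR('f) - generator (pmap x)) \<in> abelian_ideal"
      by (simp only: half_ad half_ad_generator half_bracket_simps) (intro abelian(6) gen_zero)
  qed
  then show "derivation (\<lambda>e. generator (half_bracket w e)) x \<in> ideal_closure (restricted_relations scale (\<lambda>_ _. 0) pmap)"
    if "x \<in> restricted_relations scale (\<lambda>_ _. 0) pmap" for x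
    using that unfolding half_ad_def restricted_ideal_def by blast
qed

lemma weyl_add: "weyl_operator x (u + v) = weyl_operator x u + weyl_operator x v"
  by (simp add: weyl_operator_def half_ad distrib_left)

lemma weyl_scale: "weyl_operator x (scalar_mult c v) = scalar_mult c (weyl_operator x v)"
  by (simp add: weyl_operator_def half_ad free.scl_mult_right free.scale_right_distrib)

lemma weyl_abelian_ideal: "v \<in> abelian_ideal \<Longrightarrow> weyl_operator x v \<in> abelian_ideal"
  unfolding weyl_operator_def by (intro abelian(2,3) half_ad_abelian_ideal)

text \<open>The derivation parts are compared on generators, since a difference of derivations is a
  derivation.\<close>

lemma weyl_operator_sum:
  "weyl_operator (x + y) v - (weyl_operator x v + weyl_operator y v) \<in> abelian_ideal"
proof -
  have "half_ad (x + y) v - (half_ad x v) - half_ad y v \<in> abelian_ideal"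
    by (rule derivation_into_ideal[OF is_derivation_diff[OF is_derivation_diff]])
      (simp_all add: is_derivation_half_ad two_sided_restricted_ideal half_ad_generator half_bracket_simps
        diff_diff_eq restricted_ideal_relations)
  moreover have "(generator (x + y) - (generator x + generator y)) * v \<in> abelian_ideal"
    by (intro abelian(4) restricted_ideal_relations)
  ultimately have "(generator (x + y) - (generator x + generator y)) * v + (half_ad (x + y) v - (half_ad x v) - half_ad y v)
      \<in> abelian_ideal" by (intro abelian(2))
  then show ?thesis by (simp add: weyl_operator_def algebra_simps)
qed

lemma weyl_operator_scale:
  "weyl_operator (scale c x) v - scalar_mult c (weyl_operator x v) \<in> abelian_ideal"
proof -
  have "half_ad (scale c x) v - scalar_mult c (half_ad x v) \<in> abelian_ideal"
    by (rule derivation_into_ideal[OF is_derivation_diff[OF _ is_derivation_scale]])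
      (simp_all add: is_derivation_half_ad two_sided_restricted_ideal half_ad_generator half_bracket_simps
        restricted_ideal_relations)
  moreover have "(generator (scale c x) - scalar_mult c (generator x)) * v \<in> abelian_ideal"
    by (intro abelian(4) restricted_ideal_relations)
  ultimately have "(generator (scale c x) - scalar_mult c (generator x)) * v + (half_ad (scale c x) v - scalar_mult c (half_ad x v))
      \<in> abelian_ideal" by (intro abelian(2))
  then show ?thesis
    by (simp add: weyl_operator_def left_diff_distrib free.scl_mult_left free.scale_right_distrib algebra_simps)
qed

text \<open>The commutator has three parts: a commutator of derivations, which vanishes in class 2;
  multiplication by \<open>half_bracket x y\<close> minus \<open>half_bracket y x\<close>, which
  amounts to \<open>bracket x y\<close>; and a commutator of generators, zero in the abelian
  quotient.\<close>

lemma weyl_operator_bracket: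
  "weyl_operator x (weyl_operator y v) - weyl_operator y (weyl_operator x v) - weyl_operator (bracket x y) v
    \<in> abelian_ideal"
proof -
  have 1: "half_ad x (half_ad y v) - half_ad y (half_ad x v) - half_ad (bracket x y) v \<in> abelian_ideal"
  proof -
    have "is_derivation (\<lambda>a. (half_ad x (half_ad y a) - half_ad y (half_ad x a)) - half_ad (bracket x y) a)"
      by (intro is_derivation_diff is_derivation_commutator is_derivation_half_ad)
    moreover
    have "half_ad x (half_ad y (generator e)) - half_ad y (half_ad x (generator e)) - half_ad (bracket x y) (generator e)
      \<in> abelian_ideal" for e
      by (simp only: half_ad_generator half_bracket_simps) (intro abelian(6) gen_zero)
    ultimately show ?thesis by (rule derivation_into_ideal[OF _ two_sided_restricted_ideal])
  qed
  have "generator (half_bracket x y) - generator (half_bracket y x) - generator (bracket x y) \<in> abelian_ideal"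
  proof -
    have "generator (half_bracket x y + half_bracket x y) - (generator (half_bracket x y) + generator (half_bracket x y)) \<in> abelian_ideal"
      by (rule restricted_ideal_relations)
    from abelian(6)[OF abelian(5)[OF gen_uminus[of "half_bracket x y"]] this]
    show ?thesis by (simp add: half_bracket_double half_bracket_swap[of y x] algebra_simps)
  qed
  then have 2: "(generator (half_bracket x y) - generator (half_bracket y x) - generator (bracket x y)) * v \<in> abelian_ideal"
    by (rule abelian(4))
  have 3: "(generator x * generator y - generator y * generator x) * v \<in> abelian_ideal"
    by (intro abelian(4) abelian_commute)
  show ?thesis
    using abelian(2)[OF abelian(2)[OF 1 2] 3]
    by (simp add: weyl_operator_def half_ad half_ad_generator algebra_simps)
qed

text \<open>Since \<open>half_bracket x x = 0\<close>, the derivation \<open>half_ad x\<close> kills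
  powers of \<open>generator x\<close> modulo the ideal. The two summands of the operator therefore
  commute, and the binomial theorem holds for them.\<close>

lemma weyl_operator_pow:
  "(weyl_operator x ^^ n) v - (\<Sum>k\<le>n. of_nat (n choose k) * (generator x ^ k * (half_ad x ^^ (n - k)) v))
    \<in> abelian_ideal"
proof (induction n)
  case 0
  then show ?case by (simp add: abelian(1))
next
  case (Suc n)
  let ?F = "\<lambda>k l. generator x ^ k * (half_ad x ^^ l) v"
  let ?S = "\<lambda>n. \<Sum>k\<le>n. of_nat (n choose k) * ?F k (n - k)"
  have of_nat: "half_ad x (of_nat m * a) = of_nat m * half_ad x a" for m a
    by (induction m) (simp_all add: half_ad distrib_right)
  have sum: "half_ad x (sum f A) = (\<Sum>i\<in>A. half_ad x (f i))" for f and A :: "nat set"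
    by (induction A rule: infinite_finite_induct) (simp_all add: half_ad)
  have pow: "half_ad x (generator x ^ k) \<in> abelian_ideal" for k
    by (induction k)
      (simp_all add: half_ad half_ad_generator half_bracket_simps abelian(1) abelian(2) abelian(3) abelian(4)[OF gen_zero])
  have "(\<Sum>k\<in>A. of_nat (n choose k) * (half_ad x (generator x ^ k) * (half_ad x ^^ (n - k)) v)) \<in> abelian_ideal"
    for A :: "nat set"
    by (induction A rule: infinite_finite_induct) (simp_all add: abelian(1,2,3) abelian(4)[OF pow])
  moreover have "weyl_operator x (?S n) = ?S (Suc n) +
      (\<Sum>k\<le>n. of_nat (n choose k) * (half_ad x (generator x ^ k) * (half_ad x ^^ (n - k)) v))"
  proof -
    have "generator x * (of_nat m * a) = of_nat m * (generator x * a)" for m and a :: "'l word \<Rightarrow>\<^sub>0 'f"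
      by (metis mult.assoc mult_of_nat_commute)
    then have "weyl_operator x (?S n) =
      (\<Sum>k\<le>n. of_nat (n choose k) * (?F (Suc k) (n - k))) + (\<Sum>k\<le>n. of_nat (n choose k) *
        (half_ad x (generator x ^ k) * (half_ad x ^^ (n - k)) v + ?F k (Suc (n - k))))"
      by (simp add: weyl_operator_def sum_distrib_left sum of_nat) (simp add: half_ad mult.assoc)
    also have "\<dots> = (\<Sum>k\<le>n. of_nat (n choose k) * (?F (Suc k) (n - k) + ?F k (Suc (n - k)))) +
      (\<Sum>k\<le>n. of_nat (n choose k) * (half_ad x (generator x ^ k) * (half_ad x ^^ (n - k)) v))"
      by (simp only: distrib_left sum.distrib) (simp only: add_ac)
    finally show ?thesis unfolding sum_binomial_step[of n ?F] .
  qed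
  moreover have "weyl_operator x ((weyl_operator x ^^ n) v - ?S n) \<in> abelian_ideal"
    using Suc by (rule weyl_abelian_ideal)
  moreover have "weyl_operator x (a - b) = weyl_operator x a - weyl_operator x b" for a b
    using weyl_add[of x "a - b" b] by simp
  ultimately have "(weyl_operator x ((weyl_operator x ^^ n) v) - weyl_operator x (?S n)) +
      (weyl_operator x (?S n) - ?S (Suc n)) \<in> abelian_ideal"
    by (intro abelian(2)) simp_all
  then show ?case by (simp only: funpow.simps comp_def add_diff_eq diff_add_cancel)
qed

text \<open>In characteristic p only the p-th powers of the two summands remain. The p-th power of
  \<open>half_ad x\<close> is a derivation vanishing on generators, the p-th power of
  \<open>generator x\<close> is \<open>generator (pmap x)\<close>, and
  \<open>half_ad (pmap x)\<close> is zero because \<open>pmap x\<close> is central.\<close>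

lemma weyl_operator_pmap:
  "(weyl_operator x ^^ CHAR('f)) v - weyl_operator (pmap x) v \<in> abelian_ideal"
proof -
  have 1: "(weyl_operator x ^^ CHAR('f)) v - ((half_ad x ^^ CHAR('f)) v + generator x ^ CHAR('f) * v) \<in> abelian_ideal"
    using weyl_operator_pow[of "CHAR('f)" x v] unfolding sum_binomial_prime_char[OF prime_char] by simp
  have 2: "(half_ad x ^^ CHAR('f)) v \<in> abelian_ideal"
  proof (rule derivation_into_ideal[OF is_derivation_pow_char[OF is_derivation_half_ad prime_char]])
    have "(half_ad x ^^ Suc (Suc n)) (generator e) = generator 0" for e n
      by (induction n) (simp_all add: half_ad_generator half_bracket_simps)
    then show "(half_ad x ^^ CHAR('f)) (generator e) \<in> abelian_ideal" for e
      using gen_zero char_eq_Suc_Suc by metis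
  qed (rule two_sided_restricted_ideal)
  have 3: "(generator x ^ CHAR('f) - generator (pmap x)) * v \<in> abelian_ideal"
    by (intro abelian(4) restricted_ideal_relations)
  have 4: "half_ad (pmap x) v \<in> abelian_ideal"
    by (rule derivation_into_ideal)
      (simp_all add: is_derivation_half_ad two_sided_restricted_ideal half_ad_generator half_bracket_simps gen_zero)
  show ?thesis
    using abelian(6)[OF abelian(2)[OF abelian(2)[OF 1 2] 3] 4]
    by (simp add: weyl_operator_def algebra_simps)
qed

lemma word_action_restricted_ideal:
  assumes "a \<in> restricted_ideal scale bracket pmap"
  shows "word_action weyl_operator a v \<in> abelian_ideal"
proof -
  \<comment> \<open>Quantifying over \<open>v\<close> makes this the annihilator of a module, hence
    closed under multiplication from the right as well.\<close>
  let ?T = "{a. \<forall>v. word_action weyl_operator a v \<in> abelian_ideal}"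
  note mult = word_action_mult[of weyl_operator, OF weyl_add weyl_scale]
  have T: "two_sided ?T"
    unfolding two_sided_def
    by (auto simp: word_action_left mult abelian(1,2)
      intro: word_action_mem[OF two_sided_restricted_ideal] weyl_abelian_ideal)
  have "restricted_relations scale bracket pmap \<subseteq> ?T"
    unfolding restricted_relations_subset_iff mem_Collect_eq
    by (auto simp only: word_action_left mult word_action_generator
      word_action_power[of weyl_operator, OF weyl_add weyl_scale]
      weyl_operator_sum weyl_operator_scale weyl_operator_bracket weyl_operator_pmap)
  then have "restricted_ideal scale bracket pmap \<subseteq> ?T"
    unfolding restricted_ideal_def[of scale bracket] by (rule ideal_closure_least[OF T])
  with assms show ?thesis by blast
qed

text \<open>The operator of \<open>z\<close> sends 1 to \<open>generator z\<close>, because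
  derivations kill 1. So if \<open>generator z\<close> were zero in u(L), it would be zero in the
  abelian case.\<close>

theorem generator_notin_restricted_ideal:
  assumes "\<And>x. (pmap ^^ Suc m) x = 0" "z \<noteq> 0"
  shows "generator z \<notin> restricted_ideal scale bracket pmap"
proof
  assume "generator z \<in> restricted_ideal scale bracket pmap"
  then have "word_action weyl_operator (generator z) 1 \<in> abelian_ideal"
    by (rule word_action_restricted_ideal)
  then have "generator z \<in> abelian_ideal"
    by (simp add: word_action_generator weyl_operator_def half_ad)
  with generator_notin_commutative_ideal assms show False by blast
qed

end

section \<open>The augmentation ideal\<close>

definition augmentation_ideal :: "('l word \<Rightarrow>\<^sub>0 'f::field) set" where
  "augmentation_ideal = {a. Poly_Mapping.lookup a 0 = 0}"

text \<open>A concatenation is empty only if both words are, so the constant term is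
  multiplicative.\<close>

lemma lookup_mult_zero:
  fixes a b :: "'l word \<Rightarrow>\<^sub>0 'f::field"
  shows "Poly_Mapping.lookup (a * b) 0 = Poly_Mapping.lookup a 0 * Poly_Mapping.lookup b 0"
proof (induction a rule: poly_mapping_single_induct)
  case (2 u c)
  show ?case
  proof (induction b rule: poly_mapping_single_induct)
    case (2 v d)
    have "u + v = 0 \<longleftrightarrow> u = 0 \<and> v = 0"
      by (cases u; cases v) (simp add: zero_word_def plus_word_def)
    then show ?case by (auto simp: mult_single lookup_single when_def)
  qed (simp_all add: distrib_left lookup_add)
qed (simp_all add: distrib_right lookup_add)

lemma lookup_power_zero:
  fixes a :: "'l word \<Rightarrow>\<^sub>0 'f::field"
  shows "Poly_Mapping.lookup (a ^ n) 0 = Poly_Mapping.lookup a 0 ^ n"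
  by (induction n) (simp_all add: lookup_mult_zero)

lemma lookup_generator_zero: "Poly_Mapping.lookup (generator x) 0 = 0"
  by (simp add: generator_def lookup_single zero_word_def when_def)

lemma two_sided_augmentation_ideal: "two_sided augmentation_ideal"
  unfolding two_sided_def augmentation_ideal_def by (auto simp: lookup_mult_zero lookup_add)

lemma generator_mem_augmentation_ideal: "generator x \<in> augmentation_ideal"
  by (simp add: augmentation_ideal_def lookup_generator_zero)

lemma augmentation_ideal_decompose:
  "a - scalar_mult (Poly_Mapping.lookup a 0) 1 \<in> augmentation_ideal"
  by (simp add: augmentation_ideal_def lookup_minus scalar_mult_def)

text \<open>Every nonempty word ends in a letter, so the elements \<open>a * generator x\<close>
  span the ideal.\<close>

lemma augmentation_ideal_least:
  fixes Z :: "('l word \<Rightarrow>\<^sub>0 'f::field) set"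
  assumes "free.subspace Z" "\<And>a x. a * generator x \<in> Z"
  shows "augmentation_ideal \<subseteq> Z"
proof
  fix a :: "'l word \<Rightarrow>\<^sub>0 'f" assume a: "a \<in> augmentation_ideal"
  have "(\<Sum>w\<in>Poly_Mapping.keys a. Poly_Mapping.single w (Poly_Mapping.lookup a w)) \<in> Z"
  proof (rule free.subspace_sum[OF assms(1)])
    fix w assume w: "w \<in> Poly_Mapping.keys a"
    then have "w \<noteq> 0" using a by (auto simp: augmentation_ideal_def in_keys_iff)
    then have "letters w \<noteq> []" by (cases w) (auto simp: zero_word_def)
    then obtain ys x where ws: "letters w = ys @ [x]" by (metis rev_exhaust)
    show "Poly_Mapping.single w (Poly_Mapping.lookup a w) \<in> Z"
      unfolding single_eq_scalar_mult_monomial ws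
      by (simp add: monomial_append monomial_singleton free.subspace_scale assms)
  qed
  then show "a \<in> Z" by (simp flip: poly_mapping_sum_single)
qed

section \<open>The commutator ideal, the square of the augmentation ideal and nilpotency\<close>

context class2_restricted_lie_algebra
begin

abbreviation "rel_ideal \<equiv> restricted_ideal scale bracket pmap"

lemmas rel = two_sidedD[OF two_sided_restricted_ideal[of scale bracket pmap]]

sublocale U: algebra_modulo scalar_mult rel_ideal
  by unfold_locales (auto intro: two_sided_subspace two_sided_restricted_ideal rel)

definition brackets :: "('l word \<Rightarrow>\<^sub>0 'f) set" where
  "brackets = {generator (bracket x y) | x y. True}"

lemma restricted_relation:
  "generator (x + y) - (generator x + generator y) \<in> rel_ideal"
  "generator (scale c x) - scalar_mult c (generator x) \<in> rel_ideal"
  "generator x * generator y - generator y * generator x - generator (bracket x y) \<in> rel_ideal"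
  "generator x ^ CHAR('f) - generator (pmap x) \<in> rel_ideal"
  by (rule restricted_ideal_relations)+

lemma generator_zero: "generator 0 \<in> rel_ideal"
  by (rule generator_zero_mem) (rule vector_space_axioms)

lemma rel_ideal_subset_augmentation: "rel_ideal \<subseteq> augmentation_ideal"
  unfolding restricted_ideal_def
proof (rule ideal_closure_least[OF two_sided_augmentation_ideal])
  show "restricted_relations scale bracket pmap \<subseteq> augmentation_ideal"
    unfolding restricted_relations_subset_iff
    using char_pos
    by (auto simp: augmentation_ideal_def lookup_minus lookup_add lookup_generator_zero lookup_mult_zero
      lookup_power_zero scalar_mult_def power_0_left)
qed

lemma over_ideal_augmentation: "U.over_ideal augmentation_ideal"
  unfolding U.over_ideal_def
  using rel_ideal_subset_augmentation two_sidedD[OF two_sided_augmentation_ideal]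
  by (auto intro: two_sided_subspace[OF two_sided_augmentation_ideal])

text \<open>Modulo the relations \<open>generator\<close> is linear, so the preimage in L of a
  subspace containing \<open>rel_ideal\<close> is a subspace.\<close>

lemma generator_mem_span:
  assumes "x \<in> span T" "generator ` T \<subseteq> Z" "rel_ideal \<subseteq> Z" "free.subspace Z"
  shows "generator x \<in> Z"
proof -
  note Z = free.subspace_add[OF assms(4)] free.subspace_scale[OF assms(4)]
  have "span T \<subseteq> {x. generator x \<in> Z}"
  proof (rule span_minimal)
    show "subspace {x. generator x \<in> Z}"
      unfolding subspace_def
    proof safe
      show "generator 0 \<in> Z" using generator_zero assms(3) by blast
      show "generator (x + y) \<in> Z" if "generator x \<in> Z" "generator y \<in> Z" for x y
        using Z(1)[OF subsetD[OF assms(3) restricted_relation(1)[of x y]] Z(1)[OF that]] by simp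
      show "generator (scale c x) \<in> Z" if "generator x \<in> Z" for c x
        using Z(1)[OF subsetD[OF assms(3) restricted_relation(2)[of c x]] Z(2)[OF that, of c]] by simp
    qed
  qed (use assms(2) in blast)
  with assms(1) show ?thesis by blast
qed

lemma brackets_central:
  assumes "c \<in> brackets" shows "c * a - a * c \<in> rel_ideal"
proof -
  obtain u v where c: "c = generator (bracket u v)" using assms unfolding brackets_def by blast
  have gen: "c * generator x - generator x * c \<in> rel_ideal" for x
    using rel(2)[OF restricted_relation(3)[of "bracket u v" x] generator_zero] by (simp add: c bracket_bracket)
  have "{a. c * a - a * c \<in> rel_ideal} = UNIV"
  proof (rule free_subspace_eq_UNIV)
    show "free.subspace {a. c * a - a * c \<in> rel_ideal}"
      by (rule free.subspace_vimage_linear[OF free.linear_commutator_left U.subspace_K])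
    fix x a assume "a \<in> {a. c * a - a * c \<in> rel_ideal}"
    then have "(c * generator x - generator x * c) * a + generator x * (c * a - a * c) \<in> rel_ideal"
      by (intro rel(2) rel(4)[OF gen] rel(3)) simp
    then show "generator x * a \<in> {a. c * a - a * c \<in> rel_ideal}" by (simp add: algebra_simps)
  qed (simp add: rel)
  then show ?thesis by blast
qed

lemma over_ideal_brackets: "U.over_ideal (U.prd brackets UNIV)"
  by (rule U.over_ideal_central_prd) (rule brackets_central)

text \<open>Generators commute modulo the ideal by the defining relations, and the Leibniz rule
  extends this to one argument at a time.\<close>

lemma commutator_mem: "a * b - b * a \<in> U.prd brackets UNIV"
proof -
  let ?I = "U.prd brackets UNIV"
  note I = U.over_idealD[OF over_ideal_brackets]
  have 1: "generator x * generator y - generator y * generator x \<in> ?I" for x y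
  proof -
    have "generator (bracket x y) \<in> ?I"
      using U.prd_mem[of "generator (bracket x y)" brackets 1 UNIV] by (auto simp: brackets_def)
    from free.subspace_add[OF I(1) subsetD[OF I(2) restricted_relation(3)[of x y]] this] show ?thesis by simp
  qed
  have 2: "generator x * a - a * generator x \<in> ?I" for x a
  proof -
    have "{a. generator x * a - a * generator x \<in> ?I} = UNIV"
    proof (rule free_subspace_eq_UNIV)
      show "free.subspace {a. generator x * a - a * generator x \<in> ?I}"
        by (rule free.subspace_vimage_linear[OF free.linear_commutator_left I(1)])
      fix y a assume "a \<in> {a. generator x * a - a * generator x \<in> ?I}"
      then have "(generator x * generator y - generator y * generator x) * a + generator y * (generator x * a - a * generator x) \<in> ?I"
        by (intro free.subspace_add[OF I(1)] I(4)[OF 1] I(3)) simp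
      then show "generator y * a \<in> {a. generator x * a - a * generator x \<in> ?I}" by (simp add: algebra_simps)
    qed (simp add: free.subspace_0[OF I(1)])
    then show ?thesis by blast
  qed
  have "{a. a * b - b * a \<in> ?I} = UNIV"
  proof (rule free_subspace_eq_UNIV)
    show "free.subspace {a. a * b - b * a \<in> ?I}"
      by (rule free.subspace_vimage_linear[OF free.linear_commutator_right I(1)])
    fix x a assume "a \<in> {a. a * b - b * a \<in> ?I}"
    then have "generator x * (a * b - b * a) + (generator x * b - b * generator x) * a \<in> ?I"
      by (intro free.subspace_add[OF I(1)] I(4)[OF 2] I(3)) simp
    then show "generator x * a \<in> {a. a * b - b * a \<in> ?I}" by (simp add: algebra_simps)
  qed (simp add: free.subspace_0[OF I(1)])
  then show ?thesis by blast
qed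

lemma rel_ideal_power:
  assumes "a - b \<in> rel_ideal" shows "a ^ n - b ^ n \<in> rel_ideal"
proof (induction n)
  case (Suc n)
  have "(a - b) * a ^ n + b * (a ^ n - b ^ n) \<in> rel_ideal"
    by (intro rel(2) rel(4)[OF assms] rel(3)[OF Suc])
  then show ?case by (simp add: algebra_simps)
qed (simp add: rel)

lemma generator_pow_char: "generator x ^ (CHAR('f) ^ n) - generator ((pmap ^^ n) x) \<in> rel_ideal"
proof (induction n)
  case (Suc n)
  have "(generator x ^ (CHAR('f) ^ n)) ^ CHAR('f) - generator ((pmap ^^ n) x) ^ CHAR('f) \<in> rel_ideal"
    by (rule rel_ideal_power[OF Suc])
  from rel(2)[OF this restricted_relation(4)[of "(pmap ^^ n) x"]] show ?case
    by (simp add: power_mult[symmetric] mult.commute)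
qed (simp add: rel)

lemma generator_bracket_mem: "generator (bracket x y) \<in> U.prd augmentation_ideal augmentation_ideal"
proof -
  let ?J2 = "U.prd augmentation_ideal augmentation_ideal"
  note sub = U.subspace_prd[of augmentation_ideal augmentation_ideal]
  have "generator x * generator y - generator y * generator x \<in> ?J2"
    by (intro free.subspace_diff[OF sub] U.prd_mem generator_mem_augmentation_ideal)
  from free.subspace_diff[OF sub this U.K_mem_prd[OF restricted_relation(3)[of x y]]] show ?thesis by simp
qed

text \<open>Modulo the relations this is a p-th power, hence a product of at least two factors from
  the augmentation ideal.\<close>

lemma generator_pmap_mem: "generator (pmap x) \<in> U.prd augmentation_ideal augmentation_ideal"
proof -
  let ?J2 = "U.prd augmentation_ideal augmentation_ideal"
  note sub = U.subspace_prd[of augmentation_ideal augmentation_ideal]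
  obtain n where n: "CHAR('f) = Suc (Suc (Suc n))" using char_eq_Suc_Suc by blast
  have "generator x * (generator x * generator x ^ Suc n) \<in> ?J2"
    by (intro U.prd_mem generator_mem_augmentation_ideal two_sidedD(4)[OF two_sided_augmentation_ideal])
  then have "generator x ^ CHAR('f) \<in> ?J2" by (simp only: n power_Suc)
  from free.subspace_diff[OF sub this U.K_mem_prd[OF restricted_relation(4)[of x]]] show ?thesis by simp
qed

text \<open>Modulo the square, \<open>a * generator x\<close> depends only on the constant term of
  \<open>a\<close>, and the relations turn a scalar multiple or a sum of generators into one
  generator.\<close>

lemma augmentation_mod_square:
  assumes "b \<in> augmentation_ideal"
  shows "\<exists>x. b - generator x \<in> U.prd augmentation_ideal augmentation_ideal"
proof -
  let ?J2 = "U.prd augmentation_ideal augmentation_ideal"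
  note sub = U.subspace_prd[of augmentation_ideal augmentation_ideal]
  let ?Z = "{b. \<exists>x. b - generator x \<in> ?J2}"
  have "free.subspace ?Z"
    unfolding free.subspace_def
  proof safe
    show "\<exists>x. 0 - generator x \<in> ?J2"
      using free.subspace_neg[OF sub U.K_mem_prd[OF generator_zero]] by auto
  next
    fix a b x y assume a: "a - generator x \<in> ?J2" "b - generator y \<in> ?J2"
    from free.subspace_diff[OF sub free.subspace_add[OF sub a] U.K_mem_prd[OF restricted_relation(1)[of x y]]]
    have "a + b - generator (x + y) \<in> ?J2" by (simp add: algebra_simps)
    then show "\<exists>z. a + b - generator z \<in> ?J2" ..
  next
    fix c a x assume a: "a - generator x \<in> ?J2"
    from free.subspace_diff[OF sub free.subspace_scale[OF sub a, of c] U.K_mem_prd[OF restricted_relation(2)[of c x]]]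
    have "scalar_mult c a - generator (scale c x) \<in> ?J2" by (simp add: free.scale_right_diff_distrib)
    then show "\<exists>z. scalar_mult c a - generator z \<in> ?J2" ..
  qed
  moreover have "a * generator x \<in> ?Z" for a x
  proof -
    let ?c = "Poly_Mapping.lookup a 0"
    have "(a - scalar_mult ?c 1) * generator x \<in> ?J2"
      by (intro U.prd_mem augmentation_ideal_decompose generator_mem_augmentation_ideal)
    from free.subspace_diff[OF sub this U.K_mem_prd[OF restricted_relation(2)[of ?c x]]]
    have "a * generator x - generator (scale ?c x) \<in> ?J2" by (simp add: left_diff_distrib free.scl_mult_left)
    then show ?thesis by blast
  qed
  ultimately have "augmentation_ideal \<subseteq> ?Z" by (rule augmentation_ideal_least)
  with assms show ?thesis by blast
qed

text \<open>Modulo the square, \<open>b\<close> is some \<open>generator x\<close>, and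
  \<open>x\<close> is not in the span of brackets and p-th powers, as these lie in the square. A
  linear form that separates \<open>x\<close> from that span, used as the values on generators,
  respects every relation.\<close>

lemma exists_derivation:
  assumes b: "b \<in> augmentation_ideal" "b \<notin> U.prd augmentation_ideal augmentation_ideal"
  shows "\<exists>D. Vector_Spaces.linear scalar_mult scalar_mult D \<and> (\<forall>a b. D (a * b) = D a * b + a * D b) \<and>
    D ` rel_ideal \<subseteq> rel_ideal \<and> D ` brackets \<subseteq> rel_ideal \<and> D b - 1 \<in> augmentation_ideal"
proof -
  let ?J2 = "U.prd augmentation_ideal augmentation_ideal"
  note sub = U.subspace_prd[of augmentation_ideal augmentation_ideal]
  let ?P = "span ({bracket x y | x y. True} \<union> range pmap)"
  obtain x where x: "b - generator x \<in> ?J2" using augmentation_mod_square[OF b(1)] by blast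
  have "x \<notin> ?P"
  proof
    assume "x \<in> ?P"
    then have "generator x \<in> ?J2"
      by (rule generator_mem_span) (use generator_bracket_mem generator_pmap_mem U.K_subset_prd sub in auto)
    from free.subspace_add[OF sub x this] b(2) show False by simp
  qed
  then obtain f where f: "Vector_Spaces.linear scale (*) f" "f x = 1" "\<And>y. y \<in> ?P \<Longrightarrow> f y = 0"
    using separating_functional[OF vector_space_axioms subspace_span] by blast
  interpret f: Vector_Spaces.linear scale "(*)" f by fact
  have f0: "f (bracket x y) = 0" "f (pmap x) = 0" for x y
    by (rule f(3), rule span_base, blast)+
  define D where "D = derivation (\<lambda>e. Poly_Mapping.single 0 (f e))"
  have isD: "is_derivation D" unfolding D_def by (rule is_derivation_derivation)
  note D = is_derivationD[OF isD]
  have D_gen: "D (generator e) = Poly_Mapping.single 0 (f e)" for e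
    unfolding D_def by (rule derivation_generator)
  have K: "D a \<in> rel_ideal" if "a \<in> rel_ideal" for a
    using that unfolding D_def restricted_ideal_def
  proof (rule derivation_ideal_closure[rotated])
    have "restricted_relations scale bracket pmap \<subseteq> {a. D a \<in> rel_ideal}"
      unfolding restricted_relations_subset_iff mem_Collect_eq
    proof (intro conjI allI)
      fix x y c
      have "D (generator (x + y) - (generator x + generator y)) = 0"
        by (simp add: D D_gen f.add single_add)
      then show "D (generator (x + y) - (generator x + generator y)) \<in> rel_ideal" by (simp add: rel)
      have "D (generator (scale c x) - scalar_mult c (generator x)) = 0"
        by (simp only: D(2,5) D_gen f.scale) (simp add: scalar_mult_def mult_single)
      then show "D (generator (scale c x) - scalar_mult c (generator x)) \<in> rel_ideal" by (simp add: rel)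
      have "D (generator x * generator y - generator y * generator x - generator (bracket x y)) = 0"
        by (simp add: D D_gen f0 single_zero_commute)
      then show "D (generator x * generator y - generator y * generator x - generator (bracket x y)) \<in> rel_ideal"
        by (simp add: rel)
      \<comment> \<open>The value of \<open>D\<close> on a generator is a scalar, so it commutes
        with the generator.\<close>
      have "D (generator x ^ CHAR('f)) \<in> rel_ideal"
        by (rule derivation_power_char[OF isD two_sided_restricted_ideal])
          (simp add: D_gen single_zero_commute rel)
      then show "D (generator x ^ CHAR('f) - generator (pmap x)) \<in> rel_ideal"
        by (simp add: D D_gen f0)
    qed
    then show "derivation (\<lambda>e. Poly_Mapping.single 0 (f e)) a \<in> ideal_closure (restricted_relations scale bracket pmap)"
      if "a \<in> restricted_relations scale bracket pmap" for a
      using that unfolding D_def restricted_ideal_def by blast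
  qed
  have "D ` brackets \<subseteq> rel_ideal" by (auto simp: brackets_def D_gen f0 rel)
  moreover have "?J2 \<subseteq> {a. D a \<in> augmentation_ideal}"
  proof (rule U.prd_least)
    have "Vector_Spaces.linear scalar_mult scalar_mult D" using isD unfolding is_derivation_def by blast
    then show "free.subspace {a. D a \<in> augmentation_ideal}"
      by (rule free.subspace_vimage_linear) (rule two_sided_subspace[OF two_sided_augmentation_ideal])
    show "rel_ideal \<subseteq> {a. D a \<in> augmentation_ideal}" using K rel_ideal_subset_augmentation by blast
    show "a * b \<in> {a. D a \<in> augmentation_ideal}" if "a \<in> augmentation_ideal" "b \<in> augmentation_ideal"
      for a b :: "'l word \<Rightarrow>\<^sub>0 'f"
      using that by (simp add: D two_sidedD(2-4)[OF two_sided_augmentation_ideal])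
  qed
  \<comment> \<open>Elements of the square are mapped into the augmentation ideal, so
    \<open>D b\<close> agrees modulo it with \<open>f x = 1\<close>.\<close>
  then have "D (b - generator x) \<in> augmentation_ideal" using x by blast
  then have "D b - 1 \<in> augmentation_ideal" by (simp add: D D_gen f(2))
  ultimately show ?thesis using isD K unfolding is_derivation_def by blast
qed

text \<open>There are two layers. The brackets of basis elements are central and nilpotent modulo
  the relations, so the commutator ideal is nilpotent; the basis elements are central and nilpotent
  modulo the commutator ideal.\<close>

lemma nilpotent_augmentation:
  assumes B: "finite B" "span B = UNIV" and nil: "\<And>x. (pmap ^^ Suc m) x = 0"
  shows "U.nilpotent_over augmentation_ideal rel_ideal"
proof -
  have gen_nil: "generator x ^ (CHAR('f) ^ Suc m) \<in> rel_ideal" for x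
    using rel(2)[OF generator_pow_char[of x "Suc m"] generator_zero] nil[of x] by simp
  let ?I = "U.prd brackets UNIV"
  note I = U.over_idealD[OF over_ideal_brackets]
  let ?G = "(\<lambda>(x, y). generator (bracket x y)) ` (B \<times> B)"
  let ?Z = "free.span (rel_ideal \<union> {r * x | r x. x \<in> ?G})"
  have K: "U.over_ideal rel_ideal" unfolding U.over_ideal_def by (auto intro: rel U.subspace_K)
  have nilZ: "U.nilpotent_over ?Z rel_ideal"
  proof (rule U.nilpotent_over_adjoin_finite[OF _ K])
    show "finite ?G" using B(1) by simp
    fix x :: "'l word \<Rightarrow>\<^sub>0 'f" assume "x \<in> ?G"
    then have "x \<in> brackets" by (auto simp: brackets_def)
    then show "x * a - a * x \<in> rel_ideal" for a by (rule brackets_central)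
    obtain y where "x = generator y" using \<open>x \<in> ?G\<close> by auto
    then show "\<exists>n. x ^ n \<in> rel_ideal" using gen_nil by blast
  qed
  have KZ: "rel_ideal \<subseteq> ?Z" using free.span_superset by blast
  \<comment> \<open>Bilinearity reduces arbitrary brackets to the finitely many brackets of basis
    elements.\<close>
  have "r * generator (bracket x y) \<in> ?Z" for r x y
  proof -
    have "bracket x y \<in> span ((\<lambda>(x, y). bracket x y) ` (B \<times> B))" (is "_ \<in> span ?T")
    proof -
      have *: "span B \<subseteq> {x. bracket x b \<in> span ?T}" if "b \<in> B" for b
      proof (rule span_minimal)
        show "subspace {x. bracket x b \<in> span ?T}"
          by (simp add: subspace_def bracket_add_left bracket_scale_left bracket_zero_left span_zero span_add span_scale)
        show "B \<subseteq> {x. bracket x b \<in> span ?T}" using that by (auto intro!: span_base)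
      qed
      have "span B \<subseteq> {y. bracket x y \<in> span ?T}"
      proof (rule span_minimal)
        show "subspace {y. bracket x y \<in> span ?T}"
          by (simp add: subspace_def bracket_add_right bracket_scale_right bracket_zero_right span_zero span_add span_scale)
        show "B \<subseteq> {y. bracket x y \<in> span ?T}" using * B(2) by blast
      qed
      then show ?thesis using B(2) by blast
    qed
    then have "generator (bracket x y) \<in> {a. r * a \<in> ?Z}"
    proof (rule generator_mem_span)
      show "generator ` ?T \<subseteq> {a. r * a \<in> ?Z}" by (fastforce intro!: free.span_base)
      show "rel_ideal \<subseteq> {a. r * a \<in> ?Z}" using rel(3) KZ by blast
    qed (rule free.subspace_vimage_linear[OF free.linear_mult_left free.subspace_span])
    then show ?thesis by simp
  qed
  then have *: "r * c \<in> ?Z" if "c \<in> brackets" for r c using that unfolding brackets_def by blast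
  have "?I \<subseteq> ?Z"
  proof (rule U.prd_least[OF free.subspace_span KZ])
    fix c r assume c: "c \<in> brackets"
    \<comment> \<open>\<open>?Z\<close> is built from left multiples while \<open>?I\<close> is
      built from right multiples; centrality of \<open>c\<close> mediates between them.\<close>
    have "(c * r - r * c) + r * c \<in> ?Z"
      by (intro free.span_add subsetD[OF KZ brackets_central[OF c]] *[OF c])
    then show "c * r \<in> ?Z" by simp
  qed
  with nilZ have nilI: "U.nilpotent_over ?I rel_ideal" by (rule U.nilpotent_over_mono)
  let ?Y = "free.span (?I \<union> {r * x | r x. x \<in> generator ` B})"
  have "U.nilpotent_over ?Y ?I"
  proof (rule U.nilpotent_over_adjoin_finite[OF _ over_ideal_brackets])
    show "finite (generator ` B)" using B(1) by simp
    show "x * a - a * x \<in> ?I" for x a by (rule commutator_mem)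
    fix x :: "'l word \<Rightarrow>\<^sub>0 'f" assume "x \<in> generator ` B"
    then obtain y where "x = generator y" by auto
    then show "\<exists>n. x ^ n \<in> ?I" using gen_nil I(2) by blast
  qed
  moreover have "augmentation_ideal \<subseteq> ?Y"
  proof (rule augmentation_ideal_least[OF free.subspace_span])
    fix a and x :: 'l
    have "x \<in> span B" by (simp add: B(2))
    then have "generator x \<in> {b. a * b \<in> ?Y}"
    proof (rule generator_mem_span)
      show "generator ` B \<subseteq> {b. a * b \<in> ?Y}" by (auto intro!: free.span_base)
      show "rel_ideal \<subseteq> {b. a * b \<in> ?Y}" using rel(3) I(2) free.span_superset by blast
    qed (rule free.subspace_vimage_linear[OF free.linear_mult_left free.subspace_span])
    then show "a * generator x \<in> ?Y" by simp
  qed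
  ultimately have "U.nilpotent_over augmentation_ideal ?I" by (rule U.nilpotent_over_mono)
  with nilI show ?thesis by (rule U.nilpotent_over_trans)
qed

theorem no_contracted_semigroup_algebra:
  assumes B: "finite B" "span B = UNIV" and nil: "\<And>x. (pmap ^^ Suc m) x = 0"
    and nonabelian: "bracket x y \<noteq> 0"
    and S: "contracted_semigroup_algebra scalar_mult rel_ideal S"
    and span: "augmentation_ideal \<subseteq> free.span (S \<inter> augmentation_ideal)"
  shows False
proof -
  interpret S: contracted_semigroup_algebra scalar_mult rel_ideal S by (rule S)
  show False
  proof (rule S.no_contracted_radical[where J = augmentation_ideal and C = brackets])
    show "brackets \<subseteq> U.prd augmentation_ideal augmentation_ideal"
      using generator_bracket_mem unfolding brackets_def by blast
    show "brackets \<subseteq> free.span (rel_ideal \<union> {a * b - b * a | a b. a \<in> augmentation_ideal \<and> b \<in> augmentation_ideal})"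
      (is "_ \<subseteq> free.span ?X")
    proof
      fix c assume "c \<in> brackets"
      then obtain x y where c: "c = generator (bracket x y)" unfolding brackets_def by blast
      have "generator x * generator y - generator y * generator x \<in> free.span ?X"
        by (intro free.span_base UnI2 CollectI exI[of _ "generator x"] exI[of _ "generator y"] conjI refl
            generator_mem_augmentation_ideal)
      moreover have "generator x * generator y - generator y * generator x - generator (bracket x y) \<in> free.span ?X"
        by (intro free.span_base UnI1 restricted_relation)
      ultimately have "(generator x * generator y - generator y * generator x) -
        (generator x * generator y - generator y * generator x - generator (bracket x y)) \<in> free.span ?X"
        by (rule free.span_diff)
      then show "c \<in> free.span ?X" by (simp add: c)
    qed
    \<comment> \<open>Noncommutativity of u(L) enters here, through the representation by
      \<open>weyl_operator\<close>.\<close>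
    show "\<not> brackets \<subseteq> rel_ideal"
      using generator_notin_restricted_ideal[OF nil nonabelian] unfolding brackets_def by blast
  qed (rule char_gt_2 over_ideal_augmentation span nilpotent_augmentation[OF B nil] brackets_central
      commutator_mem exists_derivation | assumption)+
qed

end

section \<open>Passage to the quotient\<close>

lemma ring_extend:
  assumes "ring R" shows "ring (ring.extend R m)"
proof -
  interpret ring R by fact
  have *: "\<exists>y\<in>carrier R. y \<oplus>\<^bsub>R\<^esub> x = \<zero>\<^bsub>R\<^esub>" if "x \<in> carrier R" for x
    using that l_neg a_inv_closed by blast
  show ?thesis
  proof (rule ringI)
    show "abelian_group (ring.extend R m)"
      by (rule abelian_groupI) (simp_all add: ring.extend_def a_ac *)
    show "Group.monoid (ring.extend R m)"
      by (rule monoidI) (simp_all add: ring.extend_def m_assoc)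
  qed (simp_all add: ring.extend_def l_distr r_distr)
qed

text \<open>A fragment of the algebra axioms that passes to quotients, so that two quotients can be
  formed in succession. Since scalars act through multiples of one, every ring ideal is stable under
  them.\<close>

definition scalar_ring :: "('f::field, 'a) module \<Rightarrow> bool" where
  "scalar_ring M \<longleftrightarrow> ring M \<and> (\<forall>c. \<forall>x\<in>carrier M. c \<odot>\<^bsub>M\<^esub> x \<in> carrier M \<and>
    c \<odot>\<^bsub>M\<^esub> x = (c \<odot>\<^bsub>M\<^esub> \<one>\<^bsub>M\<^esub>) \<otimes>\<^bsub>M\<^esub> x)"

lemma quotient_algebra_simps:
  "carrier (M Quot\<^sub>a I) = a_rcosets\<^bsub>M\<^esub> I" "\<zero>\<^bsub>M Quot\<^sub>a I\<^esub> = I" "\<one>\<^bsub>M Quot\<^sub>a I\<^esub> = I +>\<^bsub>M\<^esub> \<one>\<^bsub>M\<^esub>"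
  "X \<otimes>\<^bsub>M Quot\<^sub>a I\<^esub> Y = rcoset_mult M I X Y" "X \<oplus>\<^bsub>M Quot\<^sub>a I\<^esub> Y = set_add M X Y"
  "c \<odot>\<^bsub>M Quot\<^sub>a I\<^esub> X = (\<Union>x\<in>X. I +>\<^bsub>M\<^esub> (c \<odot>\<^bsub>M\<^esub> x))"
  by (simp_all add: quotient_algebra_def ring.extend_def module.fields_def FactRing_def)

lemma quotient_algebra:
  fixes M :: "('f::field, 'a) module"
  assumes M: "scalar_ring M" and I: "ideal I M"
  defines "Q \<equiv> M Quot\<^sub>a I" and "h \<equiv> \<lambda>x. I +>\<^bsub>M\<^esub> x"
  shows "scalar_ring Q"
    and "h ` carrier M = carrier Q"
    and "ring_hom_ring M Q h"
    and "x \<in> carrier M \<Longrightarrow> h x = \<zero>\<^bsub>Q\<^esub> \<longleftrightarrow> x \<in> I"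
    and "x \<in> carrier M \<Longrightarrow> c \<odot>\<^bsub>Q\<^esub> h x = h (c \<odot>\<^bsub>M\<^esub> x)"
proof -
  interpret I: ideal I M by fact
  have rM: "ring M" and sM: "\<And>c x. x \<in> carrier M \<Longrightarrow> c \<odot>\<^bsub>M\<^esub> x \<in> carrier M"
    "\<And>c x. x \<in> carrier M \<Longrightarrow> c \<odot>\<^bsub>M\<^esub> x = (c \<odot>\<^bsub>M\<^esub> \<one>\<^bsub>M\<^esub>) \<otimes>\<^bsub>M\<^esub> x"
    using M unfolding scalar_ring_def by blast+
  have rQ: "ring Q"
    unfolding Q_def quotient_algebra_def by (rule ring_extend) (rule I.quotient_is_ring)
  show im: "h ` carrier M = carrier Q"
    unfolding Q_def h_def quotient_algebra_simps by (auto simp: A_RCOSETS_def')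
  have hom: "h \<in> Ring.ring_hom M Q"
    using I.rcos_ring_hom unfolding Ring.ring_hom_def Q_def h_def quotient_algebra_simps FactRing_def by simp
  then show hr: "ring_hom_ring M Q h" by (rule ring_hom_ringI2[OF rM rQ])
  show "h x = \<zero>\<^bsub>Q\<^esub> \<longleftrightarrow> x \<in> I" if "x \<in> carrier M" for x
    unfolding Q_def h_def quotient_algebra_simps
    using I.a_rcos_const I.rcos_const_imp_mem that by blast
  show sh: "c \<odot>\<^bsub>Q\<^esub> h x = h (c \<odot>\<^bsub>M\<^esub> x)" if x: "x \<in> carrier M" for c x
  proof -
    \<comment> \<open>All cosets in the union that defines the scalar action coincide, because a
      scalar multiple of an element of \<open>I\<close> stays in \<open>I\<close>.\<close>
    have "I +>\<^bsub>M\<^esub> (c \<odot>\<^bsub>M\<^esub> y) = I +>\<^bsub>M\<^esub> (c \<odot>\<^bsub>M\<^esub> x)" if "y \<in> I +>\<^bsub>M\<^esub> x" for y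
    proof -
      obtain i where i: "i \<in> I" "y = i \<oplus>\<^bsub>M\<^esub> x" using \<open>y \<in> I +>\<^bsub>M\<^esub> x\<close> by (auto simp: a_r_coset_def')
      have e: "c \<odot>\<^bsub>M\<^esub> \<one>\<^bsub>M\<^esub> \<in> carrier M" by (simp add: sM(1))
      have ic: "i \<in> carrier M" using i(1) by (rule I.Icarr)
      have "c \<odot>\<^bsub>M\<^esub> y = (c \<odot>\<^bsub>M\<^esub> \<one>\<^bsub>M\<^esub>) \<otimes>\<^bsub>M\<^esub> i \<oplus>\<^bsub>M\<^esub> (c \<odot>\<^bsub>M\<^esub> \<one>\<^bsub>M\<^esub>) \<otimes>\<^bsub>M\<^esub> x"
        using sM(2)[of y c] i x e ic by (simp add: I.r_distr)
      also have "\<dots> = (c \<odot>\<^bsub>M\<^esub> \<one>\<^bsub>M\<^esub>) \<otimes>\<^bsub>M\<^esub> i \<oplus>\<^bsub>M\<^esub> c \<odot>\<^bsub>M\<^esub> x" using sM(2)[OF x, of c] by simp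
      finally have "c \<odot>\<^bsub>M\<^esub> y \<in> I +>\<^bsub>M\<^esub> (c \<odot>\<^bsub>M\<^esub> x)"
        using I.I_l_closed[OF i(1) e] by (auto simp: a_r_coset_def')
      then show ?thesis
        unfolding a_r_coset_def
        by (rule I.add.repr_independence[symmetric]) (use sM(1)[OF x] I.a_subgroup in simp_all)
    qed
    moreover have "x \<in> I +>\<^bsub>M\<^esub> x" by (rule I.a_rcos_self[OF x])
    ultimately show ?thesis unfolding Q_def h_def quotient_algebra_simps by blast
  qed
  show "scalar_ring Q"
    unfolding scalar_ring_def
  proof (intro conjI rQ allI ballI)
    interpret h: ring_hom_ring M Q h by (rule hr)
    fix c X assume "X \<in> carrier Q"
    then obtain x where x: "x \<in> carrier M" "X = h x" using im by blast
    show "c \<odot>\<^bsub>Q\<^esub> X \<in> carrier Q" using x sh sM(1) by simp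
    have "\<one>\<^bsub>Q\<^esub> = h \<one>\<^bsub>M\<^esub>" by simp
    then have "c \<odot>\<^bsub>Q\<^esub> \<one>\<^bsub>Q\<^esub> = h (c \<odot>\<^bsub>M\<^esub> \<one>\<^bsub>M\<^esub>)" using sh[of "\<one>\<^bsub>M\<^esub>" c] by simp
    then show "c \<odot>\<^bsub>Q\<^esub> X = (c \<odot>\<^bsub>Q\<^esub> \<one>\<^bsub>Q\<^esub>) \<otimes>\<^bsub>Q\<^esub> X"
      using x sh sM(1) sM(2)[of x c] h.hom_mult[of "c \<odot>\<^bsub>M\<^esub> \<one>\<^bsub>M\<^esub>" x] by simp
  qed
qed

lemma free_algebra_simps:
  "carrier free_algebra = UNIV" "a \<otimes>\<^bsub>free_algebra\<^esub> b = a * b" "\<one>\<^bsub>free_algebra\<^esub> = 1"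
  "\<zero>\<^bsub>free_algebra\<^esub> = 0" "a \<oplus>\<^bsub>free_algebra\<^esub> b = a + b" "c \<odot>\<^bsub>free_algebra\<^esub> a = scalar_mult c a"
  by (simp_all add: free_algebra_def scalar_mult_def)

lemma scalar_ring_free_algebra: "scalar_ring (free_algebra :: ('f::field, 'l word \<Rightarrow>\<^sub>0 'f) module)"
proof -
  have "ring (free_algebra :: ('f, 'l word \<Rightarrow>\<^sub>0 'f) module)"
    by (rule ringI; (rule abelian_groupI | rule monoidI)?)
      (auto simp: free_algebra_simps algebra_simps intro: exI[of _ "- x" for x] add.left_inverse)
  then show ?thesis
    unfolding scalar_ring_def by (simp add: free_algebra_simps free.scl_mult_left)
qed

lemma two_sided_ideal:
  assumes "two_sided T" shows "ideal T free_algebra"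
proof (rule idealI)
  note T = two_sidedD[OF assms]
  interpret F: ring free_algebra using scalar_ring_free_algebra unfolding scalar_ring_def by blast
  show "subgroup T (add_monoid free_algebra)"
  proof (rule F.add.subgroupI)
    have "\<ominus>\<^bsub>free_algebra\<^esub> a = - a" for a :: "'a word \<Rightarrow>\<^sub>0 'b"
      by (rule F.minus_equality) (simp_all add: free_algebra_simps)
    then show "\<ominus>\<^bsub>free_algebra\<^esub> a \<in> T" if "a \<in> T" for a using T(5) that by simp
  qed (use T in \<open>auto simp: free_algebra_simps\<close>)
qed (use scalar_ring_free_algebra two_sidedD[OF assms] in \<open>auto simp: scalar_ring_def free_algebra_simps\<close>)


section \<open>Transfer between a record-based algebra and a ring that maps onto it\<close>

locale algebra_presentation = scalar_algebra scl
  for scl :: "'f::field \<Rightarrow> 'r::ring_1 \<Rightarrow> 'r" +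
  fixes A :: "('f, 'a) module" and \<pi> :: "'r \<Rightarrow> 'a"
  assumes ring_A: "ring A"
    and range_\<pi>: "range \<pi> = carrier A"
    and \<pi>_add: "\<pi> (a + b) = \<pi> a \<oplus>\<^bsub>A\<^esub> \<pi> b"
    and \<pi>_mult: "\<pi> (a * b) = \<pi> a \<otimes>\<^bsub>A\<^esub> \<pi> b"
    and \<pi>_one: "\<pi> 1 = \<one>\<^bsub>A\<^esub>"
    and \<pi>_scale: "\<pi> (scl c a) = c \<odot>\<^bsub>A\<^esub> \<pi> a"
begin

sublocale A: ring A by (rule ring_A)

definition ker :: "'r set" where
  "ker = {a. \<pi> a = \<zero>\<^bsub>A\<^esub>}"

lemma \<pi>_carrier [simp]: "\<pi> a \<in> carrier A"
  using range_\<pi> by blast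

lemma \<pi>_zero: "\<pi> 0 = \<zero>\<^bsub>A\<^esub>"
proof -
  have "\<pi> 0 \<oplus>\<^bsub>A\<^esub> \<pi> 0 = \<pi> 0" using \<pi>_add[of 0 0] by simp
  then show ?thesis by (simp add: A.add.l_cancel_one)
qed

lemma \<pi>_uminus: "\<pi> (- a) = \<ominus>\<^bsub>A\<^esub> \<pi> a"
  by (rule A.minus_equality[symmetric]) (simp_all add: \<pi>_add[symmetric] \<pi>_zero)

lemma \<pi>_eq_iff: "\<pi> a = \<pi> b \<longleftrightarrow> a - b \<in> ker"
proof
  assume "\<pi> a = \<pi> b"
  then show "a - b \<in> ker"
    using \<pi>_add[of a "- b"] by (simp add: \<pi>_uminus ker_def A.r_neg)
next
  assume "a - b \<in> ker"
  then show "\<pi> a = \<pi> b" using \<pi>_add[of "a - b" b] by (simp add: ker_def)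
qed

lemma vectorspace_A: "vectorspace class_ring A"
proof (intro vectorspace.intro moduleI)
  fix c d :: 'f and x y assume "x \<in> carrier A" "y \<in> carrier A"
  then obtain a b where [simp]: "x = \<pi> a" "y = \<pi> b" using range_\<pi> by blast
  show "c \<odot>\<^bsub>A\<^esub> (x \<oplus>\<^bsub>A\<^esub> y) = c \<odot>\<^bsub>A\<^esub> x \<oplus>\<^bsub>A\<^esub> c \<odot>\<^bsub>A\<^esub> y"
    by (simp flip: \<pi>_add \<pi>_scale add: scale_right_distrib)
next
  fix c d :: 'f and x assume "x \<in> carrier A"
  then obtain a where [simp]: "x = \<pi> a" using range_\<pi> by blast
  show "c \<odot>\<^bsub>A\<^esub> x \<in> carrier A" by (simp flip: \<pi>_scale)
  show "(c \<oplus>\<^bsub>class_ring\<^esub> d) \<odot>\<^bsub>A\<^esub> x = c \<odot>\<^bsub>A\<^esub> x \<oplus>\<^bsub>A\<^esub> d \<odot>\<^bsub>A\<^esub> x"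
    by (simp flip: \<pi>_add \<pi>_scale add: scale_left_distrib)
  show "(c \<otimes>\<^bsub>class_ring\<^esub> d) \<odot>\<^bsub>A\<^esub> x = c \<odot>\<^bsub>A\<^esub> (d \<odot>\<^bsub>A\<^esub> x)"
    by (simp flip: \<pi>_scale)
  show "\<one>\<^bsub>class_ring\<^esub> \<odot>\<^bsub>A\<^esub> x = x" by (simp flip: \<pi>_scale)
qed (use class_field.field_axioms class_cring.is_cring A.is_abelian_group in auto)

sublocale V: vectorspace class_ring A by (rule vectorspace_A)

definition rep :: "'a \<Rightarrow> 'r" where
  "rep x = (SOME a. \<pi> a = x)"

lemma \<pi>_rep: "x \<in> carrier A \<Longrightarrow> \<pi> (rep x) = x"
  unfolding rep_def by (rule someI_ex) (metis imageE range_\<pi>)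

lemma \<pi>_sum: "finite X \<Longrightarrow> \<pi> (sum g X) = finsum A (\<lambda>b. \<pi> (g b)) X"
  by (induction X rule: finite_induct) (simp_all add: \<pi>_zero \<pi>_add)

lemma \<pi>_lincomb:
  assumes "finite X" "X \<subseteq> carrier A"
  shows "\<pi> (\<Sum>b\<in>X. scl (u b) (rep b)) = V.lincomb u X"
  unfolding \<pi>_sum[OF assms(1)] V.lincomb_def
  by (rule A.finsum_cong') (use assms(2) in \<open>auto simp: \<pi>_scale \<pi>_rep subset_iff intro!: V.smult_closed\<close>)

text \<open>A linear combination in \<open>A\<close> lifts to the same combination of
  representatives, up to an error in \<open>ker\<close>.\<close>

lemma V_span_mem_span:
  assumes "x \<in> V.span X" "X \<subseteq> carrier A" "\<pi> a = x" "ker \<subseteq> Z" "rep ` X \<subseteq> Z"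
  shows "a \<in> span Z"
proof -
  obtain u Y where Y: "finite Y" "Y \<subseteq> X" "x = V.lincomb u Y" using assms(1) unfolding V.span_def by blast
  let ?s = "\<Sum>b\<in>Y. scl (u b) (rep b)"
  have "\<pi> ?s = \<pi> a" using \<pi>_lincomb[of Y u] Y assms(2,3) by auto
  then have "a - ?s \<in> span Z" using \<pi>_eq_iff[of a ?s] assms(4) span_base by auto
  moreover have "?s \<in> span Z"
    by (intro span_sum span_scale span_base) (use Y(2) assms(5) in blast)
  ultimately have "(a - ?s) + ?s \<in> span Z" by (rule span_add)
  then show ?thesis by simp
qed

lemma submodule_image:
  assumes "subspace J"
  shows "LinearCombinations.submodule class_ring (\<pi> ` J) A"
proof (rule LinearCombinations.submodule.intro)
  fix x y assume "x \<in> \<pi> ` J" "y \<in> \<pi> ` J"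
  then obtain a b where "x = \<pi> a" "y = \<pi> b" "a \<in> J" "b \<in> J" by blast
  then show "x \<oplus>\<^bsub>A\<^esub> y \<in> \<pi> ` J" using subspace_add[OF assms] by (auto simp flip: \<pi>_add)
next
  fix c x assume "x \<in> \<pi> ` J"
  then show "c \<odot>\<^bsub>A\<^esub> x \<in> \<pi> ` J" using subspace_scale[OF assms] by (auto simp flip: \<pi>_scale)
next
  show "\<zero>\<^bsub>A\<^esub> \<in> \<pi> ` J" using subspace_0[OF assms] by (auto simp flip: \<pi>_zero)
qed (auto intro: V.module_axioms)

lemma additive_subgroup_image:
  assumes "subspace J"
  shows "additive_subgroup (\<pi> ` J) A"
proof (rule additive_subgroup.intro, rule A.add.subgroupI)
  fix x y assume "x \<in> \<pi> ` J" "y \<in> \<pi> ` J"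
  then obtain a b where "x = \<pi> a" "y = \<pi> b" "a \<in> J" "b \<in> J" by blast
  then show "x \<oplus>\<^bsub>A\<^esub> y \<in> \<pi> ` J" using subspace_add[OF assms] by (auto simp flip: \<pi>_add)
next
  fix x assume "x \<in> \<pi> ` J"
  then show "\<ominus>\<^bsub>A\<^esub> x \<in> \<pi> ` J" using subspace_neg[OF assms] by (auto simp flip: \<pi>_uminus)
qed (use subspace_0[OF assms] in auto)

lemma vectorspace_image:
  assumes "subspace J"
  shows "vectorspace class_ring (A\<lparr>carrier := \<pi> ` J\<rparr>)"
  using V.submodule_is_module[OF submodule_image[OF assms]] class_field.field_axioms
  by (rule vectorspace.intro)

sublocale algebra_modulo scl ker
proof unfold_locales
  have smult_zero: "c \<odot>\<^bsub>A\<^esub> \<zero>\<^bsub>A\<^esub> = \<zero>\<^bsub>A\<^esub>" for c using \<pi>_scale[of c 0] by (simp add: \<pi>_zero)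
  show "subspace ker" by (simp add: subspace_def ker_def \<pi>_zero \<pi>_add \<pi>_scale smult_zero)
qed (simp_all add: ker_def \<pi>_mult)

text \<open>A basis \<open>N\<close> of \<open>ker\<close> together with representatives of
  \<open>B\<close> is independent, so a functional can be prescribed as zero on \<open>N\<close> and
  as the indicator of \<open>P\<close> on the representatives.\<close>

lemma basis_functional:
  assumes B: "V.basis B"
    and P: "\<And>s t. \<pi> s \<in> B \<Longrightarrow> \<pi> t \<in> B \<Longrightarrow> \<pi> s = \<pi> t \<Longrightarrow> P s = P t"
  shows "\<exists>f. Vector_Spaces.linear scl (*) f \<and> (\<forall>s. \<pi> s \<in> B \<longrightarrow> f s = of_bool (P s)) \<and> (\<forall>s\<in>ker. f s = 0)"
proof -
  interpret W: vector_space_pair scl "(*)"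
    by (rule vector_space_pair.intro) (rule vector_space_axioms, rule vector_space_field_mult)
  have BA: "B \<subseteq> carrier A" and ind: "V.lin_indpt B" using B unfolding V.basis_def by auto
  obtain N where N: "N \<subseteq> ker" "independent N" "ker \<subseteq> span N"
    using maximal_independent_subset by blast
  have rep_B: "(\<Sum>b\<in>X. scl (u b) (rep b)) \<in> ker \<Longrightarrow> b \<in> X \<Longrightarrow> u b = 0" if X: "finite X" "X \<subseteq> B" for X u b
  proof (rule ccontr)
    assume *: "(\<Sum>b\<in>X. scl (u b) (rep b)) \<in> ker" "b \<in> X" "u b \<noteq> 0"
    then have "V.lincomb u X = \<zero>\<^bsub>A\<^esub>" using \<pi>_lincomb[of X u] X BA by (auto simp: ker_def)
    then have "V.lin_dep B" using * X by (intro V.lin_dep_crit[of X B u b]) auto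
    with ind show False by blast
  qed
  have inj: "inj_on rep B" by (rule inj_onI) (metis BA \<pi>_rep subsetD)
  have indW: "independent (N \<union> rep ` B)"
    unfolding dependent_explicit
  proof (intro notI, elim exE conjE bexE)
    fix T u v assume T: "finite T" "T \<subseteq> N \<union> rep ` B" "(\<Sum>v\<in>T. scl (u v) v) = 0" "v \<in> T" "u v \<noteq> 0"
    \<comment> \<open>\<open>X\<close> indexes the part of the dependence outside \<open>N\<close>.
      The rest of the sum lies in \<open>ker\<close>, so the part over \<open>X\<close> does too,
      and independence of \<open>B\<close> in \<open>A\<close> makes its coefficients zero.\<close>
    define X where "X = {b \<in> B. rep b \<in> T - N}"
    have TX: "T - N = rep ` X" using T(2) by (auto simp: X_def)
    have injX: "inj_on rep X" by (rule inj_on_subset[OF inj]) (auto simp: X_def)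
    have "finite (rep ` X)" unfolding TX[symmetric] using T(1) by simp
    then have X: "finite X" "X \<subseteq> B" by (rule finite_imageD[OF _ injX]) (simp add: X_def)
    have sum: "(\<Sum>v\<in>T \<inter> N. scl (u v) v) + (\<Sum>b\<in>X. scl (u (rep b)) (rep b)) = 0"
      using sum.Int_Diff[OF T(1), of "\<lambda>v. scl (u v) v" N] T(3) unfolding TX sum.reindex[OF injX] by simp
    have "(\<Sum>v\<in>T \<inter> N. scl (u v) v) \<in> ker"
      by (intro subspace_sum subspace_scale subspace_K) (use N(1) in blast)
    then have "- (\<Sum>v\<in>T \<inter> N. scl (u v) v) \<in> ker" by (rule subspace_neg[OF subspace_K])
    moreover have "- (\<Sum>v\<in>T \<inter> N. scl (u v) v) = (\<Sum>b\<in>X. scl (u (rep b)) (rep b))"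
      using sum by (simp add: minus_unique)
    ultimately have "(\<Sum>b\<in>X. scl (u (rep b)) (rep b)) \<in> ker" by (simp only:)
    from rep_B[OF X this] have z: "u (rep b) = 0" if "b \<in> X" for b using that .
    then have "(\<Sum>v\<in>T \<inter> N. scl (u v) v) = 0" using sum by simp
    then have zN: "u w = 0" if "w \<in> T \<inter> N" for w
      using independentD[OF N(2), of "T \<inter> N" u w] T(1) that by simp
    show False
    proof (cases "v \<in> N")
      case True
      then show False using zN[of v] T(4,5) by simp
    next
      case False
      then have "v \<in> rep ` X" unfolding TX[symmetric] using T(4) by simp
      then show False using z T(5) by auto
    qed
  qed
  define f where "f = W.construct (N \<union> rep ` B) (\<lambda>w. if w \<in> N then 0 else of_bool (P w))"
  have lin: "Vector_Spaces.linear scl (*) f" unfolding f_def by (rule W.linear_construct[OF indW])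
  interpret f: Vector_Spaces.linear scl "(*)" f by (rule lin)
  have fw: "f w = (if w \<in> N then 0 else of_bool (P w))" if "w \<in> N \<union> rep ` B" for w
    unfolding f_def by (rule W.construct_basis[OF indW that])
  have "span N \<subseteq> {s. f s = 0}"
    by (rule span_minimal) (use fw in \<open>auto simp: subspace_def f.zero f.add f.scale\<close>)
  then have fK: "f s = 0" if "s \<in> ker" for s using that N(3) by blast
  have "f s = of_bool (P s)" if s: "\<pi> s \<in> B" for s
  proof -
    have r: "\<pi> (rep (\<pi> s)) = \<pi> s" by (simp add: \<pi>_rep)
    have "rep (\<pi> s) \<notin> N"
    proof
      assume "rep (\<pi> s) \<in> N"
      then have "\<pi> s = \<zero>\<^bsub>A\<^esub>" using N(1) r by (auto simp: ker_def)
      then have "scl 1 (rep (\<pi> s)) \<in> ker" using r by (simp add: ker_def)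
      then show False using rep_B[of "{\<pi> s}" "\<lambda>_. 1" "\<pi> s"] s by simp
    qed
    then have "f (rep (\<pi> s)) = of_bool (P s)" using fw[of "rep (\<pi> s)"] s P[of "rep (\<pi> s)" s] r by simp
    moreover have "f (s - rep (\<pi> s)) = 0" using fK \<pi>_eq_iff[of s "rep (\<pi> s)"] r by simp
    ultimately show ?thesis by (simp add: f.diff)
  qed
  with lin fK show ?thesis by blast
qed

lemma contracted_semigroup_algebra_basis:
  assumes B: "V.basis B" and mult: "\<And>b c. b \<in> B \<Longrightarrow> c \<in> B \<Longrightarrow> b \<otimes>\<^bsub>A\<^esub> c = \<zero>\<^bsub>A\<^esub> \<or> b \<otimes>\<^bsub>A\<^esub> c \<in> B"
  shows "contracted_semigroup_algebra scl ker {a. \<pi> a \<in> B \<or> \<pi> a = \<zero>\<^bsub>A\<^esub>}"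
proof unfold_locales
  let ?S = "{a. \<pi> a \<in> B \<or> \<pi> a = \<zero>\<^bsub>A\<^esub>}"
  have BA: "B \<subseteq> carrier A" and gen: "V.span B = carrier A" using B unfolding V.basis_def by auto
  show "s * t \<in> ?S" if "s \<in> ?S" "t \<in> ?S" for s t
    using that mult[of "\<pi> s" "\<pi> t"] by (auto simp: \<pi>_mult)
  show kS: "ker \<subseteq> ?S" by (auto simp: ker_def)
  have repS: "rep ` B \<subseteq> ?S"
  proof
    fix w assume "w \<in> rep ` B"
    then obtain b where "w = rep b" "b \<in> B" by blast
    then have "\<pi> w \<in> B" using BA \<pi>_rep[of b] by auto
    then show "w \<in> ?S" by simp
  qed
  have "a \<in> span ?S" for a
    by (rule V_span_mem_span[OF _ BA refl kS repS]) (simp add: gen)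
  then show "span ?S = UNIV" by blast
  fix P assume P: "\<And>s t. s \<in> ?S \<Longrightarrow> t \<in> ?S \<Longrightarrow> s - t \<in> ker \<Longrightarrow> P s = P t" "\<And>s. s \<in> ker \<Longrightarrow> \<not> P s"
  obtain f where f: "Vector_Spaces.linear scl (*) f" "\<And>s. \<pi> s \<in> B \<Longrightarrow> f s = of_bool (P s)" "\<And>s. s \<in> ker \<Longrightarrow> f s = 0"
  proof -
    have "P s = P t" if "\<pi> s \<in> B" "\<pi> t \<in> B" "\<pi> s = \<pi> t" for s t
      using that \<pi>_eq_iff[of s t] by (intro P(1)) simp_all
    then show ?thesis using basis_functional[OF B, of P] that by blast
  qed
  have "f s = of_bool (P s)" if "s \<in> ?S" for s
    using that f(2,3) P(2) by (auto simp: ker_def)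
  with f(1) show "\<exists>f. Vector_Spaces.linear scl (*) f \<and> (\<forall>s\<in>?S. f s = of_bool (P s))" by blast
qed

lemma basis_image_span:
  assumes J: "subspace J" "ker \<subseteq> J" and B: "vectorspace.basis class_ring (A\<lparr>carrier := \<pi> ` J\<rparr>) (B \<inter> \<pi> ` J)"
  shows "J \<subseteq> span ({a. \<pi> a \<in> B \<or> \<pi> a = \<zero>\<^bsub>A\<^esub>} \<inter> J)"
proof
  interpret W: vectorspace class_ring "A\<lparr>carrier := \<pi> ` J\<rparr>" by (rule vectorspace_image[OF J(1)])
  let ?S = "{a. \<pi> a \<in> B \<or> \<pi> a = \<zero>\<^bsub>A\<^esub>}"
  \<comment> \<open>Spans inside the restricted carrier and inside the whole algebra agree for
    subsets of a submodule.\<close>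
  have eq: "W.span (B \<inter> \<pi> ` J) = V.span (B \<inter> \<pi> ` J)"
    by (rule V.span_li_not_depend(1)[OF _ submodule_image[OF J(1)]]) simp
  have "W.span (B \<inter> \<pi> ` J) = carrier (A\<lparr>carrier := \<pi> ` J\<rparr>)"
    using B unfolding W.basis_def by (elim conjE)
  then have gen: "V.span (B \<inter> \<pi> ` J) = \<pi> ` J"
    unfolding eq V.carrier_vs_is_self .
  have BJ: "B \<inter> \<pi> ` J \<subseteq> carrier A" by auto
  have kS: "ker \<subseteq> ?S \<inter> J" using J(2) by (auto simp: ker_def)
  have repS: "rep ` (B \<inter> \<pi> ` J) \<subseteq> ?S \<inter> J"
  proof
    fix w assume "w \<in> rep ` (B \<inter> \<pi> ` J)"
    then obtain j where j: "w = rep (\<pi> j)" "j \<in> J" "\<pi> j \<in> B" by blast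
    then have \<pi>w: "\<pi> w = \<pi> j" by (simp add: \<pi>_rep)
    then have "w - j \<in> J" using \<pi>_eq_iff[of w j] J(2) by blast
    from subspace_add[OF J(1) this j(2)] \<pi>w j(3) show "w \<in> ?S \<inter> J" by simp
  qed
  fix a assume "a \<in> J"
  then have "\<pi> a \<in> V.span (B \<inter> \<pi> ` J)" unfolding gen by (rule imageI)
  then show "a \<in> span (?S \<inter> J)" by (rule V_span_mem_span[OF _ BJ refl kS repS])
qed

text \<open>The image of \<open>J\<close> is a maximal left ideal because \<open>J\<close> has
  codimension one. If a maximal left ideal \<open>M\<close> did not contain it, then 1 = m + j with
  \<open>m\<close> in \<open>M\<close> and \<open>j\<close> nilpotent, so \<open>m\<close> would
  have a left inverse.\<close>

lemma jacobson_radical_image: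
  assumes J: "over_ideal J" and nil: "\<And>j. j \<in> J \<Longrightarrow> \<exists>n. j ^ n \<in> ker"
    and codim: "\<And>a. \<exists>c. a - scl c 1 \<in> J" and one: "1 \<notin> J"
  shows "jacobson_radical A = \<pi> ` J"
proof -
  note J' = over_idealD[OF J]
  have \<pi>_J: "\<pi> a \<in> \<pi> ` J \<longleftrightarrow> a \<in> J" for a
  proof
    assume "\<pi> a \<in> \<pi> ` J"
    then obtain j where "j \<in> J" "a - j \<in> J" using \<pi>_eq_iff J'(2) by blast
    then show "a \<in> J" using subspace_add[OF J'(1), of "a - j" j] by simp
  qed simp
  have left_idealD: "additive_subgroup M A" "r \<in> carrier A \<Longrightarrow> x \<in> M \<Longrightarrow> r \<otimes>\<^bsub>A\<^esub> x \<in> M" if "left_ideal M A" for M r x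
    using that unfolding left_ideal_def by auto
  have whole: "M = carrier A" if M: "left_ideal M A" and one: "\<one>\<^bsub>A\<^esub> \<in> M" for M
  proof -
    interpret M: additive_subgroup M A by (rule left_idealD[OF M])
    have "r \<in> M" if "r \<in> carrier A" for r using left_idealD(2)[OF M that one] that by simp
    then show ?thesis using M.a_subset by blast
  qed
  have left_J: "left_ideal (\<pi> ` J) A"
    unfolding left_ideal_def
  proof (intro conjI ballI)
    show "additive_subgroup (\<pi> ` J) A" by (rule additive_subgroup_image[OF J'(1)])
    fix r x assume "r \<in> carrier A" "x \<in> \<pi> ` J"
    then obtain a j where "r = \<pi> a" "x = \<pi> j" "j \<in> J" using range_\<pi> by blast
    then show "r \<otimes>\<^bsub>A\<^esub> x \<in> \<pi> ` J" using J'(3) by (simp flip: \<pi>_mult)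
  qed
  have "maximal_left_ideal (\<pi> ` J) A"
    unfolding maximal_left_ideal_def
  proof (intro conjI left_J allI impI)
    show "\<pi> ` J \<noteq> carrier A" using one \<pi>_J[of 1] by (metis \<pi>_carrier)
    fix N assume N: "left_ideal N A \<and> \<pi> ` J \<subseteq> N"
    interpret N: additive_subgroup N A using left_idealD(1) N by blast
    show "N = \<pi> ` J \<or> N = carrier A"
    proof (cases "N \<subseteq> \<pi> ` J")
      case False
      then obtain x where x: "x \<in> N" "x \<notin> \<pi> ` J" by blast
      then obtain a where a: "x = \<pi> a" using range_\<pi> N.a_subset by blast
      then have "a \<notin> J" using x by blast
      obtain c where c: "a - scl c 1 \<in> J" using codim by blast
      have "c \<noteq> 0" using c \<open>a \<notin> J\<close> by auto
      have "\<ominus>\<^bsub>A\<^esub> \<pi> (a - scl c 1) \<oplus>\<^bsub>A\<^esub> \<pi> a \<in> N" using c N x a by (intro N.a_closed N.a_inv_closed) auto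
      then have "\<pi> (scl c 1) \<in> N" by (simp flip: \<pi>_uminus \<pi>_add)
      then have "\<pi> (scl (inverse c) 1) \<otimes>\<^bsub>A\<^esub> \<pi> (scl c 1) \<in> N" using left_idealD(2) N by (meson \<pi>_carrier)
      then have "\<one>\<^bsub>A\<^esub> \<in> N"
        using \<open>c \<noteq> 0\<close> by (simp flip: \<pi>_mult \<pi>_one add: scl_mult_left)
      then show ?thesis using whole N by blast
    qed (use N in blast)
  qed
  moreover have "\<pi> ` J \<subseteq> M" if M: "maximal_left_ideal M A" for M
  proof (rule ccontr)
    assume "\<not> \<pi> ` J \<subseteq> M"
    have lM: "left_ideal M A" and neq: "M \<noteq> carrier A"
      and max: "\<And>N. left_ideal N A \<Longrightarrow> M \<subseteq> N \<Longrightarrow> N = M \<or> N = carrier A"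
      using M unfolding maximal_left_ideal_def by blast+
    interpret M: additive_subgroup M A by (rule left_idealD[OF lM])
    interpret \<pi>J: additive_subgroup "\<pi> ` J" A by (rule left_idealD[OF left_J])
    let ?N = "{m \<oplus>\<^bsub>A\<^esub> j | m j. m \<in> M \<and> j \<in> \<pi> ` J}"
    have lN: "left_ideal ?N A"
      unfolding left_ideal_def
    proof (intro conjI ballI)
      show "additive_subgroup ?N A"
      proof (rule additive_subgroup.intro, rule A.add.subgroupI)
        show "?N \<subseteq> carrier A" using M.a_subset \<pi>J.a_subset by auto
        show "?N \<noteq> {}" using M.zero_closed \<pi>J.zero_closed by blast
        fix x assume "x \<in> ?N"
        then obtain m j where x: "x = m \<oplus>\<^bsub>A\<^esub> j" "m \<in> M" "j \<in> \<pi> ` J" by blast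
        then have "m \<in> carrier A" "j \<in> carrier A" using M.a_subset \<pi>J.a_subset by auto
        then have "\<ominus>\<^bsub>A\<^esub> x = \<ominus>\<^bsub>A\<^esub> m \<oplus>\<^bsub>A\<^esub> \<ominus>\<^bsub>A\<^esub> j" using x by (simp add: A.minus_add)
        then show "\<ominus>\<^bsub>A\<^esub> x \<in> ?N" using x(2,3) M.a_inv_closed \<pi>J.a_inv_closed by blast
        fix y assume "y \<in> ?N"
        then obtain m' j' where y: "y = m' \<oplus>\<^bsub>A\<^esub> j'" "m' \<in> M" "j' \<in> \<pi> ` J" by blast
        then have "m' \<in> carrier A" "j' \<in> carrier A" using M.a_subset \<pi>J.a_subset by auto
        then have "x \<oplus>\<^bsub>A\<^esub> y = (m \<oplus>\<^bsub>A\<^esub> m') \<oplus>\<^bsub>A\<^esub> (j \<oplus>\<^bsub>A\<^esub> j')"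
          using x(1) y(1) \<open>m \<in> carrier A\<close> \<open>j \<in> carrier A\<close> by (simp add: A.a_ac)
        then show "x \<oplus>\<^bsub>A\<^esub> y \<in> ?N" using x(2,3) y(2,3) M.a_closed \<pi>J.a_closed by blast
      qed
      fix r x assume r: "r \<in> carrier A" and "x \<in> ?N"
      then obtain m j where x: "x = m \<oplus>\<^bsub>A\<^esub> j" "m \<in> M" "j \<in> \<pi> ` J" by blast
      then have "m \<in> carrier A" "j \<in> carrier A" using M.a_subset \<pi>J.a_subset by auto
      then have "r \<otimes>\<^bsub>A\<^esub> x = r \<otimes>\<^bsub>A\<^esub> m \<oplus>\<^bsub>A\<^esub> r \<otimes>\<^bsub>A\<^esub> j" using x r by (simp add: A.r_distr)
      moreover have "r \<otimes>\<^bsub>A\<^esub> m \<in> M" by (rule left_idealD(2)[OF lM r x(2)])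
      moreover have "r \<otimes>\<^bsub>A\<^esub> j \<in> \<pi> ` J" by (rule left_idealD(2)[OF left_J r x(3)])
      ultimately show "r \<otimes>\<^bsub>A\<^esub> x \<in> ?N" by blast
    qed
    have MN: "M \<subseteq> ?N"
    proof
      fix m assume m: "m \<in> M"
      then have "m = m \<oplus>\<^bsub>A\<^esub> \<zero>\<^bsub>A\<^esub>" using M.a_subset by auto
      then show "m \<in> ?N" using m \<pi>J.zero_closed by blast
    qed
    have neN: "?N \<noteq> M"
    proof -
      obtain j where j: "j \<in> \<pi> ` J" "j \<notin> M" using \<open>\<not> \<pi> ` J \<subseteq> M\<close> by blast
      then have "j = \<zero>\<^bsub>A\<^esub> \<oplus>\<^bsub>A\<^esub> j" using \<pi>J.a_subset by auto
      then have "j \<in> ?N" using j M.zero_closed by blast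
      with j show ?thesis by blast
    qed
    have "?N = carrier A"
      using max[OF lN MN]
    proof
      assume "?N = M"
      with neN show ?thesis by (rule notE)
    qed
    then have "\<one>\<^bsub>A\<^esub> \<in> ?N" using A.one_closed by (simp only:)
    then obtain m j where mj: "\<one>\<^bsub>A\<^esub> = m \<oplus>\<^bsub>A\<^esub> \<pi> j" "m \<in> M" "j \<in> J" by blast
    then have mc: "m \<in> carrier A" using M.a_subset by blast
    obtain a where a: "m = \<pi> a" using mc range_\<pi> by blast
    then have "\<pi> 1 = \<pi> (a + j)" using mj(1) by (simp add: \<pi>_one \<pi>_add)
    then have k: "1 - (a + j) \<in> ker" by (simp add: \<pi>_eq_iff)
    obtain n where n: "j ^ n \<in> ker" using nil mj(3) by blast
    \<comment> \<open>The geometric sum inverts 1 - j modulo \<open>ker\<close>, and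
      \<open>a\<close> is congruent to 1 - j.\<close>
    have "(\<Sum>i<n. j ^ i) * a - 1 = - ((\<Sum>i<n. j ^ i) * (1 - (a + j))) - j ^ n"
    proof -
      have "(\<Sum>i<n. j ^ i) * (1 - j) = 1 - j ^ n"
      proof (induction n)
        case (Suc n)
        have "(\<Sum>i<Suc n. j ^ i) * (1 - j) = (\<Sum>i<n. j ^ i) * (1 - j) + j ^ n * (1 - j)"
          by (simp add: distrib_right)
        also have "\<dots> = 1 - j ^ n + (j ^ n - j ^ Suc n)"
          by (simp only: Suc) (simp only: right_diff_distrib mult_1_right power_commutes power_Suc)
        finally show ?case by (simp only: diff_add_cancel add_diff_eq)
      qed simp
      then show ?thesis by (simp add: algebra_simps)
    qed
    also have "\<dots> \<in> ker" by (intro subspace_diff subspace_neg subspace_K K_left k n)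
    finally have "\<pi> (\<Sum>i<n. j ^ i) \<otimes>\<^bsub>A\<^esub> m = \<one>\<^bsub>A\<^esub>"
      using \<pi>_eq_iff[of "(\<Sum>i<n. j ^ i) * a" 1] by (simp add: \<pi>_mult \<pi>_one a)
    then have "\<one>\<^bsub>A\<^esub> \<in> M" using left_idealD(2)[OF lM _ mj(2), of "\<pi> (\<Sum>i<n. j ^ i)"] by simp
    with whole[OF lM] neq show False by blast
  qed
  ultimately show ?thesis unfolding jacobson_radical_def by auto
qed

end

text \<open>The two-stage quotient is the quotient of the free algebra by all relations at once, and
  the presentation is the composite of the two projections.\<close>

lemma restricted_enveloping_algebra_presentation:
  fixes scale :: "'f::field \<Rightarrow> 'l::ab_group_add \<Rightarrow> 'l"
  shows "\<exists>\<pi>. algebra_presentation scalar_mult (restricted_enveloping_algebra scale bracket pmap) \<pi> \<and>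
    algebra_presentation.ker (restricted_enveloping_algebra scale bracket pmap) \<pi> = restricted_ideal scale bracket pmap"
proof -
  let ?F = "free_algebra :: ('f, 'l word \<Rightarrow>\<^sub>0 'f) module"
  define E where "E = enveloping_ideal scale bracket"
  define U where "U = ?F Quot\<^sub>a E"
  define h where "h = (\<lambda>a. E +>\<^bsub>?F\<^esub> a)"
  define X where "X = {h (generator x) [^]\<^bsub>U\<^esub> CHAR('f) \<ominus>\<^bsub>U\<^esub> h (generator (pmap x)) | x. True}"
  define P where "P = Idl\<^bsub>U\<^esub> X"
  define A where "A = U Quot\<^sub>a P"
  define g where "g = (\<lambda>a. P +>\<^bsub>U\<^esub> a)"
  have A: "restricted_enveloping_algebra scale bracket pmap = A"
    by (simp add: restricted_enveloping_algebra_def universal_enveloping_algebra_def enveloping_map_def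
      A_def P_def X_def U_def E_def h_def Let_def)
  interpret F: ring ?F using scalar_ring_free_algebra unfolding scalar_ring_def by blast
  have idE: "ideal E ?F"
    unfolding E_def enveloping_ideal_def by (rule F.genideal_ideal) (simp add: free_algebra_simps)
  note q1 = quotient_algebra[OF scalar_ring_free_algebra idE, folded U_def, folded h_def]
  interpret h: ring_hom_ring ?F U h by (rule q1(3))
  have X: "X \<subseteq> carrier U"
    unfolding X_def using h.hom_closed by (auto simp: free_algebra_simps)
  have idP: "ideal P U" unfolding P_def by (rule h.S.genideal_ideal[OF X])
  note q2 = quotient_algebra[OF q1(1) idP, folded A_def, folded g_def]
  interpret g: ring_hom_ring U A g by (rule q2(3))
  have hc [simp]: "h a \<in> carrier U" for a using h.hom_closed[of a] by (simp add: free_algebra_simps)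
  have h_add: "h (a + b) = h a \<oplus>\<^bsub>U\<^esub> h b" for a b using h.hom_add[of a b] by (simp add: free_algebra_simps)
  have h_mult: "h (a * b) = h a \<otimes>\<^bsub>U\<^esub> h b" for a b using h.hom_mult[of a b] by (simp add: free_algebra_simps)
  have h_one: "h 1 = \<one>\<^bsub>U\<^esub>" using h.hom_one by (simp add: free_algebra_simps)
  have h_zero: "h 0 = \<zero>\<^bsub>U\<^esub>" using h.hom_zero by (simp add: free_algebra_simps)
  have h_uminus: "h (- a) = \<ominus>\<^bsub>U\<^esub> h a" for a
    by (rule h.S.minus_equality[symmetric]) (simp_all flip: h_add add: h_zero)
  have h_diff: "h (a - b) = h a \<ominus>\<^bsub>U\<^esub> h b" for a b
    using h_add[of a "- b"] by (simp add: h_uminus h.S.minus_eq)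
  have h_pow: "h (a ^ n) = h a [^]\<^bsub>U\<^esub> n" for a n
    by (induction n) (simp_all add: h_one h_mult power_commutes[symmetric] del: power_Suc add: power_Suc2)
  have h_surj: "range h = carrier U" using q1(2) by (simp add: free_algebra_simps)
  have h_ker: "h a = \<zero>\<^bsub>U\<^esub> \<longleftrightarrow> a \<in> E" for a using q1(4)[of a] by (simp add: free_algebra_simps)
  have "algebra_presentation scalar_mult A (g \<circ> h)"
  proof unfold_locales
    show "(g \<circ> h) (scalar_mult c a) = c \<odot>\<^bsub>A\<^esub> (g \<circ> h) a" for c a
      using q2(5)[of "h a" c] q1(5)[of a c] by (simp add: free_algebra_simps)
    show "range (g \<circ> h) = carrier A" using q2(2) h_surj by (metis image_comp)
  qed (simp_all add: h_add h_mult h_one)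
  then interpret \<pi>: algebra_presentation scalar_mult A "g \<circ> h" .
  let ?K = "restricted_ideal scale bracket pmap"
  have ker_iff: "a \<in> \<pi>.ker \<longleftrightarrow> h a \<in> P" for a using q2(4)[of "h a"] by (simp add: \<pi>.ker_def)
  have rel_X: "h (generator x ^ CHAR('f) - generator (pmap x)) \<in> X" for x
    unfolding X_def h_diff h_pow by blast
  have "?K \<subseteq> \<pi>.ker"
    unfolding restricted_ideal_def
  proof (rule ideal_closure_least)
    show "two_sided \<pi>.ker"
      unfolding two_sided_def
      using free.subspace_0[OF \<pi>.subspace_K] free.subspace_add[OF \<pi>.subspace_K] \<pi>.K_left \<pi>.K_right by blast
    have "enveloping_relations scale bracket \<subseteq> E"
      unfolding E_def enveloping_ideal_def by (rule F.genideal_self) (simp add: free_algebra_simps)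
    moreover have "\<zero>\<^bsub>U\<^esub> \<in> P" using idP additive_subgroup.zero_closed ideal.axioms(1) by blast
    then have "E \<subseteq> \<pi>.ker" using h_ker ker_iff by (metis subsetI)
    ultimately have "enveloping_relations scale bracket \<subseteq> \<pi>.ker" by (rule subset_trans)
    moreover have "h (generator x ^ CHAR('f) - generator (pmap x)) \<in> P" for x
      using rel_X h.S.genideal_self[OF X] unfolding P_def by blast
    then have "{generator x ^ CHAR('f) - generator (pmap x) | x. True} \<subseteq> \<pi>.ker"
      using ker_iff by blast
    ultimately show "restricted_relations scale bracket pmap \<subseteq> \<pi>.ker"
      unfolding restricted_relations_def by (rule Un_least)
  qed
  moreover have "\<pi>.ker \<subseteq> ?K"
  proof
    note K = two_sidedD[OF two_sided_restricted_ideal[of scale bracket pmap]]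
    have EK: "E \<subseteq> ?K"
      unfolding E_def enveloping_ideal_def
    proof (rule F.genideal_minimal)
      show "ideal ?K ?F" by (rule two_sided_ideal) (rule two_sided_restricted_ideal)
      show "enveloping_relations scale bracket \<subseteq> ?K"
        using ideal_closure_superset[of "restricted_relations scale bracket pmap"]
        unfolding restricted_ideal_def restricted_relations_def by blast
    qed
    \<comment> \<open>The image of the one-stage ideal is an ideal of \<open>U\<close> containing
      the p-th power relations, so it contains \<open>P\<close>. Lifting back changes an element
      only by \<open>E\<close>, which is part of \<open>?K\<close>.\<close>
    have "ideal (h ` ?K) U"
    proof (rule idealI[OF h.S.ring_axioms])
      show "subgroup (h ` ?K) (add_monoid U)"
      proof (rule h.S.add.subgroupI)
        show "h ` ?K \<noteq> {}" using K(1) by blast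
        show "\<ominus>\<^bsub>U\<^esub> x \<in> h ` ?K" if "x \<in> h ` ?K" for x
          using that K(5) by (auto simp flip: h_uminus)
        show "x \<oplus>\<^bsub>U\<^esub> y \<in> h ` ?K" if "x \<in> h ` ?K" "y \<in> h ` ?K" for x y
          using that K(2) by (auto simp flip: h_add)
      qed auto
      fix x r assume "x \<in> h ` ?K" "r \<in> carrier U"
      then obtain a b where ab: "x = h a" "r = h b" "a \<in> ?K" using h_surj by blast
      show "r \<otimes>\<^bsub>U\<^esub> x \<in> h ` ?K" unfolding ab h_mult[symmetric] by (rule imageI) (rule K(3)[OF ab(3)])
      show "x \<otimes>\<^bsub>U\<^esub> r \<in> h ` ?K" unfolding ab h_mult[symmetric] by (rule imageI) (rule K(4)[OF ab(3)])
    qed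
    moreover have "X \<subseteq> h ` ?K"
    proof
      fix y assume "y \<in> X"
      then obtain x where "y = h (generator x ^ CHAR('f) - generator (pmap x))"
        unfolding X_def h_diff h_pow by blast
      then show "y \<in> h ` ?K" using restricted_ideal_relations(4)[of x pmap scale bracket] by blast
    qed
    ultimately have PK: "P \<subseteq> h ` ?K" unfolding P_def by (rule h.S.genideal_minimal)
    fix a assume "a \<in> \<pi>.ker"
    then obtain k where k: "h a = h k" "k \<in> ?K" using PK ker_iff by blast
    then have "h (a - k) = \<zero>\<^bsub>U\<^esub>" using h_diff[of a k] h.S.r_neg[of "h k"] by (simp add: h.S.minus_eq)
    then have "a - k \<in> ?K" using h_ker EK by blast
    from K(2)[OF this k(2)] show "a \<in> ?K" by simp
  qed
  ultimately show ?thesis unfolding A using \<pi>.algebra_presentation_axioms by blast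
qed

section \<open>Filtered multiplicative bases of u(L) in class two\<close>

theorem theorem3:
  fixes scale :: "'f::field \<Rightarrow> 'l::ab_group_add \<Rightarrow> 'l"
    and bracket :: "'l \<Rightarrow> 'l \<Rightarrow> 'l"
    and pmap :: "'l \<Rightarrow> 'l"
  assumes "restricted_lie_algebra scale bracket pmap"
    and "\<exists>Basis. finite_dimensional_vector_space scale Basis"
    and "p_nilpotent pmap"
    and "nilpotency_class_2 scale bracket"
    and "CHAR('f) > 2"
  shows "\<not> (\<exists>B. filtered_multiplicative_basis (class_ring :: 'f ring)
                 (restricted_enveloping_algebra scale bracket pmap) B)"
proof
  interpret L: restricted_lie_algebra scale bracket pmap by fact
  have mem: "bracket x y \<in> lie_product scale bracket V W" if "x \<in> V" "y \<in> W" for x y V W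
    unfolding lie_product_def by (rule L.span_base) (use that in blast)
  interpret L: class2_restricted_lie_algebra scale bracket pmap
  proof unfold_locales
    show "bracket (bracket x y) z = 0" for x y z
      using mem[OF mem[OF UNIV_I UNIV_I] UNIV_I, of x y z] assms(4)
      unfolding nilpotency_class_2_def by simp
  qed (rule assms(5))
  have "\<exists>x y. bracket x y \<noteq> 0"
  proof (rule ccontr)
    assume "\<not> ?thesis"
    then have "{bracket x y | x y. x \<in> UNIV \<and> y \<in> UNIV} = {0}" by auto
    then have "lie_product scale bracket UNIV UNIV = {0}" unfolding lie_product_def by (simp add: L.span_insert_0)
    with assms(4) show False unfolding nilpotency_class_2_def by blast
  qed
  then obtain x y where xy: "bracket x y \<noteq> 0" by blast
  obtain Basis where "finite_dimensional_vector_space scale Basis" using assms(2) by blast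
  then interpret fd: finite_dimensional_vector_space scale Basis .
  note Basis = fd.finite_Basis fd.span_Basis
  obtain m where nil: "\<And>x. (pmap ^^ Suc m) x = 0" using L.uniformly_nilpotent[OF Basis assms(3)] by blast
  let ?A = "restricted_enveloping_algebra scale bracket pmap"
  let ?J = "augmentation_ideal :: ('l word \<Rightarrow>\<^sub>0 'f) set"
  obtain \<pi> where pres: "algebra_presentation scalar_mult ?A \<pi>"
    and ker: "algebra_presentation.ker ?A \<pi> = L.rel_ideal"
    using restricted_enveloping_algebra_presentation by blast
  interpret \<pi>: algebra_presentation scalar_mult ?A \<pi> by (rule pres)
  \<comment> \<open>This turns the radical clause of a filtered multiplicative basis into a
    statement about the augmentation ideal.\<close>
  have rad: "jacobson_radical ?A = \<pi> ` ?J"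
  proof (rule \<pi>.jacobson_radical_image)
    show "\<pi>.over_ideal ?J" unfolding ker by (rule L.over_ideal_augmentation)
    fix j assume j: "j \<in> ?J"
    obtain n where n: "\<And>xs. length xs = n \<Longrightarrow> set xs \<subseteq> ?J \<Longrightarrow> prod_list xs \<in> L.rel_ideal"
      using L.nilpotent_augmentation[OF Basis nil] unfolding L.U.nilpotent_over_def by blast
    have "prod_list (replicate n j) \<in> L.rel_ideal" by (rule n) (use j in auto)
    then show "\<exists>n. j ^ n \<in> \<pi>.ker" unfolding ker by (auto simp: prod_list_replicate)
  next
    show "\<exists>c. a - scalar_mult c 1 \<in> ?J" for a using augmentation_ideal_decompose by blast
    show "1 \<notin> ?J" by (simp add: augmentation_ideal_def)
  qed
  assume "\<exists>B. filtered_multiplicative_basis (class_ring :: 'f ring) ?A B"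
  then obtain B where B: "\<pi>.V.basis B"
    and mult: "\<And>b c. b \<in> B \<Longrightarrow> c \<in> B \<Longrightarrow> b \<otimes>\<^bsub>?A\<^esub> c = \<zero>\<^bsub>?A\<^esub> \<or> b \<otimes>\<^bsub>?A\<^esub> c \<in> B"
    and B_rad: "vectorspace.basis class_ring (?A\<lparr>carrier := \<pi> ` ?J\<rparr>) (B \<inter> \<pi> ` ?J)"
    unfolding filtered_multiplicative_basis_def rad by blast
  let ?S = "{a. \<pi> a \<in> B \<or> \<pi> a = \<zero>\<^bsub>?A\<^esub>}"
  have "contracted_semigroup_algebra scalar_mult L.rel_ideal ?S"
    using \<pi>.contracted_semigroup_algebra_basis[OF B mult] unfolding ker .
  moreover have "?J \<subseteq> free.span (?S \<inter> ?J)"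
  proof (rule \<pi>.basis_image_span[OF _ _ B_rad])
    show "free.subspace ?J" by (rule two_sided_subspace) (rule two_sided_augmentation_ideal)
    show "\<pi>.ker \<subseteq> ?J" unfolding ker by (rule L.rel_ideal_subset_augmentation)
  qed
  ultimately show False by (rule L.no_contracted_semigroup_algebra[OF Basis nil xy])
qed

end
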